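(* Let $\sigma\ge 1$ be a real number and $1\le p\le q\le\infty$. Let $u$ be the solution to $$u_{tt}+(-\Delta)^\sigma u+u_t+(-\Delta)^\sigma u_t=0,\quad u(0,x)=u_0(x),\quad u_t(0,x)=u_1(x),\qquad x\in\mathbb{R}^n,$$ and let $v$ be the solution to $$v_t+(-\Delta)^\sigma v=0,\quad v(0,x)=v_0(x):=u_0(x)+u_1(x).$$ Then, for large $t\ge 1$, the following $L^p$-$L^q$ estimate holds: $$\big\|\partial_t^j|D|^a\big(u_{\mathrm{low}}(t,\cdot)-v_{\mathrm{low}}(t,\cdot)\big)\big\|_{L^q}\lesssim(1+t)^{-\frac{n}{2\sigma}\left(\frac1p-\frac1q\right)-\frac{a}{2\sigma}-j-1}\big(\|u_0\|_{L^p}+\|u_1\|_{L^p}\big),$$ for all $a\ge 0$, $j=0,1$ and all space dimensions $n\ge 1$.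
   Context: $f\lesssim g$ means $f\le Cg$ with a constant $C>0$ (here independent of $t$ and of the data); "for large $t\ge1$" means for all sufficiently large $t$. $\hat f=\mathcal{F}f$ is the Fourier transform in $x$; $|D|^a$ is the Fourier multiplier with symbol $|\xi|^a$. $\chi=\chi(|\xi|)\in C_0^\infty(\mathbb{R}^n)$ is a fixed smooth radial cut-off function equal to $1$ for small $|\xi|$ and vanishing for large $|\xi|$, and $f_{\mathrm{low}}(t,x):=\mathcal{F}^{-1}\big(\chi(|\xi|)\hat f(t,\xi)\big)(x)$. The solution $u$ is given by $$\hat u(t,\xi)=\frac{e^{-t|\xi|^{2\sigma}}-|\xi|^{2\sigma}e^{-t}}{1-|\xi|^{2\sigma}}\widehat{u_0}(\xi)+\frac{e^{-t|\xi|^{2\sigma}}-e^{-t}}{1-|\xi|^{2\sigma}}\widehat{u_1}(\xi)$$ (multipliers extended continuously across $|\xi|=1$), and $v$ by $\hat v(t,\xi)=e^{-t|\xi|^{2\sigma}}\widehat{v_0}(\xi)$. The data $u_0,u_1$ are in $L^p(\mathbb{R}^n)$. *)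

theory Defs
  imports "HOL-Probability.Essential_Supremum"
begin

section \<open>Lebesgue spaces\<close>

text \<open>The exponent is an extended number, \<open>p = \<infinity>\<close> being the essential supremum.\<close>

definition Lp_norm :: "ennreal \<Rightarrow> ('a::euclidean_space \<Rightarrow> complex) \<Rightarrow> ennreal" where
  "Lp_norm p f =
    (if p = \<infinity> then esssup lborel (\<lambda>x. ennreal (norm (f x)))
     else let I = (\<integral>\<^sup>+ x. ennreal (norm (f x) powr enn2real p) \<partial>lborel)
          in if I = \<infinity> then \<infinity> else ennreal (enn2real I powr enn2real (1 / p)))"

definition Lp_space :: "ennreal \<Rightarrow> ('a::euclidean_space \<Rightarrow> complex) set" where
  "Lp_space p = {f \<in> borel_measurable lborel. Lp_norm p f < \<infinity>}"


section \<open>Smooth functions, cut-offs and Schwartz functions\<close>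

definition dir_deriv ::
  "'a::euclidean_space \<Rightarrow> ('a \<Rightarrow> 'b::real_normed_vector) \<Rightarrow> 'a \<Rightarrow> 'b" where
  "dir_deriv b f = (\<lambda>x. frechet_derivative f (at x) b)"

definition iter_deriv ::
  "'a::euclidean_space list \<Rightarrow> ('a \<Rightarrow> 'b::real_normed_vector) \<Rightarrow> 'a \<Rightarrow> 'b" where
  "iter_deriv bs f = foldr dir_deriv bs f"

definition smooth :: "('a::euclidean_space \<Rightarrow> 'b::real_normed_vector) \<Rightarrow> bool" where
  "smooth f \<longleftrightarrow> (\<forall>bs x. set bs \<subseteq> Basis \<longrightarrow> iter_deriv bs f differentiable (at x))"

definition schwartz :: "('a::euclidean_space \<Rightarrow> complex) \<Rightarrow> bool" where
  "schwartz f \<longleftrightarrow> smooth f \<and>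
    (\<forall>bs k. set bs \<subseteq> Basis \<longrightarrow>
      (\<exists>B. \<forall>x. (1 + norm x) ^ k * norm (iter_deriv bs f x) \<le> B))"

definition radial_cutoff :: "('a::euclidean_space \<Rightarrow> real) \<Rightarrow> bool" where
  "radial_cutoff chi \<longleftrightarrow>
    smooth chi \<and>
    (\<forall>\<xi> \<eta>. norm \<xi> = norm \<eta> \<longrightarrow> chi \<xi> = chi \<eta>) \<and>
    (\<exists>\<epsilon>>0. \<forall>\<xi>. norm \<xi> \<le> \<epsilon> \<longrightarrow> chi \<xi> = 1) \<and>
    (\<exists>R. \<forall>\<xi>. R \<le> norm \<xi> \<longrightarrow> chi \<xi> = 0)"


section \<open>Fourier transform of functions and of distributions\<close>

definition fourier :: "('a::euclidean_space \<Rightarrow> complex) \<Rightarrow> 'a \<Rightarrow> complex" where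
  "fourier f \<xi> = (LINT x|lborel. exp (- (\<i> * complex_of_real (x \<bullet> \<xi>))) * f x)"

definition inv_fourier :: "('a::euclidean_space \<Rightarrow> complex) \<Rightarrow> 'a \<Rightarrow> complex" where
  "inv_fourier f x =
    (LINT \<xi>|lborel. exp (\<i> * complex_of_real (x \<bullet> \<xi>)) * f \<xi>)
      / complex_of_real ((2 * pi) ^ DIM('a))"

text \<open>For \<open>f\<close> in \<open>L\<^sup>p\<close> with \<open>p > 2\<close> the Fourier transform is only a tempered distribution.
  Distributions are represented by their pairing with test functions, and
  \<open>\<F>\<close>, \<open>\<F>\<^sup>-\<^sup>1\<close> and multiplication by a function act by transposition. The
  functionals are not restricted to Schwartz functions: the symbols below are not smooth at
  the origin, so \<open>\<langle>m f, \<psi>\<rangle> = \<langle>f, m \<psi>\<rangle>\<close> leads to test functions \<open>m \<psi>\<close> that are not Schwartz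
  even if \<open>\<psi>\<close> is. The pairing of the Fourier transform of \<open>f\<close> with such a function is
  \<open>\<integral> f (\<F> (m \<psi>))\<close>.\<close>

type_synonym 'a dist = "('a \<Rightarrow> complex) \<Rightarrow> complex"

definition dist_of :: "('a::euclidean_space \<Rightarrow> complex) \<Rightarrow> 'a dist" where
  "dist_of f = (\<lambda>\<phi>. LINT x|lborel. f x * \<phi> x)"

definition dist_fourier :: "'a::euclidean_space dist \<Rightarrow> 'a dist" where
  "dist_fourier T = (\<lambda>\<phi>. T (fourier \<phi>))"

definition dist_inv_fourier :: "'a::euclidean_space dist \<Rightarrow> 'a dist" where
  "dist_inv_fourier T = (\<lambda>\<phi>. T (inv_fourier \<phi>))"

definition dist_mult :: "('a::euclidean_space \<Rightarrow> complex) \<Rightarrow> 'a dist \<Rightarrow> 'a dist" where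
  "dist_mult m T = (\<lambda>\<phi>. T (\<lambda>\<xi>. m \<xi> * \<phi> \<xi>))"

definition dist_add :: "'a dist \<Rightarrow> 'a dist \<Rightarrow> 'a dist" where
  "dist_add S T = (\<lambda>\<phi>. S \<phi> + T \<phi>)"

definition dist_diff :: "'a dist \<Rightarrow> 'a dist \<Rightarrow> 'a dist" where
  "dist_diff S T = (\<lambda>\<phi>. S \<phi> - T \<phi>)"

text \<open>The \<open>q\<close>-norm of a tempered distribution: the norm of the function in \<open>L\<^sup>q\<close>, unique up to
  null sets, that represents it, and \<open>\<infinity>\<close> (the infimum of the empty set) if there is none.\<close>

definition dist_Lp_norm :: "ennreal \<Rightarrow> 'a::euclidean_space dist \<Rightarrow> ennreal" where
  "dist_Lp_norm q T =
    Inf {Lp_norm q g | g. g \<in> Lp_space q \<and> (\<forall>\<phi>. schwartz \<phi> \<longrightarrow> T \<phi> = dist_of g \<phi>)}"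

definition fourier_multiplier ::
  "('a::euclidean_space \<Rightarrow> complex) \<Rightarrow> 'a dist \<Rightarrow> 'a dist" where
  "fourier_multiplier m T = dist_inv_fourier (dist_mult m (dist_fourier T))"

definition low :: "('a::euclidean_space \<Rightarrow> real) \<Rightarrow> 'a dist \<Rightarrow> 'a dist" where
  "low chi = fourier_multiplier (\<lambda>\<xi>. complex_of_real (chi \<xi>))"

text \<open>The case distinction is needed because \<open>0 powr 0 = 0\<close>.\<close>

definition abs_D :: "real \<Rightarrow> 'a::euclidean_space dist \<Rightarrow> 'a dist" where
  "abs_D a = fourier_multiplier
    (\<lambda>\<xi>. if a = 0 then 1 else complex_of_real (norm \<xi> powr a))"

text \<open>Time derivatives of a family of distributions are taken after pairing with a fixed
  test function.\<close>

definition time_deriv :: "(real \<Rightarrow> 'a dist) \<Rightarrow> real \<Rightarrow> 'a dist" where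
  "time_deriv T = (\<lambda>t \<phi>. vector_derivative (\<lambda>s. T s \<phi>) (at t))"


section \<open>The solutions\<close>

text \<open>\<open>sol_u\<close> solves \<open>u\<^sub>t\<^sub>t + (-\<Delta>)\<^sup>\<sigma> u + u\<^sub>t + (-\<Delta>)\<^sup>\<sigma> u\<^sub>t = 0\<close>, \<open>u(0) = u\<^sub>0\<close>, \<open>u\<^sub>t(0) = u\<^sub>1\<close>, and
  \<open>sol_v\<close> solves \<open>v\<^sub>t + (-\<Delta>)\<^sup>\<sigma> v = 0\<close>, \<open>v(0) = v\<^sub>0\<close>; both are given by their Fourier
  transforms. With \<open>r = norm \<xi> powr (2 * \<sigma>)\<close>, the value at \<open>r = 1\<close> is the limit of the
  quotient as \<open>r\<close> tends to \<open>1\<close>.\<close>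

definition symb0 :: "real \<Rightarrow> real \<Rightarrow> 'a::euclidean_space \<Rightarrow> real" where
  "symb0 \<sigma> t \<xi> = (let r = norm \<xi> powr (2 * \<sigma>) in
     if r = 1 then (1 + t) * exp (- t)
     else (exp (- t * r) - r * exp (- t)) / (1 - r))"

definition symb1 :: "real \<Rightarrow> real \<Rightarrow> 'a::euclidean_space \<Rightarrow> real" where
  "symb1 \<sigma> t \<xi> = (let r = norm \<xi> powr (2 * \<sigma>) in
     if r = 1 then t * exp (- t)
     else (exp (- t * r) - exp (- t)) / (1 - r))"

definition sol_u :: "real \<Rightarrow> ('a::euclidean_space \<Rightarrow> complex) \<Rightarrow> ('a \<Rightarrow> complex) \<Rightarrow>
    real \<Rightarrow> 'a dist" where
  "sol_u \<sigma> u0 u1 t = dist_inv_fourier (dist_add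
     (dist_mult (\<lambda>\<xi>. complex_of_real (symb0 \<sigma> t \<xi>)) (dist_fourier (dist_of u0)))
     (dist_mult (\<lambda>\<xi>. complex_of_real (symb1 \<sigma> t \<xi>)) (dist_fourier (dist_of u1))))"

definition sol_v :: "real \<Rightarrow> ('a::euclidean_space \<Rightarrow> complex) \<Rightarrow> real \<Rightarrow> 'a dist" where
  "sol_v \<sigma> v0 t = dist_inv_fourier
     (dist_mult (\<lambda>\<xi>. complex_of_real (exp (- t * norm \<xi> powr (2 * \<sigma>))))
       (dist_fourier (dist_of v0)))"

end

theory Submission
  imports Defs "HOL-Probability.Characteristic_Functions" "HOL-Probability.Sinc_Integral"
begin

text \<open>With \<open>r = |\<xi>|\<^sup>2\<^sup>\<sigma>\<close> and \<open>w(t) = \<integral>\<^sub>0\<^sup>t exp (- (t - \<tau>)) exp (- \<tau> r) d\<tau>\<close>, the difference \<open>u - v\<close> has the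
  symbols \<open>r w\<close> (acting on \<open>u\<^sub>0\<close>) and \<open>r w - exp (- t)\<close> (acting on \<open>u\<^sub>1\<close>), and
  \<open>\<partial>\<^sub>t w = exp (- t) - r w\<close>. Hence all symbols are superpositions over \<open>\<tau>\<close> of heat symbols
  \<open>|\<xi>|\<^sup>c exp (- \<tau> |\<xi>|\<^sup>2\<^sup>\<sigma>)\<close>, and the decay rates come from the scaling of their kernels in \<open>L\<^sup>1\<close> and
  \<open>L\<^sup>\<infinity>\<close>, followed by Young's inequality. It remains to see that \<open>|\<xi>|\<^sup>c exp (- |\<xi>|\<^sup>2\<^sup>\<sigma>)\<close>, which is not
  smooth at the origin, has an integrable kernel for \<open>c > 0\<close>. Taylor's formula at infinity writes
  \<open>f(|\<xi>|\<^sup>2)\<close> as \<open>\<integral>\<^sub>0\<^sup>\<infinity> (u\<^sup>M / M!) (1 - |\<xi>|\<^sup>2 / u)\<^sub>+\<^sup>M (-1)\<^sup>M\<^sup>+\<^sup>1 f\<^sup>(\<^sup>M\<^sup>+\<^sup>1\<^sup>)(u) du\<close>, a superposition of dilates of one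
  symbol which is compactly supported and as smooth as desired, and \<open>u\<^sup>M f\<^sup>(\<^sup>M\<^sup>+\<^sup>1\<^sup>)(u)\<close> is
  integrable for \<open>f(u) = u\<^sup>c\<^sup>/\<^sup>2 exp (- u\<^sup>\<sigma>)\<close>.\<close>

section \<open>Fourier inversion\<close>

text \<open>Near \<tau> = 0 scaling alone fails: the kernel of |\<xi>|^c exp (- \<tau>
  |\<xi>|^(2\<sigma>)) has mass of order \<tau>^(-c/(2\<sigma>)), which is not integrable for the
  powers c >= 2\<sigma> that occur. There the cut-off helps: one half of |\<xi>|^(2\<sigma>) stays
  with the heat symbol and costs only \<tau>^(-1/2), the cut-off absorbs the rest, and the factor
  exp (- t) makes this part decay exponentially. A second obstacle is that |D|^a stands outside the
  cut-off. By transposition it meets the test function first, as an unbounded symbol without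
  integrable kernel. It is therefore written as one symbol with integrable kernel plus |\<xi>|^(2k)
  times another; the polynomial turns into derivatives of the test function, or is absorbed by the
  cut-off. The time derivative is taken after pairing, so it is enough to bound the first-order
  Taylor remainder of the symbol by a multiple of h^2 in the L^1 norm of its kernel. In Young's
  inequality the L^1 bound of the kernel enters with weight 1 - \<theta> and its sup bound with
  weight \<theta> = 1/p - 1/q.\<close>

lemma lborel_integrable_affine:
  fixes f :: "'a::euclidean_space \<Rightarrow> 'b::{banach, second_countable_topology}"
  assumes c: "c \<noteq> 0" and f: "integrable lborel f"
  shows "integrable lborel (\<lambda>x. f (t + c *\<^sub>R x))"
proof -
  have "integrable (density (distr lborel borel (\<lambda>x. t + c *\<^sub>R x)) (\<lambda>_. ennreal (\<bar>c\<bar>^DIM('a)))) f"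
    using f lborel_affine[OF c, of t] by simp
  then have "integrable lborel (\<lambda>x. \<bar>c\<bar>^DIM('a) *\<^sub>R f (t + c *\<^sub>R x))"
    using c f by (subst (asm) integrable_density) (auto simp: integrable_distr_eq)
  then have "integrable lborel (\<lambda>x. inverse (\<bar>c\<bar>^DIM('a)) *\<^sub>R (\<bar>c\<bar>^DIM('a) *\<^sub>R f (t + c *\<^sub>R x)))"
    by (rule integrable_scaleR_right)
  then show ?thesis
    using c by simp
qed

lemma lborel_integral_affine:
  fixes f :: "'a::euclidean_space \<Rightarrow> 'b::{banach, second_countable_topology}"
  assumes c: "c \<noteq> 0" and f: "f \<in> borel_measurable borel"
  shows "(LINT x|lborel. f x) = \<bar>c\<bar>^DIM('a) *\<^sub>R (LINT x|lborel. f (t + c *\<^sub>R x))"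
proof -
  have "(LINT x|lborel. f x) = (LINT x|density (distr lborel borel (\<lambda>x. t + c *\<^sub>R x)) (\<lambda>_. ennreal (\<bar>c\<bar>^DIM('a))). f x)"
    using lborel_affine[OF c, of t] by simp
  also have "\<dots> = \<bar>c\<bar>^DIM('a) *\<^sub>R (LINT x|lborel. f (t + c *\<^sub>R x))"
    using f by (subst integral_density) (auto simp: integral_distr)
  finally show ?thesis .
qed

lemma lborel_integral_shift:
  fixes f :: "'a::euclidean_space \<Rightarrow> 'b::{banach, second_countable_topology}"
  assumes "f \<in> borel_measurable borel"
  shows "(LINT x|lborel. f (x + t)) = (LINT x|lborel. f x)"
  using lborel_integral_affine[of 1 f t] assms by (simp add: add.commute)

lemma lborel_integral_minus:
  fixes f :: "'a::euclidean_space \<Rightarrow> 'b::{banach, second_countable_topology}"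
  assumes "f \<in> borel_measurable borel"
  shows "(LINT x|lborel. f (t - x)) = (LINT x|lborel. f x)"
  using lborel_integral_affine[of "-1" f t] assms by simp

lemma lborel_integrable_shift:
  fixes f :: "'a::euclidean_space \<Rightarrow> 'b::{banach, second_countable_topology}"
  assumes "integrable lborel f"
  shows "integrable lborel (\<lambda>x. f (x + t))"
  using lborel_integrable_affine[of 1 f t] assms by (simp add: add.commute)

lemma lborel_integrable_minus:
  fixes f :: "'a::euclidean_space \<Rightarrow> 'b::{banach, second_countable_topology}"
  assumes "integrable lborel f"
  shows "integrable lborel (\<lambda>x. f (t - x))"
  using lborel_integrable_affine[of "-1" f t] assms by simp

text \<open>\<open>lborel\<close> on a Euclidean space is the image of a product of real Lebesgue
  measures under \<open>T\<close>, which assembles a vector from its coordinates; Fubini for finite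
  products is transported along it.\<close>

lemma
  fixes f :: "'a::euclidean_space \<Rightarrow> real \<Rightarrow> 'b::{real_normed_field, banach, second_countable_topology}"
  assumes "\<And>b. b \<in> Basis \<Longrightarrow> integrable lborel (f b)"
  shows integrable_prod_Basis: "integrable lborel (\<lambda>x::'a. \<Prod>b\<in>Basis. f b (x \<bullet> b))"
    and integral_prod_Basis:
      "(LINT x|lborel. (\<Prod>b\<in>Basis. f b (x \<bullet> b))) = (\<Prod>b\<in>Basis. LINT y|lborel. f b y)"
proof -
  interpret product_sigma_finite "\<lambda>_::'a. lborel :: real measure"
    by unfold_locales
  define T where "T = (\<lambda>g::'a \<Rightarrow> real. \<Sum>b\<in>Basis. g b *\<^sub>R b)"
  define P where "P = (\<Pi>\<^sub>M b\<in>(Basis::'a set). (lborel::real measure))"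
  have lb: "lborel = distr P borel T"
    unfolding P_def T_def lborel_def[where 'a='a] lborel_eq_real[symmetric] ..
  have T: "T \<in> borel_measurable P"
    unfolding T_def P_def by measurable
  have Tb: "T g \<bullet> b = g b" if "b \<in> Basis" for g b
    using that by (simp add: T_def inner_sum_left inner_Basis if_distrib cong: if_cong)
  have [measurable]: "f b \<in> borel_measurable borel" if "b \<in> Basis" for b
    using assms[OF that] by auto
  have m: "(\<lambda>x::'a. \<Prod>b\<in>Basis. f b (x \<bullet> b)) \<in> borel_measurable borel"
    by measurable
  have eq: "(\<lambda>g. \<Prod>b\<in>Basis. f b (T g \<bullet> b)) = (\<lambda>g. \<Prod>b\<in>Basis. f b (g b))"
    by (simp add: Tb)
  show "integrable lborel (\<lambda>x::'a. \<Prod>b\<in>Basis. f b (x \<bullet> b))"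
    unfolding lb using product_integrable_prod[of Basis f] assms
    by (subst integrable_distr_eq[OF T m]) (simp add: eq P_def)
  show "(LINT x|lborel. (\<Prod>b\<in>Basis. f b (x \<bullet> b))) = (\<Prod>b\<in>Basis. LINT y|lborel. f b y)"
    unfolding lb using product_integral_prod[of Basis f] assms
    by (subst integral_distr[OF T m]) (simp add: eq P_def)
qed

section \<open>The Fourier integral and convolution\<close>

text \<open>Up to a reflection and a constant factor this is both \<open>fourier\<close> and
  \<open>inv_fourier\<close>, so that one set of lemmas serves the two.\<close>

definition ft :: "('a::euclidean_space \<Rightarrow> complex) \<Rightarrow> 'a \<Rightarrow> complex" where
  "ft f \<xi> = (LINT y|lborel. cis (\<xi> \<bullet> y) * f y)"

lemma fourier_eq_ft: "fourier f \<xi> = ft f (- \<xi>)"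
  by (simp add: fourier_def ft_def cis_conv_exp inner_commute)

lemma inv_fourier_eq_ft: "inv_fourier f x = ft f x / of_real ((2 * pi) ^ DIM('a))"
  for x :: "'a::euclidean_space"
  by (simp add: inv_fourier_def ft_def cis_conv_exp)

lemma measurable_cis [measurable (raw)]:
  "f \<in> borel_measurable M \<Longrightarrow> (\<lambda>x. cis (f x)) \<in> borel_measurable M"
  unfolding cis_conv_exp by measurable

lemma integrable_cis_mult:
  assumes "integrable M f" "g \<in> borel_measurable M"
  shows "integrable M (\<lambda>y. cis (g y) * f y)"
  using assms by (intro Bochner_Integration.integrable_bound[OF assms(1)]) (auto simp: norm_mult)

lemma integrable_ft: "integrable lborel f \<Longrightarrow> integrable lborel (\<lambda>y. cis (\<xi> \<bullet> y) * f y)"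
  by (intro integrable_cis_mult) auto

lemma borel_measurable_ft [measurable]:
  fixes f :: "'a::euclidean_space \<Rightarrow> complex"
  assumes [measurable]: "f \<in> borel_measurable borel"
  shows "ft f \<in> borel_measurable borel"
  unfolding ft_def[abs_def] by measurable

lemma norm_ft_le: "norm (ft f \<xi>) \<le> (LINT y|lborel. norm (f y))"
  unfolding ft_def by (rule order_trans[OF integral_norm_bound]) (simp add: norm_mult)

lemma continuous_ft:
  fixes f :: "'a::euclidean_space \<Rightarrow> complex"
  assumes f: "integrable lborel f"
  shows "continuous_on UNIV (ft f)"
proof (unfold continuous_on_sequentially, intro allI ballI impI)
  fix X :: "nat \<Rightarrow> 'a" and a assume "(\<forall>n. X n \<in> UNIV) \<and> X \<longlonglongrightarrow> a"
  then have X: "X \<longlonglongrightarrow> a" by simp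
  have [measurable]: "f \<in> borel_measurable borel" using f by auto
  show "(ft f \<circ> X) \<longlonglongrightarrow> ft f a"
    unfolding ft_def o_def
  proof (rule integral_dominated_convergence[where w="\<lambda>y. norm (f y)"])
    show "integrable lborel (\<lambda>y. norm (f y))" using f by auto
    show "AE x in lborel. (\<lambda>i. cis (X i \<bullet> x) * f x) \<longlonglongrightarrow> cis (a \<bullet> x) * f x"
      unfolding cis_conv_exp by (intro AE_I2 tendsto_intros X)
  qed (auto simp: norm_mult)
qed

lemma ft_add: "integrable lborel f \<Longrightarrow> integrable lborel g \<Longrightarrow> ft (\<lambda>x. f x + g x) \<xi> = ft f \<xi> + ft g \<xi>"
  unfolding ft_def distrib_left by (intro Bochner_Integration.integral_add integrable_ft)

lemma ft_cmult: "ft (\<lambda>x. c * f x) \<xi> = c * ft f \<xi>"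
  unfolding ft_def mult.left_commute[of _ c] by simp

text \<open>The kernel \<open>cis (x \<bullet> y)\<close> is symmetric in its two arguments, so
  Fubini moves the transform from one factor to the other.\<close>

lemma ft_swap:
  fixes f g :: "'a::euclidean_space \<Rightarrow> complex"
  assumes f: "integrable lborel f" and g: "integrable lborel g"
  shows "(LINT x|lborel. ft f x * g x) = (LINT y|lborel. f y * ft g y)"
proof -
  have [measurable]: "f \<in> borel_measurable borel" "g \<in> borel_measurable borel"
    using f g by auto
  have int: "integrable (lborel \<Otimes>\<^sub>M lborel) (\<lambda>(x, y). cis (x \<bullet> y) * f y * g x)"
  proof (rule lborel_pair.Fubini_integrable)
    show "(\<lambda>(x, y). cis (x \<bullet> y) * f y * g x) \<in> borel_measurable (lborel \<Otimes>\<^sub>M lborel)"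
      by measurable
    show "integrable lborel (\<lambda>x. LINT y|lborel. norm (case (x, y) of (x, y) \<Rightarrow> cis (x \<bullet> y) * f y * g x))"
      using g by (simp add: norm_mult)
    show "AE x in lborel. integrable lborel (\<lambda>y. case (x, y) of (x, y) \<Rightarrow> cis (x \<bullet> y) * f y * g x)"
      using integrable_ft[OF f] by simp
  qed
  have "(LINT x|lborel. ft f x * g x) = (LINT x|lborel. LINT y|lborel. cis (x \<bullet> y) * f y * g x)"
    unfolding ft_def by (intro Bochner_Integration.integral_cong refl) (simp add: integrable_ft f)
  also have "\<dots> = (LINT y|lborel. LINT x|lborel. cis (x \<bullet> y) * f y * g x)"
    using lborel_pair.Fubini_integral[OF int] by simp
  also have "\<dots> = (LINT y|lborel. f y * ft g y)"
    unfolding ft_def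
    by (intro Bochner_Integration.integral_cong refl)
       (simp add: integral_mult_right_zero[symmetric] mult_ac inner_commute del: integral_mult_right_zero)
  finally show ?thesis .
qed

definition conv :: "('a::euclidean_space \<Rightarrow> complex) \<Rightarrow> ('a \<Rightarrow> complex) \<Rightarrow> 'a \<Rightarrow> complex" where
  "conv f g x = (LINT y|lborel. f y * g (x - y))"

lemma integrable_conv_pair:
  fixes f g :: "'a::euclidean_space \<Rightarrow> complex"
  assumes f: "integrable lborel f" and g: "integrable lborel g"
  shows "integrable (lborel \<Otimes>\<^sub>M lborel) (\<lambda>(y, x). f y * g (x - y))"
proof (rule lborel_pair.Fubini_integrable)
  have [measurable]: "f \<in> borel_measurable borel" "g \<in> borel_measurable borel"
    using f g by auto
  show "(\<lambda>(y, x). f y * g (x - y)) \<in> borel_measurable (lborel \<Otimes>\<^sub>M lborel)"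
    by measurable
  show "integrable lborel (\<lambda>y. LINT x|lborel. norm (case (y, x) of (y, x) \<Rightarrow> f y * g (x - y)))"
    using f lborel_integral_shift[of "\<lambda>x. norm (g x)" "- y" for y] by (simp add: norm_mult)
  show "AE y in lborel. integrable lborel (\<lambda>x. case (y, x) of (y, x) \<Rightarrow> f y * g (x - y))"
    using lborel_integrable_shift[OF g, of "- y" for y] by simp
qed

lemma
  fixes f g :: "'a::euclidean_space \<Rightarrow> complex"
  assumes f: "integrable lborel f" and g: "integrable lborel g"
  shows integrable_conv: "integrable lborel (conv f g)"
    and norm_conv_L1: "(LINT x|lborel. norm (conv f g x)) \<le> (LINT x|lborel. norm (f x)) * (LINT x|lborel. norm (g x))"
    and ft_conv: "ft (conv f g) \<xi> = ft f \<xi> * ft g \<xi>"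
proof -
  have [measurable]: "f \<in> borel_measurable borel" "g \<in> borel_measurable borel"
    using f g by auto
  note int = integrable_conv_pair[OF f g]
  show ic: "integrable lborel (conv f g)"
    unfolding conv_def[abs_def]
    using lborel_pair.integrable_snd[OF int] by simp
  have intn: "integrable (lborel \<Otimes>\<^sub>M lborel) (\<lambda>(y, x). norm (f y) * norm (g (x - y)))"
    using integrable_norm[OF int] by (simp add: norm_mult case_prod_unfold)
  have "(LINT x|lborel. norm (conv f g x)) \<le> (LINT x|lborel. LINT y|lborel. norm (f y) * norm (g (x - y)))"
  proof (intro integral_mono integrable_norm ic)
    show "integrable lborel (\<lambda>x. LINT y|lborel. norm (f y) * norm (g (x - y)))"
      using lborel_pair.integrable_snd[OF intn] by simp
    show "norm (conv f g x) \<le> (LINT y|lborel. norm (f y) * norm (g (x - y)))" for x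
      unfolding conv_def by (rule order_trans[OF integral_norm_bound]) (simp add: norm_mult)
  qed
  also have "\<dots> = (LINT y|lborel. LINT x|lborel. norm (f y) * norm (g (x - y)))"
    using lborel_pair.Fubini_integral[OF intn] by simp
  also have "\<dots> = (LINT x|lborel. norm (f x)) * (LINT x|lborel. norm (g x))"
    using lborel_integral_shift[of "\<lambda>x. norm (g x)" "- y" for y] by simp
  finally show "(LINT x|lborel. norm (conv f g x)) \<le> (LINT x|lborel. norm (f x)) * (LINT x|lborel. norm (g x))" .
  have int2: "integrable (lborel \<Otimes>\<^sub>M lborel) (\<lambda>(y, x). cis (\<xi> \<bullet> x) * (f y * g (x - y)))"
    using integrable_cis_mult[OF int, of "\<lambda>(y,x). \<xi> \<bullet> x"] by (simp add: case_prod_unfold)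
  have "ft (conv f g) \<xi> = (LINT x|lborel. LINT y|lborel. cis (\<xi> \<bullet> x) * (f y * g (x - y)))"
    unfolding ft_def conv_def by simp
  also have "\<dots> = (LINT y|lborel. LINT x|lborel. cis (\<xi> \<bullet> x) * (f y * g (x - y)))"
    using lborel_pair.Fubini_integral[OF int2] by simp
  also have "\<dots> = (LINT y|lborel. cis (\<xi> \<bullet> y) * f y * ft g \<xi>)"
  proof (intro Bochner_Integration.integral_cong refl)
    fix y
    \<comment> \<open>Translation by \<open>y\<close> factors the character and leaves
      \<open>ft g \<xi>\<close>.\<close>
    have "(LINT x|lborel. cis (\<xi> \<bullet> x) * (f y * g (x - y))) =
        (LINT x|lborel. cis (\<xi> \<bullet> (x + y)) * (f y * g (x + y - y)))"
      by (rule lborel_integral_shift[symmetric]) measurable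
    also have "\<dots> = (LINT x|lborel. (cis (\<xi> \<bullet> y) * f y) * (cis (\<xi> \<bullet> x) * g x))"
      by (intro Bochner_Integration.integral_cong refl) (simp add: inner_add_right cis_mult[symmetric] mult_ac)
    finally show "(LINT x|lborel. cis (\<xi> \<bullet> x) * (f y * g (x - y))) = cis (\<xi> \<bullet> y) * f y * ft g \<xi>"
      by (simp add: ft_def)
  qed
  also have "\<dots> = ft f \<xi> * ft g \<xi>"
    by (simp add: ft_def)
  finally show "ft (conv f g) \<xi> = ft f \<xi> * ft g \<xi>" .
qed

lemma norm_conv_le:
  fixes f g :: "'a::euclidean_space \<Rightarrow> complex"
  assumes f: "integrable lborel f" and B: "\<And>y. norm (g y) \<le> B"
  shows "norm (conv f g x) \<le> (LINT y|lborel. norm (f y)) * B"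
proof -
  have B0: "0 \<le> B" using norm_ge_zero[of "g 0"] B[of 0] by linarith
  have "norm (conv f g x) \<le> (LINT y|lborel. norm (f y * g (x - y)))"
    unfolding conv_def by (rule integral_norm_bound)
  also have "\<dots> \<le> (LINT y|lborel. norm (f y) * B)"
    using f B B0 by (intro integral_mono') (auto simp: norm_mult mult_left_mono)
  finally show ?thesis by simp
qed

section \<open>Gaussian summability and the inversion theorem\<close>

text \<open>Written as a product of normal densities, so that its transform comes from the
  characteristic function of the one-dimensional normal law.\<close>

definition gauss :: "'a::euclidean_space \<Rightarrow> real" where
  "gauss x = (\<Prod>b\<in>Basis. std_normal_density (x \<bullet> b))"

lemma gauss_eq: "gauss x = exp (- (norm x)\<^sup>2 / 2) / sqrt (2 * pi) ^ DIM('a)"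
  for x :: "'a::euclidean_space"
proof -
  have "(norm x)\<^sup>2 = (\<Sum>b\<in>Basis. (x \<bullet> b)\<^sup>2)"
    unfolding power2_norm_eq_inner euclidean_inner[of x x] by (simp add: power2_eq_square)
  then show ?thesis
    by (simp add: gauss_def std_normal_density_def prod_dividef exp_sum[symmetric] sum_negf sum_divide_distrib)
qed

lemma gauss_nonneg: "0 \<le> gauss x"
  by (simp add: gauss_def prod_nonneg)

lemma borel_measurable_gauss [measurable]: "gauss \<in> borel_measurable borel"
  unfolding gauss_def[abs_def] by measurable

lemma integrable_gauss: "integrable lborel (gauss :: 'a::euclidean_space \<Rightarrow> real)"
  using integrable_prod_Basis[of "\<lambda>_::'a. std_normal_density"] integrable_std_normal_moment[of 0]
  by (simp add: gauss_def[abs_def])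

lemma ft_gauss: "ft (\<lambda>x. of_real (gauss x)) \<xi> = of_real (exp (- (norm \<xi>)\<^sup>2 / 2))"
  for \<xi> :: "'a::euclidean_space"
proof -
  have sn: "integrable lborel (\<lambda>x. std_normal_density x)"
    using integrable_std_normal_moment[of 0] by simp
  have i: "integrable lborel (\<lambda>y. cis (t * y) * complex_of_real (std_normal_density y))" for t :: real
    using sn by (intro integrable_cis_mult integrable_of_real) auto
  have one: "(LINT y|lborel. cis (t * y) * complex_of_real (std_normal_density y)) = of_real (exp (- t\<^sup>2 / 2))" for t
  proof -
    have "char std_normal_distribution t = (LINT y|lborel. std_normal_density y *\<^sub>R iexp (t * y))"
      unfolding char_def by (subst integral_density) auto
    then show ?thesis
      by (simp add: char_std_normal_distribution cis_conv_exp scaleR_conv_of_real mult.commute)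
  qed
  have "ft (\<lambda>x. of_real (gauss x)) \<xi> =
      (LINT y|lborel. (\<Prod>b\<in>Basis. cis ((\<xi> \<bullet> b) * (y \<bullet> b)) * of_real (std_normal_density (y \<bullet> b))))"
    unfolding ft_def
  proof (intro Bochner_Integration.integral_cong refl)
    fix y :: 'a
    have "cis (\<xi> \<bullet> y) = (\<Prod>b\<in>Basis. cis ((\<xi> \<bullet> b) * (y \<bullet> b)))"
      unfolding euclidean_inner[of \<xi> y] cis_conv_exp by (simp add: exp_sum[symmetric] sum_distrib_left)
    then show "cis (\<xi> \<bullet> y) * of_real (gauss y) =
        (\<Prod>b\<in>Basis. cis ((\<xi> \<bullet> b) * (y \<bullet> b)) * of_real (std_normal_density (y \<bullet> b)))"
      by (simp add: gauss_def prod.distrib)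
  qed
  also have "\<dots> = (\<Prod>b\<in>Basis. of_real (exp (- (\<xi> \<bullet> b)\<^sup>2 / 2)))"
    using integral_prod_Basis[of "\<lambda>b y. cis ((\<xi> \<bullet> b) * y) * of_real (std_normal_density y)", OF i]
    by (simp add: one)
  also have "\<dots> = of_real (exp (\<Sum>b\<in>Basis. - (\<xi> \<bullet> b)\<^sup>2 / 2))"
    by (simp add: exp_sum)
  also have "(\<Sum>b\<in>Basis. - (\<xi> \<bullet> b)\<^sup>2 / 2) = - (norm \<xi>)\<^sup>2 / 2"
    unfolding power2_norm_eq_inner euclidean_inner[of \<xi> \<xi>]
    by (simp add: power2_eq_square sum_negf sum_divide_distrib)
  finally show ?thesis .
qed

lemma integral_gauss: "(LINT x|lborel. gauss (x::'a::euclidean_space)) = 1"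
  using ft_gauss[of "0::'a"] by (simp add: ft_def del: of_real_exp)

text \<open>Multiplying \<^term>\<open>ft f\<close> by the Gaussian of width \<open>1 / \<epsilon>\<close> amounts to averaging \<open>f\<close> at
  scale \<open>\<epsilon>\<close>.\<close>

lemma ft_mult_gauss:
  fixes f :: "'a::euclidean_space \<Rightarrow> complex"
  assumes f: "integrable lborel f" and \<epsilon>: "\<epsilon> > 0"
  shows "(LINT \<xi>|lborel. ft f \<xi> * (cis (- (x \<bullet> \<xi>)) * of_real (exp (- (norm (\<epsilon> *\<^sub>R \<xi>))\<^sup>2 / 2)))) =
    (2 * pi) ^ DIM('a) * (LINT z|lborel. f (x + \<epsilon> *\<^sub>R z) * of_real (gauss z))"
proof -
  have [measurable]: "f \<in> borel_measurable borel"
    using f by auto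
  define c where "c = sqrt (2 * pi) ^ DIM('a)"
  have c2: "c * c = (2 * pi) ^ DIM('a)"
    unfolding c_def power_mult_distrib[symmetric] real_sqrt_mult_self by simp
  have e: "exp (- (norm z)\<^sup>2 / 2) = c * gauss z" for z :: 'a
    by (simp add: gauss_eq c_def)
  \<comment> \<open>A modulated Gaussian of width 1/\<epsilon>. Its transform at
    \<open>x + \<epsilon> *\<^sub>R z\<close> is, up to constants, a Gaussian in \<open>z\<close>;
    this is \<open>ftg\<close> below.\<close>
  define g where "g \<xi> = cis (- (x \<bullet> \<xi>)) * complex_of_real (exp (- (norm (\<epsilon> *\<^sub>R \<xi>))\<^sup>2 / 2))" for \<xi>
  have g_eq: "g \<xi> = cis (- (x \<bullet> \<xi>)) * complex_of_real (c * gauss (\<epsilon> *\<^sub>R \<xi>))" for \<xi>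
    unfolding g_def e ..
  have ig: "integrable lborel g"
    unfolding g_eq[abs_def]
    using lborel_integrable_affine[OF _ integrable_gauss, of \<epsilon> 0] \<epsilon>
    by (intro integrable_cis_mult integrable_of_real integrable_mult_right) auto
  have ftg: "ft g (x + \<epsilon> *\<^sub>R z) = of_real (c * c * gauss z / \<epsilon> ^ DIM('a))" for z
  proof -
    have "ft g (x + \<epsilon> *\<^sub>R z) = (LINT \<xi>|lborel. of_real c * (cis (z \<bullet> (\<epsilon> *\<^sub>R \<xi>)) * of_real (gauss (\<epsilon> *\<^sub>R \<xi>))))"
      unfolding ft_def g_eq
    proof (intro Bochner_Integration.integral_cong refl)
      fix \<xi> :: 'a
      have "cis ((x + \<epsilon> *\<^sub>R z) \<bullet> \<xi>) * cis (- (x \<bullet> \<xi>)) = cis (z \<bullet> (\<epsilon> *\<^sub>R \<xi>))"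
        by (simp add: cis_mult inner_add_left)
      then show "cis ((x + \<epsilon> *\<^sub>R z) \<bullet> \<xi>) * (cis (- (x \<bullet> \<xi>)) * of_real (c * gauss (\<epsilon> *\<^sub>R \<xi>))) =
          of_real c * (cis (z \<bullet> (\<epsilon> *\<^sub>R \<xi>)) * of_real (gauss (\<epsilon> *\<^sub>R \<xi>)))"
        by (metis mult.assoc mult.commute of_real_mult)
    qed
    also have "\<dots> = of_real c * (of_real (1 / \<epsilon> ^ DIM('a)) * ft (\<lambda>x. of_real (gauss x)) z)"
      using lborel_integral_affine[of \<epsilon> "\<lambda>\<eta>. cis (z \<bullet> \<eta>) * of_real (gauss \<eta>)" 0] \<epsilon>
      by (simp add: ft_def scaleR_conv_of_real)
    also have "\<dots> = of_real (c * c * gauss z / \<epsilon> ^ DIM('a))"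
      unfolding ft_gauss e by simp
    finally show ?thesis .
  qed
  have "(LINT \<xi>|lborel. ft f \<xi> * g \<xi>) = (LINT y|lborel. f y * ft g y)"
    by (rule ft_swap[OF f ig])
  also have "\<dots> = \<epsilon> ^ DIM('a) *\<^sub>R (LINT z|lborel. f (x + \<epsilon> *\<^sub>R z) * ft g (x + \<epsilon> *\<^sub>R z))"
    using \<epsilon> borel_measurable_ft[of g] ig
    by (subst lborel_integral_affine[of \<epsilon> _ x]) auto
  also have "\<dots> = (LINT z|lborel. (c * c) * (f (x + \<epsilon> *\<^sub>R z) * of_real (gauss z)))"
    unfolding ftg integral_scaleR_right[symmetric] using \<epsilon>
    by (intro Bochner_Integration.integral_cong refl) (simp add: scaleR_conv_of_real)
  also have "\<dots> = (2 * pi) ^ DIM('a) * (LINT z|lborel. f (x + \<epsilon> *\<^sub>R z) * of_real (gauss z))"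
    by (simp add: of_real_mult[symmetric] c2 del: of_real_mult)
  finally show ?thesis
    by (simp add: g_def)
qed

text \<open>The damped integral \<open>L\<close> of \<open>ft f\<close> is evaluated twice. As the
  damping disappears, integrability of \<open>ft f\<close> gives the iterated transform, while
  \<open>ft_mult_gauss\<close> turns the same quantity into Gaussian averages of \<open>f\<close>,
  which converge to \<open>f x\<close> by continuity and boundedness.\<close>

theorem ft_inversion:
  fixes f :: "'a::euclidean_space \<Rightarrow> complex"
  assumes f: "integrable lborel f" and cont: "continuous_on UNIV f" and bdd: "\<And>x. norm (f x) \<le> B"
    and ff: "integrable lborel (ft f)"
  shows "ft (ft f) (- x) = (2 * pi) ^ DIM('a) * f x"
proof -
  have [measurable]: "f \<in> borel_measurable borel"
    using f by auto
  define \<epsilon> :: "nat \<Rightarrow> real" where "\<epsilon> k = inverse (real (Suc k))" for k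
  have \<epsilon>0: "\<epsilon> k > 0" for k by (simp add: \<epsilon>_def)
  have \<epsilon>: "\<epsilon> \<longlonglongrightarrow> 0"
    unfolding \<epsilon>_def by (rule LIMSEQ_inverse_real_of_nat)
  define L where "L k = (LINT \<xi>|lborel. ft f \<xi> * (cis (- (x \<bullet> \<xi>)) * of_real (exp (- (norm (\<epsilon> k *\<^sub>R \<xi>))\<^sup>2 / 2))))" for k
  have "L \<longlonglongrightarrow> (LINT \<xi>|lborel. ft f \<xi> * (cis (- (x \<bullet> \<xi>)) * of_real (exp (- (norm (0 *\<^sub>R \<xi>))\<^sup>2 / 2))))"
    unfolding L_def
  proof (rule integral_dominated_convergence[where w="\<lambda>\<xi>. norm (ft f \<xi>)"])
    show "integrable lborel (\<lambda>\<xi>. norm (ft f \<xi>))" using ff by auto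
    show "AE \<xi> in lborel. (\<lambda>k. ft f \<xi> * (cis (- (x \<bullet> \<xi>)) * of_real (exp (- (norm (\<epsilon> k *\<^sub>R \<xi>))\<^sup>2 / 2))))
       \<longlonglongrightarrow> ft f \<xi> * (cis (- (x \<bullet> \<xi>)) * of_real (exp (- (norm (0 *\<^sub>R \<xi>))\<^sup>2 / 2)))"
      by (intro AE_I2 tendsto_intros \<epsilon>) auto
  qed (auto simp: norm_mult simp del: of_real_exp intro!: mult_left_le)
  then have 1: "L \<longlonglongrightarrow> ft (ft f) (- x)"
    by (simp add: ft_def mult.commute)
  have "(\<lambda>k. LINT z|lborel. f (x + \<epsilon> k *\<^sub>R z) * of_real (gauss z)) \<longlonglongrightarrow>
      (LINT z|lborel. f (x + 0 *\<^sub>R z) * of_real (gauss z))"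
  proof (rule integral_dominated_convergence[where w="\<lambda>z. B * gauss z"])
    show "integrable lborel (\<lambda>z::'a. B * gauss z)" using integrable_gauss by auto
    show "AE z in lborel. (\<lambda>k. f (x + \<epsilon> k *\<^sub>R z) * of_real (gauss z)) \<longlonglongrightarrow> f (x + 0 *\<^sub>R z) * of_real (gauss z)"
      by (intro AE_I2 tendsto_mult continuous_on_tendsto_compose[OF cont] tendsto_intros \<epsilon>) auto
    show "AE z in lborel. norm (f (x + \<epsilon> k *\<^sub>R z) * of_real (gauss z)) \<le> B * gauss z" for k
      by (simp add: norm_mult gauss_nonneg bdd mult_right_mono)
  qed auto
  also have "(LINT z|lborel. f (x + 0 *\<^sub>R z) * of_real (gauss z)) = f x"
    using integral_gauss[where 'a='a] by simp
  finally have "(\<lambda>k. (2 * pi) ^ DIM('a) * (LINT z|lborel. f (x + \<epsilon> k *\<^sub>R z) * of_real (gauss z)))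
      \<longlonglongrightarrow> (2 * pi) ^ DIM('a) * f x"
    by (intro tendsto_mult tendsto_const) auto
  then have "L \<longlonglongrightarrow> (2 * pi) ^ DIM('a) * f x"
    unfolding L_def using ft_mult_gauss[OF f \<epsilon>0] by simp
  with 1 show ?thesis
    by (rule LIMSEQ_unique)
qed

text \<open>The hypotheses of \<open>ft_inversion\<close>, bundled.\<close>

definition invertible :: "('a::euclidean_space \<Rightarrow> complex) \<Rightarrow> bool" where
  "invertible f \<longleftrightarrow> integrable lborel f \<and> continuous_on UNIV f \<and>
    (\<exists>B. \<forall>x. norm (f x) \<le> B) \<and> integrable lborel (ft f)"

text \<open>The symbol \<open>ft \<mu>\<close> is merely bounded, so inversion is applied to \<phi>
  alone: \<open>ft_swap\<close> moves the outer transform from \<open>ft \<mu>\<close> onto the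
  modulated inverse transform \<open>g\<close> of \<phi>, and inversion identifies
  \<open>ft g y\<close> with \<open>\<phi> (x - y)\<close>.\<close>

lemma fourier_multiplier_kernel:
  fixes \<mu> \<phi> :: "'a::euclidean_space \<Rightarrow> complex"
  assumes \<mu>: "integrable lborel \<mu>" and \<phi>: "invertible \<phi>"
  shows "fourier (\<lambda>\<xi>. ft \<mu> \<xi> * inv_fourier \<phi> \<xi>) x = conv \<mu> \<phi> x"
    and "inv_fourier (conv \<mu> \<phi>) \<xi> = ft \<mu> \<xi> * inv_fourier \<phi> \<xi>"
proof -
  from \<phi> obtain B where \<phi>i: "integrable lborel \<phi>" and cont: "continuous_on UNIV \<phi>"
    and B: "\<And>x. norm (\<phi> x) \<le> B" and ff: "integrable lborel (ft \<phi>)"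
    unfolding invertible_def by auto
  define g where "g \<xi> = cis (- (x \<bullet> \<xi>)) * (ft \<phi> \<xi> / of_real ((2 * pi) ^ DIM('a)))" for \<xi>
  have ig: "integrable lborel g"
    unfolding g_def[abs_def] using ff by (intro integrable_cis_mult) auto
  have ftg: "ft g y = \<phi> (x - y)" for y
  proof -
    have "ft g y = (LINT \<xi>|lborel. cis ((y - x) \<bullet> \<xi>) * ft \<phi> \<xi> / of_real ((2 * pi) ^ DIM('a)))"
      unfolding ft_def[of g] g_def
      by (intro Bochner_Integration.integral_cong refl) (simp add: mult.assoc[symmetric] cis_mult inner_diff_left)
    also have "\<dots> = ft (ft \<phi>) (- (x - y)) / of_real ((2 * pi) ^ DIM('a))"
      by (simp add: ft_def[of "ft \<phi>"])
    also have "\<dots> = \<phi> (x - y)"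
      by (subst ft_inversion[OF \<phi>i cont B ff]) simp
    finally show ?thesis .
  qed
  have "fourier (\<lambda>\<xi>. ft \<mu> \<xi> * inv_fourier \<phi> \<xi>) x = (LINT \<xi>|lborel. ft \<mu> \<xi> * g \<xi>)"
    unfolding fourier_eq_ft ft_def[where f="\<lambda>\<xi>. ft \<mu> \<xi> * _ \<xi>"] inv_fourier_eq_ft g_def
    by (simp add: mult.left_commute)
  also have "\<dots> = (LINT y|lborel. \<mu> y * ft g y)"
    by (rule ft_swap[OF \<mu> ig])
  finally show "fourier (\<lambda>\<xi>. ft \<mu> \<xi> * inv_fourier \<phi> \<xi>) x = conv \<mu> \<phi> x"
    by (simp add: ftg conv_def)
  show "inv_fourier (conv \<mu> \<phi>) \<xi> = ft \<mu> \<xi> * inv_fourier \<phi> \<xi>"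
    by (simp add: inv_fourier_eq_ft ft_conv[OF \<mu> \<phi>i])
qed

lemma fourier_inv_fourier:
  fixes \<phi> :: "'a::euclidean_space \<Rightarrow> complex"
  assumes \<phi>: "invertible \<phi>"
  shows "fourier (inv_fourier \<phi>) = \<phi>"
proof
  fix x
  from \<phi> obtain B where \<phi>i: "integrable lborel \<phi>" and cont: "continuous_on UNIV \<phi>"
    and B: "\<And>x. norm (\<phi> x) \<le> B" and ff: "integrable lborel (ft \<phi>)"
    unfolding invertible_def by auto
  have "fourier (inv_fourier \<phi>) x = ft (ft \<phi>) (- x) / of_real ((2 * pi) ^ DIM('a))"
    unfolding fourier_eq_ft ft_def[of "inv_fourier \<phi>"] ft_def[of "ft \<phi>"] inv_fourier_eq_ft by simp
  then show "fourier (inv_fourier \<phi>) x = \<phi> x"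
    by (subst (asm) ft_inversion[OF \<phi>i cont B ff]) simp
qed


section \<open>Rapidly decreasing functions\<close>

definition decaying :: "('a::euclidean_space \<Rightarrow> complex) \<Rightarrow> bool" where
  "decaying f \<longleftrightarrow> continuous_on UNIV f \<and> (\<forall>N. \<exists>B. \<forall>x. (1 + norm x) ^ N * norm (f x) \<le> B)"

definition line_deriv :: "'a::euclidean_space \<Rightarrow> ('a \<Rightarrow> complex) \<Rightarrow> ('a \<Rightarrow> complex) \<Rightarrow> bool" where
  "line_deriv b f g \<longleftrightarrow> (\<forall>x. ((\<lambda>s. f (x + s *\<^sub>R b)) has_vector_derivative g x) (at 0))"

text \<open>The order is finite because \<open>bump M\<close> has only finitely many continuous
  derivatives; Schwartz functions and cut-offs belong to the class for every
  \<open>k\<close>.\<close>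

primrec rapid :: "nat \<Rightarrow> ('a::euclidean_space \<Rightarrow> complex) \<Rightarrow> bool" where
  "rapid 0 f \<longleftrightarrow> decaying f"
| "rapid (Suc k) f \<longleftrightarrow> decaying f \<and> (\<forall>b\<in>Basis. \<exists>g. line_deriv b f g \<and> rapid k g)"

lemma rapid_decaying: "rapid k f \<Longrightarrow> decaying f"
  by (cases k) auto

lemma rapid_SucD: "rapid (Suc k) f \<Longrightarrow> rapid k f"
proof (induction k arbitrary: f)
  case (Suc k)
  then have "\<forall>b\<in>Basis. \<exists>g. line_deriv b f g \<and> rapid k g"
    by (metis rapid.simps(2))
  with Suc.prems show ?case by auto
qed auto

lemma decaying_zero: "decaying (\<lambda>x. 0)"
  by (auto simp: decaying_def)

lemma decaying_add: "decaying f \<Longrightarrow> decaying g \<Longrightarrow> decaying (\<lambda>x. f x + g x)"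
  unfolding decaying_def
proof (intro conjI allI continuous_on_add; (elim conjE)?)
  fix N assume "\<forall>N. \<exists>B. \<forall>x. (1 + norm x) ^ N * norm (f x) \<le> B" "\<forall>N. \<exists>B. \<forall>x. (1 + norm x) ^ N * norm (g x) \<le> B"
  then obtain B C where B: "\<And>x. (1 + norm x) ^ N * norm (f x) \<le> B" and C: "\<And>x. (1 + norm x) ^ N * norm (g x) \<le> C"
    by metis
  have "(1 + norm x) ^ N * norm (f x + g x) \<le> B + C" for x
  proof -
    have "(1 + norm x) ^ N * norm (f x + g x) \<le> (1 + norm x) ^ N * (norm (f x) + norm (g x))"
      by (intro mult_left_mono norm_triangle_ineq) auto
    also have "\<dots> \<le> B + C" using B[of x] C[of x] by (simp add: distrib_left)
    finally show ?thesis .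
  qed
  then show "\<exists>B. \<forall>x. (1 + norm x) ^ N * norm (f x + g x) \<le> B" by blast
qed

lemma decaying_cmult: "decaying f \<Longrightarrow> decaying (\<lambda>x. c * f x)"
  unfolding decaying_def
proof (intro conjI allI continuous_on_mult_left; (elim conjE)?)
  fix N assume "\<forall>N. \<exists>B. \<forall>x. (1 + norm x) ^ N * norm (f x) \<le> B"
  then obtain B where B: "\<And>x. (1 + norm x) ^ N * norm (f x) \<le> B" by metis
  have "(1 + norm x) ^ N * norm (c * f x) \<le> norm c * B" for x
    using mult_left_mono[OF B norm_ge_zero, of c x] by (simp add: norm_mult mult_ac)
  then show "\<exists>B. \<forall>x. (1 + norm x) ^ N * norm (c * f x) \<le> B" by blast
qed

lemma decaying_coord: "decaying f \<Longrightarrow> decaying (\<lambda>x. of_real (x \<bullet> c) * f x)"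
  unfolding decaying_def
proof (intro conjI allI continuous_intros; (elim conjE)?)
  fix N assume "\<forall>N. \<exists>B. \<forall>x. (1 + norm x) ^ N * norm (f x) \<le> B"
  then obtain B where B: "\<And>x. (1 + norm x) ^ Suc N * norm (f x) \<le> B" by metis
  have "(1 + norm x) ^ N * norm (of_real (x \<bullet> c) * f x) \<le> norm c * B" for x
  proof -
    have "\<bar>x \<bullet> c\<bar> \<le> norm c * (1 + norm x)"
      using Cauchy_Schwarz_ineq2[of x c] by (simp add: distrib_left mult.commute add_increasing)
    then have "(1 + norm x) ^ N * norm (of_real (x \<bullet> c) * f x) \<le>
        (1 + norm x) ^ N * ((norm c * (1 + norm x)) * norm (f x))"
      unfolding norm_mult norm_of_real by (intro mult_left_mono mult_right_mono) auto
    also have "\<dots> \<le> norm c * B"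
      using mult_left_mono[OF B norm_ge_zero, of c x] by (simp add: mult_ac)
    finally show ?thesis .
  qed
  then show "\<exists>B. \<forall>x. (1 + norm x) ^ N * norm (of_real (x \<bullet> c) * f x) \<le> B" by blast
qed auto

lemma line_deriv_add: "line_deriv b f f' \<Longrightarrow> line_deriv b g g' \<Longrightarrow> line_deriv b (\<lambda>x. f x + g x) (\<lambda>x. f' x + g' x)"
  unfolding line_deriv_def by (auto intro!: derivative_intros)

lemma line_deriv_cmult: "line_deriv b f f' \<Longrightarrow> line_deriv b (\<lambda>x. c * f x) (\<lambda>x. c * f' x)"
  unfolding line_deriv_def by (auto intro!: derivative_intros)

lemma rapid_zero: "rapid k (\<lambda>x. 0)"
  by (induction k) (auto simp: decaying_zero line_deriv_def intro!: exI[of _ "\<lambda>x. 0"])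

lemma rapid_add: "rapid k f \<Longrightarrow> rapid k g \<Longrightarrow> rapid k (\<lambda>x. f x + g x)"
proof (induction k arbitrary: f g)
  case (Suc k)
  show ?case
  proof (simp, intro conjI ballI)
    show "decaying (\<lambda>x. f x + g x)" using Suc.prems by (auto intro: decaying_add)
    fix b :: 'a assume "b \<in> Basis"
    with Suc.prems obtain f' g' where "line_deriv b f f'" "rapid k f'" "line_deriv b g g'" "rapid k g'"
      by (metis rapid.simps(2))
    then show "\<exists>h. line_deriv b (\<lambda>x. f x + g x) h \<and> rapid k h"
      using Suc.IH line_deriv_add by blast
  qed
qed (auto intro: decaying_add)

lemma rapid_cmult: "rapid k f \<Longrightarrow> rapid k (\<lambda>x. c * f x)"
proof (induction k arbitrary: f)
  case (Suc k)
  show ?case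
  proof (simp, intro conjI ballI)
    show "decaying (\<lambda>x. c * f x)" using Suc.prems by (auto intro: decaying_cmult)
    fix b :: 'a assume "b \<in> Basis"
    with Suc.prems obtain f' where "line_deriv b f f'" "rapid k f'"
      by (metis rapid.simps(2))
    then show "\<exists>h. line_deriv b (\<lambda>x. c * f x) h \<and> rapid k h"
      using Suc.IH line_deriv_cmult by blast
  qed
qed (auto intro: decaying_cmult)

lemma rapid_sum: "(\<And>i. i \<in> I \<Longrightarrow> rapid k (f i)) \<Longrightarrow> rapid k (\<lambda>x. \<Sum>i\<in>I. f i x)"
  by (induction I rule: infinite_finite_induct) (auto simp: rapid_zero rapid_add simp del: rapid.simps)

lemma rapid_coord: "rapid k f \<Longrightarrow> rapid k (\<lambda>x. of_real (x \<bullet> c) * f x)"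
proof (induction k arbitrary: f)
  case (Suc k)
  show ?case
  proof (simp, intro conjI ballI)
    show "decaying (\<lambda>x. of_real (x \<bullet> c) * f x)" using Suc.prems by (auto intro: decaying_coord)
    fix b :: 'a assume "b \<in> Basis"
    with Suc.prems obtain f' where f': "line_deriv b f f'" "rapid k f'"
      by (metis rapid.simps(2))
    have "line_deriv b (\<lambda>x. of_real (x \<bullet> c) * f x) (\<lambda>x. of_real (x \<bullet> c) * f' x + of_real (b \<bullet> c) * f x)"
      unfolding line_deriv_def
    proof
      fix x
      have "((\<lambda>s. f (x + s *\<^sub>R b)) has_vector_derivative f' x) (at 0)"
        using f' by (auto simp: line_deriv_def)
      moreover have "((\<lambda>s. complex_of_real ((x + s *\<^sub>R b) \<bullet> c)) has_vector_derivative of_real (b \<bullet> c)) (at 0)"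
        unfolding inner_add_left inner_scaleR_left of_real_add of_real_mult
        by (auto intro!: derivative_eq_intros simp: has_vector_derivative_def scaleR_conv_of_real)
      ultimately show "((\<lambda>s. of_real ((x + s *\<^sub>R b) \<bullet> c) * f (x + s *\<^sub>R b)) has_vector_derivative
          of_real (x \<bullet> c) * f' x + of_real (b \<bullet> c) * f x) (at 0)"
        using has_vector_derivative_mult[where f="\<lambda>s. complex_of_real ((x + s *\<^sub>R b) \<bullet> c)"] by fastforce
    qed
    moreover have "rapid k (\<lambda>x. of_real (x \<bullet> c) * f' x + of_real (b \<bullet> c) * f x)"
      using Suc.IH[OF f'(2)] rapid_SucD[OF Suc.prems] by (intro rapid_add rapid_cmult)
    ultimately show "\<exists>h. line_deriv b (\<lambda>x. of_real (x \<bullet> c) * f x) h \<and> rapid k h"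
      by blast
  qed
qed (auto intro: decaying_coord)

text \<open>An even power of the norm is a polynomial: the squared norm is the sum of the squared
  coordinates, so two uses of \<open>rapid_coord\<close> per direction raise \<open>m\<close> by
  one.\<close>

lemma rapid_norm_power: "rapid k f \<Longrightarrow> rapid k (\<lambda>x. of_real (norm x ^ (2 * m)) * f x)"
proof (induction m)
  case (Suc m)
  have "rapid k (\<lambda>x. \<Sum>b\<in>Basis. of_real (x \<bullet> b) * (of_real (x \<bullet> b) * (of_real (norm x ^ (2 * m)) * f x)))"
    using Suc by (intro rapid_sum rapid_coord)
  also have "(\<lambda>x. \<Sum>b\<in>Basis. of_real (x \<bullet> b) * (of_real (x \<bullet> b) * (of_real (norm x ^ (2 * m)) * f x))) =
      (\<lambda>x. of_real (norm x ^ (2 * Suc m)) * f x)"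
  proof
    fix x :: 'a
    have "complex_of_real (norm x ^ (2 * Suc m)) = (\<Sum>b\<in>Basis. of_real (x \<bullet> b) * of_real (x \<bullet> b)) * of_real (norm x ^ (2 * m))"
    proof -
      have "norm x ^ (2 * Suc m) = (\<Sum>b\<in>Basis. (x \<bullet> b) * (x \<bullet> b)) * norm x ^ (2 * m)"
        using euclidean_inner[of x x] by (simp add: power2_norm_eq_inner[symmetric] power2_eq_square)
      then show ?thesis
        by (simp only: of_real_mult of_real_sum)
    qed
    then show "(\<Sum>b\<in>Basis. of_real (x \<bullet> b) * (of_real (x \<bullet> b) * (of_real (norm x ^ (2 * m)) * f x))) =
      of_real (norm x ^ (2 * Suc m)) * f x"
      by (simp add: sum_distrib_right mult.assoc)
  qed
  finally show ?case .
qed simp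

section \<open>Decay of the Fourier transform from derivatives\<close>

text \<open>Its reciprocal is integrable, being a product of integrable functions of one coordinate
  each, and on the Fourier side multiplication by this polynomial is a differential operator: the
  product, over the basis, of 1 minus the second derivative.\<close>

definition dominator :: "'a::euclidean_space \<Rightarrow> real" where
  "dominator x = (\<Prod>b\<in>Basis. 1 + (x \<bullet> b)\<^sup>2)"

lemma dominator_pos: "dominator x > 0"
  unfolding dominator_def by (intro prod_pos) (auto intro: add_pos_nonneg)

lemma dominator_le: "dominator x \<le> (1 + norm x) ^ (2 * DIM('a))" for x :: "'a::euclidean_space"
proof -
  have "dominator x \<le> (\<Prod>b\<in>(Basis::'a set). (1 + norm x)\<^sup>2)"
    unfolding dominator_def
  proof (intro prod_mono conjI)
    fix b :: 'a assume b: "b \<in> Basis"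
    have "(x \<bullet> b)\<^sup>2 \<le> (norm x)\<^sup>2"
      using Basis_le_norm[OF b, of x] by (metis abs_le_square_iff abs_norm_cancel)
    then show "1 + (x \<bullet> b)\<^sup>2 \<le> (1 + norm x)\<^sup>2"
      unfolding power2_eq_square by (simp add: algebra_simps add_increasing2)
  qed auto
  then show ?thesis by (simp add: power_mult)
qed

lemma borel_measurable_dominator [measurable]: "dominator \<in> borel_measurable borel"
  unfolding dominator_def[abs_def] by measurable

lemma integrable_dominator: "integrable lborel (\<lambda>x::'a::euclidean_space. B / dominator x)"
proof -
  have "integrable lborel (\<lambda>y::real. inverse (1 + y\<^sup>2))"
    using integrable_inverse_1_plus_square by (simp add: set_integrable_def)
  then have "integrable lborel (\<lambda>x::'a. \<Prod>b\<in>Basis. inverse (1 + (x \<bullet> b)\<^sup>2))"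
    by (intro integrable_prod_Basis)
  then have "integrable lborel (\<lambda>x::'a. B * (\<Prod>b\<in>Basis. inverse (1 + (x \<bullet> b)\<^sup>2)))"
    by (rule integrable_mult_right)
  then show ?thesis
    by (simp add: dominator_def divide_inverse prod_inversef[symmetric] o_def)
qed

lemma decaying_integrable:
  fixes f :: "'a::euclidean_space \<Rightarrow> complex"
  assumes "decaying f" shows "integrable lborel f"
proof -
  obtain B where B: "\<And>x. (1 + norm x) ^ (2 * DIM('a)) * norm (f x) \<le> B"
    using assms unfolding decaying_def by metis
  have [measurable]: "f \<in> borel_measurable borel"
    using assms by (auto simp: decaying_def intro: borel_measurable_continuous_onI)
  have le: "norm (f x) \<le> B / dominator x" for x
  proof -
    have "dominator x * norm (f x) \<le> B"
      using mult_right_mono[OF dominator_le norm_ge_zero, of x "f x"] B[of x] by linarith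
    then show ?thesis using dominator_pos[of x] by (simp add: field_simps)
  qed
  show ?thesis
  proof (rule Bochner_Integration.integrable_bound[OF integrable_dominator[of B]])
    show "AE x in lborel. norm (f x) \<le> norm (B / dominator x)"
      using le by (intro AE_I2) (smt (verit) real_norm_def)
  qed auto
qed

lemma decaying_bounded: "decaying f \<Longrightarrow> \<exists>B. \<forall>x. norm (f x) \<le> B"
  unfolding decaying_def by (drule conjunct2, drule spec[of _ 0]) simp

lemma line_deriv_at:
  assumes "line_deriv b f g"
  shows "((\<lambda>s. f (x + s *\<^sub>R b)) has_vector_derivative g (x + s0 *\<^sub>R b)) (at s0)"
proof -
  have 1: "((\<lambda>s. s - s0) has_vector_derivative 1) (at s0)"
    by (auto intro!: derivative_eq_intros simp: has_vector_derivative_def)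
  have 2: "((\<lambda>s. f ((x + s0 *\<^sub>R b) + s *\<^sub>R b)) has_vector_derivative g (x + s0 *\<^sub>R b)) (at (s0 - s0))"
    using assms by (simp add: line_deriv_def)
  show ?thesis
    using vector_diff_chain_at[OF 1 2] by (simp add: o_def algebra_simps)
qed

text \<open>Integrate \<open>f (x + b) - f x\<close>, written as an integral of the derivative, over \<open>x\<close>.\<close>

lemma integral_line_deriv:
  fixes f g :: "'a::euclidean_space \<Rightarrow> complex"
  assumes d: "line_deriv b f g" and f: "integrable lborel f" and g: "integrable lborel g"
    and cg: "continuous_on UNIV g"
  shows "(LINT x|lborel. g x) = 0"
proof -
  have [measurable]: "g \<in> borel_measurable borel" "f \<in> borel_measurable borel" using f g by auto
  have FTC: "(LINT s|lborel. indicat_real {0..1} s *\<^sub>R g (x + s *\<^sub>R b)) = f (x + b) - f x" for x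
    by (subst integral_FTC_atLeastAtMost[where F="\<lambda>s. f (x + s *\<^sub>R b)"])
       (auto intro!: has_vector_derivative_at_within line_deriv_at[OF d] continuous_on_compose2[OF cg] continuous_intros)
  have int: "integrable (lborel \<Otimes>\<^sub>M lborel) (\<lambda>(s, x). indicat_real {0..1} s *\<^sub>R g (x + s *\<^sub>R b))"
  proof (rule lborel_pair.Fubini_integrable)
    show "(\<lambda>(s, x). indicat_real {0..1} s *\<^sub>R g (x + s *\<^sub>R b)) \<in> borel_measurable (lborel \<Otimes>\<^sub>M lborel)"
      by measurable
    have "(LINT x|lborel. norm (g (x + s *\<^sub>R b))) = (LINT x|lborel. norm (g x))" for s
      by (rule lborel_integral_shift) measurable
    then show "integrable lborel (\<lambda>s. LINT x|lborel. norm (case (s, x) of (s, x) \<Rightarrow> indicat_real {0..1} s *\<^sub>R g (x + s *\<^sub>R b)))"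
      by (simp add: integrable_mult_left)
    show "AE s in lborel. integrable lborel (\<lambda>x. case (s, x) of (s, x) \<Rightarrow> indicat_real {0..1} s *\<^sub>R g (x + s *\<^sub>R b))"
      using lborel_integrable_shift[OF g] by simp
  qed
  have "(LINT x|lborel. LINT s|lborel. indicat_real {0..1} s *\<^sub>R g (x + s *\<^sub>R b)) =
    (LINT s|lborel. LINT x|lborel. indicat_real {0..1} s *\<^sub>R g (x + s *\<^sub>R b))"
    using lborel_pair.Fubini_integral[OF int] by simp
  also have "\<dots> = (LINT x|lborel. g x)"
    by (simp add: lborel_integral_shift)
  finally have "(LINT x|lborel. g x) = (LINT x|lborel. f (x + b) - f x)"
    unfolding FTC ..
  also have "\<dots> = 0"
    using lborel_integrable_shift[OF f, of b] f by (simp add: lborel_integral_shift)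
  finally show ?thesis .
qed

text \<open>Integration by parts: the product \<open>F\<close> of \<open>f\<close> with the
  character has the line derivative \<open>G\<close>, and \<open>G\<close> integrates to 0.\<close>

lemma ft_line_deriv:
  fixes f g :: "'a::euclidean_space \<Rightarrow> complex"
  assumes d: "line_deriv b f g" and f: "decaying f" and g: "decaying g"
  shows "ft g \<xi> = - (\<i> * of_real (\<xi> \<bullet> b)) * ft f \<xi>"
proof -
  define F where "F x = cis (\<xi> \<bullet> x) * f x" for x
  define G where "G x = cis (\<xi> \<bullet> x) * g x + (\<i> * of_real (\<xi> \<bullet> b)) * (cis (\<xi> \<bullet> x) * f x)" for x
  have fi: "integrable lborel (\<lambda>x. cis (\<xi> \<bullet> x) * f x)" "integrable lborel (\<lambda>x. cis (\<xi> \<bullet> x) * g x)"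
    using decaying_integrable[OF f] decaying_integrable[OF g] by (auto intro!: integrable_ft)
  have "(LINT x|lborel. G x) = 0"
  proof (rule integral_line_deriv)
    show "line_deriv b F G"
      unfolding line_deriv_def
    proof
      fix x
      have "((\<lambda>s. f (x + s *\<^sub>R b)) has_vector_derivative g x) (at 0)"
        using d by (auto simp: line_deriv_def)
      moreover have "((\<lambda>s. cis (\<xi> \<bullet> (x + s *\<^sub>R b))) has_vector_derivative \<i> * of_real (\<xi> \<bullet> b) * cis (\<xi> \<bullet> x)) (at 0)"
        unfolding inner_add_right inner_scaleR_right has_vector_derivative_def
        by (auto intro!: derivative_eq_intros simp: scaleR_conv_of_real)
      ultimately show "((\<lambda>s. F (x + s *\<^sub>R b)) has_vector_derivative G x) (at 0)"
        unfolding F_def G_def by (auto intro!: derivative_eq_intros)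
    qed
    show "integrable lborel F" "integrable lborel G"
      unfolding F_def[abs_def] G_def[abs_def] by (intro fi Bochner_Integration.integrable_add integrable_mult_right)+
    show "continuous_on UNIV G"
      using f g unfolding G_def[abs_def] decaying_def cis_conv_exp by (intro continuous_intros) auto
  qed
  then show ?thesis
    unfolding G_def using fi by (simp add: ft_def[symmetric] eq_neg_iff_add_eq_0)
qed

lemma rapid_line_deriv2:
  assumes "rapid (Suc (Suc k)) f" "b \<in> Basis"
  shows "\<exists>g. rapid k g \<and> (\<forall>\<xi>. ft g \<xi> = - of_real ((\<xi> \<bullet> b)\<^sup>2) * ft f \<xi>)"
proof -
  obtain g where g: "line_deriv b f g" "rapid (Suc k) g"
    using assms by (metis rapid.simps(2))
  obtain h where h: "line_deriv b g h" "rapid k h"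
    using g assms by (metis rapid.simps(2))
  have "ft h \<xi> = - of_real ((\<xi> \<bullet> b)\<^sup>2) * ft f \<xi>" for \<xi>
    unfolding ft_line_deriv[OF h(1) rapid_decaying[OF g(2)] rapid_decaying[OF h(2)]]
      ft_line_deriv[OF g(1) rapid_decaying[OF assms(1)] rapid_decaying[OF g(2)]]
    by (simp add: power2_eq_square mult.assoc mult.left_commute[of "of_real (\<xi> \<bullet> b)" \<i>])
  with h show ?thesis by blast
qed

text \<open>The witness is the m-th power of minus the Laplacian, applied to \<open>f\<close>; each
  Laplacian costs two orders.\<close>

lemma rapid_ft_norm:
  fixes f :: "'a::euclidean_space \<Rightarrow> complex"
  assumes "rapid (2 * m + k) f"
  shows "\<exists>g. rapid k g \<and> (\<forall>\<xi>. ft g \<xi> = of_real (norm \<xi> ^ (2 * m)) * ft f \<xi>)"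
  using assms
proof (induction m arbitrary: k)
  case (Suc m)
  from Suc.IH[of "Suc (Suc k)"] Suc.prems obtain g where g: "rapid (Suc (Suc k)) g"
    "\<And>\<xi>. ft g \<xi> = of_real (norm \<xi> ^ (2 * m)) * ft f \<xi>"
    by (auto simp del: rapid.simps)
  from rapid_line_deriv2[OF g(1)] obtain h where h: "\<And>b. b \<in> Basis \<Longrightarrow> rapid k (h b)"
    "\<And>b \<xi>. b \<in> Basis \<Longrightarrow> ft (h b) \<xi> = - of_real ((\<xi> \<bullet> b)\<^sup>2) * ft g \<xi>"
    by metis
  define l where "l x = (\<Sum>b\<in>Basis. (-1) * h b x)" for x
  have "rapid k l"
    unfolding l_def using h by (intro rapid_sum rapid_cmult)
  moreover have "ft l \<xi> = of_real (norm \<xi> ^ (2 * Suc m)) * ft f \<xi>" for \<xi>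
  proof -
    have "ft l \<xi> = (\<Sum>b\<in>Basis. ft (\<lambda>x. (-1) * h b x) \<xi>)"
      unfolding ft_def l_def sum_distrib_left
      by (intro Bochner_Integration.integral_sum integrable_ft integrable_mult_right decaying_integrable
          rapid_decaying[OF h(1)])
    also have "\<dots> = (\<Sum>b\<in>Basis. of_real ((\<xi> \<bullet> b)\<^sup>2)) * ft g \<xi>"
      unfolding ft_cmult by (simp add: h sum_distrib_right)
    also have "(\<Sum>b\<in>Basis. complex_of_real ((\<xi> \<bullet> b)\<^sup>2)) = of_real ((norm \<xi>)\<^sup>2)"
      unfolding power2_norm_eq_inner euclidean_inner[of \<xi> \<xi>] by (simp add: power2_eq_square)
    finally show ?thesis by (simp add: g power2_eq_square)
  qed
  ultimately show ?case by blast
qed auto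

text \<open>The witness arises from \<open>f\<close> by applying 1 minus the second derivative along
  each \<open>b\<close> in \<open>S\<close>, one direction per induction step.\<close>

lemma rapid_ft_dominator:
  fixes f :: "'a::euclidean_space \<Rightarrow> complex"
  assumes "finite S" "S \<subseteq> Basis" "rapid (2 * card S + k) f"
  shows "\<exists>g. rapid k g \<and> (\<forall>\<xi>. ft g \<xi> = of_real (\<Prod>b\<in>S. 1 + (\<xi> \<bullet> b)\<^sup>2) * ft f \<xi>)"
  using assms
proof (induction S arbitrary: k rule: finite_induct)
  case (insert b S)
  from insert.IH[of "Suc (Suc k)"] insert.prems insert.hyps obtain g where g: "rapid (Suc (Suc k)) g"
    "\<And>\<xi>. ft g \<xi> = of_real (\<Prod>b\<in>S. 1 + (\<xi> \<bullet> b)\<^sup>2) * ft f \<xi>"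
    by (auto simp del: rapid.simps)
  have "b \<in> Basis" using insert.prems by auto
  from rapid_line_deriv2[OF g(1) this] obtain h where h: "rapid k h"
    "\<And>\<xi>. ft h \<xi> = - of_real ((\<xi> \<bullet> b)\<^sup>2) * ft g \<xi>"
    by metis
  have "rapid k (\<lambda>x. g x + (-1) * h x)"
    using h rapid_SucD[OF rapid_SucD[OF g(1)]] by (intro rapid_add rapid_cmult)
  moreover have "ft (\<lambda>x. g x + (-1) * h x) \<xi> = of_real (\<Prod>b\<in>insert b S. 1 + (\<xi> \<bullet> b)\<^sup>2) * ft f \<xi>" for \<xi>
  proof -
    have "ft (\<lambda>x. g x + (-1) * h x) \<xi> = ft g \<xi> + ft (\<lambda>x. (-1) * h x) \<xi>"
      by (intro ft_add integrable_mult_right decaying_integrable rapid_decaying[OF h(1)] rapid_decaying[OF g(1)])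
    also have "ft (\<lambda>x. (-1) * h x) \<xi> = of_real ((\<xi> \<bullet> b)\<^sup>2) * ft g \<xi>"
      unfolding ft_cmult h by simp
    finally show ?thesis
      using insert.hyps by (simp add: g algebra_simps)
  qed
  ultimately show ?case by blast
qed (auto simp del: rapid.simps)

text \<open>Two derivatives in each direction bound \<open>ft f\<close> by a multiple of the
  integrable function \<open>1 / dominator\<close>.\<close>

lemma rapid_invertible:
  fixes f :: "'a::euclidean_space \<Rightarrow> complex"
  assumes "rapid (2 * DIM('a)) f"
  shows "invertible f"
proof -
  have f: "decaying f" using assms by (rule rapid_decaying)
  obtain g where g: "rapid 0 g" "\<And>\<xi>. ft g \<xi> = of_real (dominator \<xi>) * ft f \<xi>"
    using rapid_ft_dominator[of Basis 0 f] assms unfolding dominator_def by auto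
  have le: "norm (ft f \<xi>) \<le> (LINT y|lborel. norm (g y)) / dominator \<xi>" for \<xi>
    using norm_ft_le[of g \<xi>] dominator_pos[of \<xi>] by (simp add: g norm_mult field_simps)
  have "integrable lborel (ft f)"
  proof (rule Bochner_Integration.integrable_bound[OF integrable_dominator])
    show "AE x in lborel. norm (ft f x) \<le> norm ((LINT y|lborel. norm (g y)) / dominator x)"
      using le by (intro AE_I2) (smt (verit) real_norm_def)
    show "ft f \<in> borel_measurable lborel"
      using decaying_integrable[OF f] by auto
  qed
  then show ?thesis
    unfolding invertible_def using f decaying_integrable[OF f] decaying_bounded[OF f]
    by (auto simp: decaying_def)
qed

section \<open>Schwartz functions, cut-offs and truncated powers\<close>

lemma iter_deriv_snoc: "iter_deriv (b # bs) f = dir_deriv b (iter_deriv bs f)"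
  by (simp add: iter_deriv_def)

lemma line_deriv_dir_deriv:
  fixes f :: "'a::euclidean_space \<Rightarrow> 'b::real_normed_vector"
  assumes "f differentiable (at x)"
  shows "((\<lambda>s. f (x + s *\<^sub>R b)) has_vector_derivative dir_deriv b f x) (at 0)"
proof -
  have 1: "((\<lambda>s. x + s *\<^sub>R b) has_derivative (\<lambda>s. s *\<^sub>R b)) (at (0::real))"
    by (auto intro!: derivative_eq_intros)
  have 2: "(f has_derivative frechet_derivative f (at x)) (at (x + 0 *\<^sub>R b))"
    using assms by (simp add: frechet_derivative_works)
  have "bounded_linear (frechet_derivative f (at x))"
    using 2 by (rule has_derivative_bounded_linear)
  then show ?thesis
    using has_derivative_compose[OF 1 2]
    by (simp add: has_vector_derivative_def dir_deriv_def linear_simps)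
qed

lemma schwartz_rapid:
  assumes "schwartz f" shows "rapid k f"
proof -
  have "rapid k (iter_deriv bs f)" if "set bs \<subseteq> Basis" for bs
    using that
  proof (induction k arbitrary: bs)
    case d: 0
    have "continuous_on UNIV (iter_deriv bs f)"
      using assms d by (auto simp: schwartz_def smooth_def intro!: continuous_at_imp_continuous_on differentiable_imp_continuous_within)
    with assms d show ?case by (auto simp: decaying_def schwartz_def)
  next
    case (Suc k)
    have "continuous_on UNIV (iter_deriv bs f)"
      using assms Suc.prems by (auto simp: schwartz_def smooth_def intro!: continuous_at_imp_continuous_on differentiable_imp_continuous_within)
    then have "decaying (iter_deriv bs f)"
      using assms Suc.prems by (auto simp: decaying_def schwartz_def)
    moreover have "line_deriv b (iter_deriv bs f) (iter_deriv (b # bs) f) \<and> rapid k (iter_deriv (b # bs) f)"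
      if "b \<in> Basis" for b
    proof
      show "rapid k (iter_deriv (b # bs) f)"
        using Suc that by auto
      show "line_deriv b (iter_deriv bs f) (iter_deriv (b # bs) f)"
        unfolding line_deriv_def iter_deriv_snoc using assms Suc.prems that
        by (auto intro!: line_deriv_dir_deriv simp: schwartz_def smooth_def)
    qed
    ultimately show ?case by auto
  qed
  from this[of "[]"] show ?thesis by (simp add: iter_deriv_def)
qed

lemma has_vector_derivative_eventually_zero:
  assumes "(f has_vector_derivative D) (at x)" "eventually (\<lambda>y. f y = 0) (at x)" "f x = 0"
  shows "D = 0"
proof -
  have "(f has_vector_derivative 0) (at x)"
    unfolding has_vector_derivative_def scaleR_zero_right
  proof (rule has_derivative_transform_eventually[OF has_derivative_const])
    show "\<forall>\<^sub>F y in at x. 0 = f y"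
      using assms(2) by eventually_elim simp
  qed (auto simp: assms(3))
  with assms(1) show ?thesis by (rule vector_derivative_unique_at)
qed

text \<open>The region \<open>R < norm x\<close> is open, so a short segment through
  \<open>x\<close> stays in it and the derivative along that segment sees only zeros.\<close>

lemma iter_deriv_support:
  fixes f :: "'a::euclidean_space \<Rightarrow> real"
  assumes sm: "smooth f" and z: "\<And>x. R < norm x \<Longrightarrow> f x = 0" and bs: "set bs \<subseteq> Basis" and x: "R < norm x"
  shows "iter_deriv bs f x = 0"
  using bs x
proof (induction bs arbitrary: x)
  case Nil then show ?case using z by (simp add: iter_deriv_def)
next
  case (Cons b bs)
  have d: "((\<lambda>s. iter_deriv bs f (x + s *\<^sub>R b)) has_vector_derivative iter_deriv (b # bs) f x) (at 0)"
    unfolding iter_deriv_snoc using sm Cons.prems by (intro line_deriv_dir_deriv) (auto simp: smooth_def)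
  have "((\<lambda>s::real. norm (x + s *\<^sub>R b)) \<longlongrightarrow> norm (x + 0 *\<^sub>R b)) (at 0)"
    by (intro tendsto_intros)
  then have "eventually (\<lambda>s::real. R < norm (x + s *\<^sub>R b)) (at 0)"
    using Cons.prems by (auto dest!: order_tendstoD(1)[of _ _ _ R])
  then have "eventually (\<lambda>s::real. iter_deriv bs f (x + s *\<^sub>R b) = 0) (at 0)"
    by eventually_elim (use Cons in auto)
  from has_vector_derivative_eventually_zero[OF d this] Cons show ?case
    by simp
qed

lemma cutoff_rapid:
  fixes chi :: "'a::euclidean_space \<Rightarrow> real"
  assumes "radial_cutoff chi" shows "rapid k (\<lambda>x. of_real (chi x))"
proof -
  have sm: "smooth chi"
    using assms unfolding radial_cutoff_def by (rule conjunct1)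
  have "\<exists>R. \<forall>x. R \<le> norm x \<longrightarrow> chi x = 0"
    using assms unfolding radial_cutoff_def by (elim conjE)
  then obtain R where z: "\<And>x. R \<le> norm x \<Longrightarrow> chi x = 0"
    by blast
  have R: "chi x = 0" if "\<bar>R\<bar> < norm x" for x
    using that by (intro z) linarith
  have dc: "decaying (\<lambda>x. of_real (iter_deriv bs chi x))" if bs: "set bs \<subseteq> Basis" for bs
    unfolding decaying_def
  proof (intro conjI allI)
    have c: "continuous_on UNIV (iter_deriv bs chi)"
      using sm bs by (auto simp: smooth_def intro!: continuous_at_imp_continuous_on differentiable_imp_continuous_within)
    then show "continuous_on UNIV (\<lambda>x. complex_of_real (iter_deriv bs chi x))"
      by (intro continuous_intros)
    fix N
    have "compact ((\<lambda>x. (1 + norm x) ^ N * norm (complex_of_real (iter_deriv bs chi x))) ` cball 0 \<bar>R\<bar>)"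
      by (intro compact_continuous_image continuous_intros continuous_on_subset[OF c]) auto
    then obtain B where "\<forall>y\<in>(\<lambda>x. (1 + norm x) ^ N * norm (complex_of_real (iter_deriv bs chi x))) ` cball 0 \<bar>R\<bar>. norm y \<le> B"
      by (meson bounded_iff compact_imp_bounded)
    then have B: "(1 + norm x) ^ N * norm (complex_of_real (iter_deriv bs chi x)) \<le> B" if "x \<in> cball 0 \<bar>R\<bar>" for x
      using that by fastforce
    have "(1 + norm x) ^ N * norm (complex_of_real (iter_deriv bs chi x)) \<le> \<bar>B\<bar>" for x
    proof (cases "\<bar>R\<bar> < norm x")
      case True
      then show ?thesis using iter_deriv_support[OF sm R bs] by simp
    next
      case False
      then show ?thesis using B[of x] by (simp add: dist_norm)
    qed
    then show "\<exists>B. \<forall>x. (1 + norm x) ^ N * norm (complex_of_real (iter_deriv bs chi x)) \<le> B" by blast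
  qed
  have "rapid k (\<lambda>x. of_real (iter_deriv bs chi x))" if "set bs \<subseteq> Basis" for bs
    using that
  proof (induction k arbitrary: bs)
    case (Suc k)
    have "line_deriv b (\<lambda>x. of_real (iter_deriv bs chi x)) (\<lambda>x. of_real (iter_deriv (b # bs) chi x)) \<and>
        rapid k (\<lambda>x. of_real (iter_deriv (b # bs) chi x))"
      if "b \<in> Basis" for b
    proof
      show "rapid k (\<lambda>x. of_real (iter_deriv (b # bs) chi x))"
        using Suc that by auto
      show "line_deriv b (\<lambda>x. of_real (iter_deriv bs chi x)) (\<lambda>x. of_real (iter_deriv (b # bs) chi x))"
        unfolding line_deriv_def iter_deriv_snoc
      proof
        fix x
        have "((\<lambda>s. iter_deriv bs chi (x + s *\<^sub>R b)) has_vector_derivative dir_deriv b (iter_deriv bs chi) x) (at 0)"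
          using sm Suc.prems by (intro line_deriv_dir_deriv) (auto simp: smooth_def)
        then show "((\<lambda>s. complex_of_real (iter_deriv bs chi (x + s *\<^sub>R b))) has_vector_derivative
            of_real (dir_deriv b (iter_deriv bs chi) x)) (at 0)"
          by (intro has_vector_derivative_of_real) (simp add: has_real_derivative_iff_has_vector_derivative)
      qed
    qed
    with dc[OF Suc.prems] show ?case by auto
  qed (use dc in auto)
  from this[of "[]"] show ?thesis by (simp add: iter_deriv_def)
qed

text \<open>The Bochner-Riesz symbol of order \<open>M\<close>. Its dilates are the building blocks
  of Taylor's formula at infinity.\<close>

definition bump :: "nat \<Rightarrow> 'a::euclidean_space \<Rightarrow> real" where
  "bump M x = max 0 (1 - (norm x)\<^sup>2) ^ M"

lemma decaying_bump:
  assumes "M \<ge> 1" shows "decaying (\<lambda>x::'a::euclidean_space. of_real (bump M x))"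
  unfolding decaying_def
proof (intro conjI allI)
  show "continuous_on UNIV (\<lambda>x::'a. complex_of_real (bump M x))"
    unfolding bump_def by (intro continuous_intros)
  fix N
  have "(1 + norm x) ^ N * norm (complex_of_real (bump M x)) \<le> 2 ^ N" for x :: 'a
  proof (cases "norm x \<le> 1")
    case True
    have "(1 + norm x) ^ N * \<bar>bump M x\<bar> \<le> 2 ^ N * 1"
      using True by (intro mult_mono power_mono) (auto simp: bump_def power_abs[symmetric] intro!: power_le_one)
    then show ?thesis unfolding norm_of_real by simp
  next
    case False
    then have "1 - (norm x)\<^sup>2 \<le> 0" by (simp add: power2_eq_square) (smt (verit) mult_less_cancel_left1)
    then have "bump M x = 0" using assms by (simp add: bump_def max_absorb1)
    then show ?thesis by simp
  qed
  then show "\<exists>B. \<forall>x::'a. (1 + norm x) ^ N * norm (complex_of_real (bump M x)) \<le> B" by blast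
qed

text \<open>Only the origin needs care. There the difference quotient is at most
  \<open>\<bar>h\<bar> ^ (M - 1)\<close>, and \<open>M \<ge> 2\<close> makes this exponent
  positive.\<close>

lemma has_derivative_pos_part_power:
  fixes t :: real
  assumes "M \<ge> 2"
  shows "((\<lambda>t. max 0 t ^ M) has_real_derivative (real M * max 0 t ^ (M - 1))) (at t)"
proof -
  consider "t > 0" | "t < 0" | "t = 0" by linarith
  then show ?thesis
  proof cases
    case 1
    have "((\<lambda>t. t ^ M) has_real_derivative (real M * max 0 t ^ (M - 1))) (at t)"
      using 1 by (auto intro!: derivative_eq_intros)
    moreover have "eventually (\<lambda>s. s ^ M = max 0 s ^ M) (nhds t)"
      using eventually_nhds_in_open[of "{0<..}" t] 1 by (auto elim!: eventually_mono)
    ultimately show ?thesis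
      using 1 by (subst (asm) DERIV_cong_ev) auto
  next
    case 2
    have "((\<lambda>t. 0) has_real_derivative (real M * max 0 t ^ (M - 1))) (at t)"
      using 2 assms by (auto intro!: derivative_eq_intros)
    moreover have "eventually (\<lambda>s. 0 = max 0 s ^ M) (nhds t)"
      using eventually_nhds_in_open[of "{..<0}" t] 2 assms by (auto elim!: eventually_mono)
    ultimately show ?thesis
      using 2 by (subst (asm) DERIV_cong_ev) auto
  next
    case 3
    have "((\<lambda>h. max 0 h ^ M / h) \<longlongrightarrow> 0) (at (0::real))"
    proof (rule Lim_null_comparison)
      show "\<forall>\<^sub>F h in at 0. norm (max 0 h ^ M / h) \<le> \<bar>h\<bar> ^ (M - 1)"
      proof (intro always_eventually allI)
        fix h :: real
        have "M = Suc (M - 1)" using assms by simp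
        then have "max 0 h ^ M = max 0 h * max 0 h ^ (M - 1)" by (metis power_Suc)
        then show "norm (max 0 h ^ M / h) \<le> \<bar>h\<bar> ^ (M - 1)"
          using assms by (cases "h > 0") (auto simp: max_absorb1 power_0_left)
      qed
      have "((\<lambda>h::real. \<bar>h\<bar> ^ (M - 1)) \<longlongrightarrow> \<bar>0\<bar> ^ (M - 1)) (at 0)"
        by (intro tendsto_intros)
      then show "((\<lambda>h::real. \<bar>h\<bar> ^ (M - 1)) \<longlongrightarrow> 0) (at 0)"
        using assms by (simp add: power_0_left)
    qed
    then show ?thesis
      using 3 assms unfolding DERIV_def by (simp add: power_0_left)
  qed
qed

text \<open>A derivative turns \<open>bump M\<close> into a multiple of a coordinate times
  \<open>bump (M - 1)\<close>. Each order thus costs one power, and one power has to remain for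
  continuity.\<close>

lemma rapid_bump: "k < M \<Longrightarrow> rapid k (\<lambda>x::'a::euclidean_space. of_real (bump M x))"
proof (induction k arbitrary: M)
  case (Suc k)
  have "line_deriv b (\<lambda>x::'a. of_real (bump M x)) (\<lambda>x. of_real (- 2 * M) * (of_real (x \<bullet> b) * of_real (bump (M - 1) x)))"
    for b :: 'a
    unfolding line_deriv_def
  proof
    fix x :: 'a
    have n: "(norm (x + s *\<^sub>R b))\<^sup>2 = x \<bullet> x + 2 * s * (x \<bullet> b) + s\<^sup>2 * (b \<bullet> b)" for s
      unfolding power2_norm_eq_inner
      by (simp add: inner_add_left inner_add_right inner_commute[of b x] power2_eq_square algebra_simps)
    have "((\<lambda>s. 1 - (x \<bullet> x + 2 * s * (x \<bullet> b) + s\<^sup>2 * (b \<bullet> b))) has_real_derivative - 2 * (x \<bullet> b)) (at 0)"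
      by (auto intro!: derivative_eq_intros)
    from DERIV_chain2[OF has_derivative_pos_part_power this, of M]
    have "((\<lambda>s. bump M (x + s *\<^sub>R b)) has_real_derivative (- 2 * M * (x \<bullet> b) * bump (M - 1) x)) (at 0)"
      unfolding bump_def n
      using Suc.prems by (simp add: power2_norm_eq_inner mult_ac)
    then show "((\<lambda>s. complex_of_real (bump M (x + s *\<^sub>R b))) has_vector_derivative
          of_real (- 2 * M) * (of_real (x \<bullet> b) * of_real (bump (M - 1) x))) (at 0)"
      by (rule has_vector_derivative_eq_rhs[OF has_vector_derivative_of_real]) simp
  qed
  moreover have "rapid k (\<lambda>x::'a. of_real (- 2 * M) * (of_real (x \<bullet> b) * of_real (bump (M - 1) x)))" for b
    using Suc.prems by (intro rapid_cmult rapid_coord Suc.IH) simp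
  moreover have "decaying (\<lambda>x::'a. of_real (bump M x))"
    using Suc.prems by (intro decaying_bump) auto
  ultimately show ?case
    unfolding rapid.simps by blast
qed (simp add: decaying_bump)


section \<open>Multipliers with integrable kernel\<close>

text \<open>\<open>N\<close> bounds the kernel norm from above instead of being equal to it, so
  constants may be enlarged freely. It is the bound for the action of the symbol on each
  L^p.\<close>

definition wiener :: "real \<Rightarrow> ('a::euclidean_space \<Rightarrow> complex) \<Rightarrow> bool" where
  "wiener N m \<longleftrightarrow> (\<exists>\<mu>. integrable lborel \<mu> \<and> (LINT y|lborel. norm (\<mu> y)) \<le> N \<and> m = ft \<mu>)"

text \<open>The sup bound \<open>B\<close> of the kernel is the endpoint from L^1 to L^\<infinity>;
  the general estimate interpolates between \<open>N\<close> and \<open>B\<close>.\<close>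

definition wiener_bdd :: "real \<Rightarrow> real \<Rightarrow> ('a::euclidean_space \<Rightarrow> complex) \<Rightarrow> bool" where
  "wiener_bdd N B m \<longleftrightarrow> (\<exists>\<mu>. integrable lborel \<mu> \<and> (LINT y|lborel. norm (\<mu> y)) \<le> N \<and>
     (\<forall>y. norm (\<mu> y) \<le> B) \<and> m = ft \<mu>)"

lemma wiener_bdd_imp_wiener: "wiener_bdd N B m \<Longrightarrow> wiener N m"
  unfolding wiener_def wiener_bdd_def by blast

lemma wiener_nonneg: "wiener N m \<Longrightarrow> 0 \<le> N" for m :: "'a::euclidean_space \<Rightarrow> complex"
proof -
  assume "wiener N m"
  then obtain \<mu> :: "'a \<Rightarrow> complex" where "(LINT y|lborel. norm (\<mu> y)) \<le> N"
    unfolding wiener_def by blast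
  moreover have "0 \<le> (LINT y|lborel. norm (\<mu> y))" by simp
  ultimately show ?thesis by linarith
qed

lemma wiener_bdd_nonneg: "wiener_bdd N B m \<Longrightarrow> 0 \<le> N \<and> 0 \<le> B" for m :: "'a::euclidean_space \<Rightarrow> complex"
proof
  assume m: "wiener_bdd N B m"
  then show "0 \<le> N" by (intro wiener_nonneg[OF wiener_bdd_imp_wiener])
  from m obtain \<mu> :: "'a \<Rightarrow> complex" where "\<And>y. norm (\<mu> y) \<le> B"
    unfolding wiener_bdd_def by blast
  then show "0 \<le> B" by (meson norm_ge_zero order_trans)
qed

lemma wiener_mono: "wiener N m \<Longrightarrow> N \<le> N' \<Longrightarrow> wiener N' m"
  unfolding wiener_def by (blast intro: order_trans)

lemma wiener_bdd_mono: "wiener_bdd N B m \<Longrightarrow> N \<le> N' \<Longrightarrow> B \<le> B' \<Longrightarrow> wiener_bdd N' B' m"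
  unfolding wiener_bdd_def by (blast intro: order_trans)

lemma wiener_add:
  assumes "wiener N m" "wiener N' m'" shows "wiener (N + N') (\<lambda>\<xi>. m \<xi> + m' \<xi>)"
proof -
  obtain \<mu> \<nu> where \<mu>: "integrable lborel \<mu>" "(LINT y|lborel. norm (\<mu> y)) \<le> N" "m = ft \<mu>"
    and \<nu>: "integrable lborel \<nu>" "(LINT y|lborel. norm (\<nu> y)) \<le> N'" "m' = ft \<nu>"
    using assms unfolding wiener_def by metis
  have "(LINT y|lborel. norm (\<mu> y + \<nu> y)) \<le> (LINT y|lborel. norm (\<mu> y) + norm (\<nu> y))"
    using \<mu> \<nu> by (intro integral_mono norm_triangle_ineq) auto
  also have "\<dots> \<le> N + N'" using \<mu> \<nu> by simp
  finally show ?thesis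
    using \<mu> \<nu> unfolding wiener_def
    by (intro exI[of _ "\<lambda>y. \<mu> y + \<nu> y"]) (auto simp: ft_add)
qed

lemma wiener_bdd_add:
  assumes "wiener_bdd N B m" "wiener_bdd N' B' m'" shows "wiener_bdd (N + N') (B + B') (\<lambda>\<xi>. m \<xi> + m' \<xi>)"
proof -
  obtain \<mu> \<nu> where \<mu>: "integrable lborel \<mu>" "(LINT y|lborel. norm (\<mu> y)) \<le> N" "m = ft \<mu>" "\<And>y. norm (\<mu> y) \<le> B"
    and \<nu>: "integrable lborel \<nu>" "(LINT y|lborel. norm (\<nu> y)) \<le> N'" "m' = ft \<nu>" "\<And>y. norm (\<nu> y) \<le> B'"
    using assms unfolding wiener_bdd_def by metis
  have "(LINT y|lborel. norm (\<mu> y + \<nu> y)) \<le> (LINT y|lborel. norm (\<mu> y) + norm (\<nu> y))"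
    using \<mu> \<nu> by (intro integral_mono norm_triangle_ineq) auto
  also have "\<dots> \<le> N + N'" using \<mu> \<nu> by simp
  finally show ?thesis
    using \<mu> \<nu> unfolding wiener_bdd_def
    by (intro exI[of _ "\<lambda>y. \<mu> y + \<nu> y"]) (auto simp: ft_add intro: norm_triangle_le add_mono)
qed

lemma wiener_cmult:
  assumes "wiener N m" shows "wiener (norm c * N) (\<lambda>\<xi>. c * m \<xi>)"
proof -
  obtain \<mu> where \<mu>: "integrable lborel \<mu>" "(LINT y|lborel. norm (\<mu> y)) \<le> N" "m = ft \<mu>"
    using assms unfolding wiener_def by metis
  then show ?thesis unfolding wiener_def
    by (intro exI[of _ "\<lambda>y. c * \<mu> y"]) (auto simp: ft_cmult norm_mult mult_left_mono)
qed

lemma wiener_bdd_cmult: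
  assumes "wiener_bdd N B m" shows "wiener_bdd (norm c * N) (norm c * B) (\<lambda>\<xi>. c * m \<xi>)"
proof -
  obtain \<mu> where \<mu>: "integrable lborel \<mu>" "(LINT y|lborel. norm (\<mu> y)) \<le> N" "m = ft \<mu>" "\<And>y. norm (\<mu> y) \<le> B"
    using assms unfolding wiener_bdd_def by metis
  then show ?thesis unfolding wiener_bdd_def
    by (intro exI[of _ "\<lambda>y. c * \<mu> y"]) (auto simp: ft_cmult norm_mult mult_left_mono)
qed

lemma wiener_mult:
  assumes "wiener N m" "wiener N' m'" shows "wiener (N * N') (\<lambda>\<xi>. m \<xi> * m' \<xi>)"
proof -
  obtain \<mu> \<nu> where \<mu>: "integrable lborel \<mu>" "(LINT y|lborel. norm (\<mu> y)) \<le> N" "m = ft \<mu>"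
    and \<nu>: "integrable lborel \<nu>" "(LINT y|lborel. norm (\<nu> y)) \<le> N'" "m' = ft \<nu>"
    using assms unfolding wiener_def by metis
  have "(LINT y|lborel. norm (conv \<mu> \<nu> y)) \<le> N * N'"
    using \<mu> \<nu> wiener_nonneg[OF assms(1)] by (intro order_trans[OF norm_conv_L1] mult_mono) auto
  then show ?thesis
    using \<mu> \<nu> unfolding wiener_def
    by (intro exI[of _ "conv \<mu> \<nu>"]) (auto simp: ft_conv integrable_conv)
qed

text \<open>One bounded kernel is enough: convolution with an integrable function preserves
  boundedness.\<close>

lemma wiener_bdd_mult:
  assumes "wiener N m" "wiener_bdd N' B m'" shows "wiener_bdd (N * N') (N * B) (\<lambda>\<xi>. m \<xi> * m' \<xi>)"
proof -
  obtain \<mu> \<nu> where \<mu>: "integrable lborel \<mu>" "(LINT y|lborel. norm (\<mu> y)) \<le> N" "m = ft \<mu>"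
    and \<nu>: "integrable lborel \<nu>" "(LINT y|lborel. norm (\<nu> y)) \<le> N'" "m' = ft \<nu>" "\<And>y. norm (\<nu> y) \<le> B"
    using assms unfolding wiener_def wiener_bdd_def by metis
  have "(LINT y|lborel. norm (conv \<mu> \<nu> y)) \<le> N * N'"
    using \<mu> \<nu> wiener_nonneg[OF assms(1)] by (intro order_trans[OF norm_conv_L1] mult_mono) auto
  moreover have "norm (conv \<mu> \<nu> y) \<le> N * B" for y
    using norm_conv_le[OF \<mu>(1) \<nu>(4), where x=y] \<mu>(2) wiener_bdd_nonneg[OF assms(2)]
    by (meson mult_right_mono order_trans)
  ultimately show ?thesis
    using \<mu> \<nu> unfolding wiener_bdd_def
    by (intro exI[of _ "conv \<mu> \<nu>"]) (auto simp: ft_conv integrable_conv)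
qed

lemma wiener_continuous: "wiener N m \<Longrightarrow> continuous_on UNIV m"
  unfolding wiener_def by (auto intro: continuous_ft)

text \<open>By inversion \<open>f\<close> is the transform of its own reflected transform, divided
  by \<open>(2 * pi) ^ DIM('a)\<close>.\<close>

lemma rapid_wiener_bdd:
  fixes f :: "'a::euclidean_space \<Rightarrow> complex"
  assumes "rapid (2 * DIM('a)) f"
  shows "\<exists>N B. wiener_bdd N B f"
proof -
  from rapid_invertible[OF assms] obtain B where f: "integrable lborel f" "continuous_on UNIV f"
    "\<And>x. norm (f x) \<le> B" "integrable lborel (ft f)"
    unfolding invertible_def by auto
  define \<mu> where "\<mu> y = of_real (1 / (2 * pi) ^ DIM('a)) * ft f (0 - y)" for y
  have i: "integrable lborel \<mu>"
    unfolding \<mu>_def[abs_def] by (intro integrable_mult_right lborel_integrable_minus f)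
  have "ft \<mu> \<xi> = f \<xi>" for \<xi>
  proof -
    have "ft (\<lambda>y. ft f (0 - y)) \<xi> = (LINT y|lborel. cis (\<xi> \<bullet> (0 - y)) * ft f (0 - (0 - y)))"
      unfolding ft_def[of "\<lambda>y. ft f (0 - y)"] using f by (subst lborel_integral_minus) auto
    also have "\<dots> = ft (ft f) (- \<xi>)"
      by (simp add: ft_def)
    finally show ?thesis
      unfolding \<mu>_def ft_cmult using ft_inversion[OF f(1-4)] by simp
  qed
  moreover have "norm (\<mu> y) \<le> (1 / (2 * pi) ^ DIM('a)) * (LINT y|lborel. norm (f y))" for y
    unfolding \<mu>_def norm_mult by (intro mult_mono norm_ft_le) (auto simp: norm_divide norm_power norm_mult)
  ultimately have "wiener_bdd (LINT y|lborel. norm (\<mu> y)) ((1 / (2 * pi) ^ DIM('a)) * (LINT y|lborel. norm (f y))) f"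
    using i unfolding wiener_bdd_def by (intro exI[of _ \<mu>]) (auto simp: fun_eq_iff)
  then show ?thesis by blast
qed

section \<open>Superpositions of dilated symbols\<close>

text \<open>In dimension n, a dilation by \<rho> in the symbol replaces the kernel \<mu>(y) by
  \<rho>^(-n) \<mu>(y / \<rho>), whose L^1 norm is the same; Fubini then sums with the weights
  \<open>h\<close>. Positivity of \<rho> is asked only where \<open>h\<close> does not vanish, which
  admits weights supported on a half-line.\<close>

lemma
  fixes \<mu> :: "'a::euclidean_space \<Rightarrow> complex" and h \<rho> :: "real \<Rightarrow> real"
  assumes \<mu>: "integrable lborel \<mu>" and h: "integrable lborel h" and \<rho>: "\<rho> \<in> borel_measurable borel"
    and pos: "\<And>\<tau>. h \<tau> \<noteq> 0 \<Longrightarrow> \<rho> \<tau> > 0"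
  defines "\<nu> \<equiv> \<lambda>y. LINT \<tau>|lborel. (h \<tau> / \<rho> \<tau> ^ DIM('a)) *\<^sub>R \<mu> ((1 / \<rho> \<tau>) *\<^sub>R y)"
  shows integrable_superposition: "integrable lborel \<nu>"
    and norm_superposition: "(LINT y|lborel. norm (\<nu> y)) \<le> (LINT \<tau>|lborel. \<bar>h \<tau>\<bar>) * (LINT y|lborel. norm (\<mu> y))"
    and ft_superposition: "ft \<nu> \<xi> = (LINT \<tau>|lborel. h \<tau> *\<^sub>R ft \<mu> (\<rho> \<tau> *\<^sub>R \<xi>))"
proof -
  have [measurable]: "\<mu> \<in> borel_measurable borel" "h \<in> borel_measurable borel" "\<rho> \<in> borel_measurable borel"
    using \<mu> h \<rho> by auto
  define K where "K = (\<lambda>\<tau> y. (h \<tau> / \<rho> \<tau> ^ DIM('a)) *\<^sub>R \<mu> ((1 / \<rho> \<tau>) *\<^sub>R y))"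
  have mK [measurable]: "(\<lambda>(\<tau>, y). K \<tau> y) \<in> borel_measurable (lborel \<Otimes>\<^sub>M lborel)"
    unfolding K_def by measurable
  have scale: "(LINT y|lborel. (h \<tau> / \<rho> \<tau> ^ DIM('a)) *\<^sub>R g ((1 / \<rho> \<tau>) *\<^sub>R y)) = h \<tau> *\<^sub>R (LINT y|lborel. g y)"
    if [measurable]: "g \<in> borel_measurable borel" for g :: "'a \<Rightarrow> 'b::{banach, second_countable_topology}" and \<tau>
  proof (cases "h \<tau> = 0")
    case False
    then show ?thesis
      using lborel_integral_affine[of "1 / \<rho> \<tau>" g 0] pos[of \<tau>]
      by (simp add: power_one_over field_simps)
  qed simp
  have iK: "integrable lborel (K \<tau>)" for \<tau>
    using lborel_integrable_affine[OF _ \<mu>, of "1 / \<rho> \<tau>" 0] pos[of \<tau>]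
    unfolding K_def by (cases "h \<tau> = 0") auto
  have nK: "(LINT y|lborel. norm (K \<tau> y)) = \<bar>h \<tau>\<bar> * (LINT y|lborel. norm (\<mu> y))" for \<tau>
  proof -
    have "(LINT y|lborel. norm (K \<tau> y)) = (LINT y|lborel. \<bar>h \<tau> / \<rho> \<tau> ^ DIM('a)\<bar> * norm (\<mu> ((1 / \<rho> \<tau>) *\<^sub>R y)))"
      by (simp add: K_def)
    also have "\<dots> = \<bar>LINT y|lborel. (h \<tau> / \<rho> \<tau> ^ DIM('a)) *\<^sub>R norm (\<mu> ((1 / \<rho> \<tau>) *\<^sub>R y))\<bar>"
      by (simp add: abs_mult del: integral_mult_right_zero) (simp add: abs_mult)
    also have "\<dots> = \<bar>h \<tau>\<bar> * (LINT y|lborel. norm (\<mu> y))"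
      by (subst scale) (auto simp: abs_mult)
    finally show ?thesis .
  qed
  have int: "integrable (lborel \<Otimes>\<^sub>M lborel) (\<lambda>(\<tau>, y). K \<tau> y)"
  proof (rule lborel_pair.Fubini_integrable)
    show "integrable lborel (\<lambda>\<tau>. LINT y|lborel. norm (case (\<tau>, y) of (\<tau>, y) \<Rightarrow> K \<tau> y))"
      using h by (simp add: nK)
  qed (auto simp: iK)
  have \<nu>: "\<nu> = (\<lambda>y. LINT \<tau>|lborel. K \<tau> y)"
    by (simp add: \<nu>_def K_def)
  show i\<nu>: "integrable lborel \<nu>"
    unfolding \<nu> using lborel_pair.integrable_snd[OF int] by simp
  have intn: "integrable (lborel \<Otimes>\<^sub>M lborel) (\<lambda>(\<tau>, y). norm (K \<tau> y))"
    using integrable_norm[OF int] by (simp add: case_prod_unfold)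
  have "(LINT y|lborel. norm (\<nu> y)) \<le> (LINT y|lborel. LINT \<tau>|lborel. norm (K \<tau> y))"
  proof (intro integral_mono integrable_norm i\<nu>)
    show "integrable lborel (\<lambda>y. LINT \<tau>|lborel. norm (K \<tau> y))"
      using lborel_pair.integrable_snd[OF intn] by simp
    show "norm (\<nu> y) \<le> (LINT \<tau>|lborel. norm (K \<tau> y))" for y
      unfolding \<nu> by (rule integral_norm_bound)
  qed
  also have "\<dots> = (LINT \<tau>|lborel. LINT y|lborel. norm (K \<tau> y))"
    using lborel_pair.Fubini_integral[OF intn] by simp
  finally show "(LINT y|lborel. norm (\<nu> y)) \<le> (LINT \<tau>|lborel. \<bar>h \<tau>\<bar>) * (LINT y|lborel. norm (\<mu> y))"
    by (simp add: nK)
  have int2: "integrable (lborel \<Otimes>\<^sub>M lborel) (\<lambda>(\<tau>, y). cis (\<xi> \<bullet> y) * K \<tau> y)"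
    using integrable_cis_mult[OF int, of "\<lambda>(\<tau>,y). \<xi> \<bullet> y"] by (simp add: case_prod_unfold)
  have "ft \<nu> \<xi> = (LINT y|lborel. LINT \<tau>|lborel. cis (\<xi> \<bullet> y) * K \<tau> y)"
    unfolding ft_def \<nu> by simp
  also have "\<dots> = (LINT \<tau>|lborel. LINT y|lborel. cis (\<xi> \<bullet> y) * K \<tau> y)"
    using lborel_pair.Fubini_integral[OF int2] by simp
  also have "\<dots> = (LINT \<tau>|lborel. h \<tau> *\<^sub>R ft \<mu> (\<rho> \<tau> *\<^sub>R \<xi>))"
  proof (intro Bochner_Integration.integral_cong refl)
    fix \<tau>
    show "(LINT y|lborel. cis (\<xi> \<bullet> y) * K \<tau> y) = h \<tau> *\<^sub>R ft \<mu> (\<rho> \<tau> *\<^sub>R \<xi>)"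
    proof (cases "h \<tau> = 0")
      case False
      then have "cis (\<xi> \<bullet> y) * K \<tau> y = (h \<tau> / \<rho> \<tau> ^ DIM('a)) *\<^sub>R
          (cis ((\<rho> \<tau> *\<^sub>R \<xi>) \<bullet> ((1 / \<rho> \<tau>) *\<^sub>R y)) * \<mu> ((1 / \<rho> \<tau>) *\<^sub>R y))" for y
        using pos[of \<tau>] by (simp add: K_def)
      then show ?thesis
        using scale[of "\<lambda>y. cis ((\<rho> \<tau> *\<^sub>R \<xi>) \<bullet> y) * \<mu> y" \<tau>] by (simp add: ft_def del: inner_scaleR_left)
    qed (simp add: K_def)
  qed
  finally show "ft \<nu> \<xi> = (LINT \<tau>|lborel. h \<tau> *\<^sub>R ft \<mu> (\<rho> \<tau> *\<^sub>R \<xi>))" .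
qed

lemma wiener_superposition:
  fixes m :: "'a::euclidean_space \<Rightarrow> complex" and h \<rho> :: "real \<Rightarrow> real"
  assumes m: "wiener N m" and h: "integrable lborel h" and \<rho>: "\<rho> \<in> borel_measurable borel"
    and pos: "\<And>\<tau>. h \<tau> \<noteq> 0 \<Longrightarrow> \<rho> \<tau> > 0"
  shows "wiener ((LINT \<tau>|lborel. \<bar>h \<tau>\<bar>) * N) (\<lambda>\<xi>. LINT \<tau>|lborel. h \<tau> *\<^sub>R m (\<rho> \<tau> *\<^sub>R \<xi>))"
proof -
  obtain \<mu> where \<mu>: "integrable lborel \<mu>" "(LINT y|lborel. norm (\<mu> y)) \<le> N" "m = ft \<mu>"
    using m unfolding wiener_def by metis
  have "(LINT \<tau>|lborel. \<bar>h \<tau>\<bar>) * (LINT y|lborel. norm (\<mu> y)) \<le> (LINT \<tau>|lborel. \<bar>h \<tau>\<bar>) * N"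
    using \<mu> by (intro mult_left_mono) auto
  with norm_superposition[OF \<mu>(1) h \<rho> pos] integrable_superposition[OF \<mu>(1) h \<rho> pos] ft_superposition[OF \<mu>(1) h \<rho> pos]
  show ?thesis
    unfolding wiener_def \<mu>(3)
    by (intro exI[of _ "\<lambda>y. LINT \<tau>|lborel. (h \<tau> / \<rho> \<tau> ^ DIM('a)) *\<^sub>R \<mu> ((1 / \<rho> \<tau>) *\<^sub>R y)"]) (auto simp: fun_eq_iff)
qed

text \<open>The dilated kernel is bounded by \<open>B / \<rho> \<tau> ^ DIM('a)\<close>; this is
  where the second weight, in \<open>hn\<close>, comes from.\<close>

lemma wiener_bdd_superposition:
  fixes m :: "'a::euclidean_space \<Rightarrow> complex" and h \<rho> :: "real \<Rightarrow> real"
  assumes m: "wiener_bdd N B m" and h: "integrable lborel h" and \<rho>: "\<rho> \<in> borel_measurable borel"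
    and pos: "\<And>\<tau>. h \<tau> \<noteq> 0 \<Longrightarrow> \<rho> \<tau> > 0"
    and hn: "integrable lborel (\<lambda>\<tau>. h \<tau> / \<rho> \<tau> ^ DIM('a))"
  shows "wiener_bdd ((LINT \<tau>|lborel. \<bar>h \<tau>\<bar>) * N) ((LINT \<tau>|lborel. \<bar>h \<tau> / \<rho> \<tau> ^ DIM('a)\<bar>) * B)
    (\<lambda>\<xi>. LINT \<tau>|lborel. h \<tau> *\<^sub>R m (\<rho> \<tau> *\<^sub>R \<xi>))"
proof -
  obtain \<mu> where \<mu>: "integrable lborel \<mu>" "(LINT y|lborel. norm (\<mu> y)) \<le> N" "\<And>y. norm (\<mu> y) \<le> B" "m = ft \<mu>"
    using m unfolding wiener_bdd_def by metis
  have B: "0 \<le> B" using wiener_bdd_nonneg[OF m] by simp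
  define \<nu> where "\<nu> y = (LINT \<tau>|lborel. (h \<tau> / \<rho> \<tau> ^ DIM('a)) *\<^sub>R \<mu> ((1 / \<rho> \<tau>) *\<^sub>R y))" for y
  have "norm (\<nu> y) \<le> (LINT \<tau>|lborel. \<bar>h \<tau> / \<rho> \<tau> ^ DIM('a)\<bar>) * B" for y
  proof -
    have "norm (\<nu> y) \<le> (LINT \<tau>|lborel. norm ((h \<tau> / \<rho> \<tau> ^ DIM('a)) *\<^sub>R \<mu> ((1 / \<rho> \<tau>) *\<^sub>R y)))"
      unfolding \<nu>_def by (rule integral_norm_bound)
    also have "\<dots> \<le> (LINT \<tau>|lborel. \<bar>h \<tau> / \<rho> \<tau> ^ DIM('a)\<bar> * B)"
      unfolding norm_scaleR real_norm_def
      by (intro integral_mono' mult_left_mono \<mu> mult_nonneg_nonneg integrable_mult_left integrable_abs hn B abs_ge_zero)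
    also have "\<dots> = (LINT \<tau>|lborel. \<bar>h \<tau> / \<rho> \<tau> ^ DIM('a)\<bar>) * B"
      by (rule integral_mult_left_zero)
    finally show ?thesis .
  qed
  moreover have "(LINT \<tau>|lborel. \<bar>h \<tau>\<bar>) * (LINT y|lborel. norm (\<mu> y)) \<le> (LINT \<tau>|lborel. \<bar>h \<tau>\<bar>) * N"
    using \<mu> by (intro mult_left_mono) auto
  ultimately show ?thesis
    using norm_superposition[OF \<mu>(1) h \<rho> pos] integrable_superposition[OF \<mu>(1) h \<rho> pos] ft_superposition[OF \<mu>(1) h \<rho> pos]
    unfolding wiener_bdd_def \<mu>(4) \<nu>_def
    by (intro exI[of _ "\<lambda>y. LINT \<tau>|lborel. (h \<tau> / \<rho> \<tau> ^ DIM('a)) *\<^sub>R \<mu> ((1 / \<rho> \<tau>) *\<^sub>R y)"]) (auto simp: fun_eq_iff)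
qed


section \<open>The symbol of the heat kernel at unit time\<close>

lemma powr_mult_exp_neg_le:
  fixes \<gamma> \<sigma> :: real
  assumes \<sigma>: "\<sigma> > 0"
  shows "\<exists>C>0. \<forall>u\<ge>1. u powr \<gamma> * exp (- (u powr \<sigma>)) \<le> C * u powr - 2"
proof -
  \<comment> \<open>Large enough for \<open>k * \<sigma> \<ge> \<gamma> + 2\<close>. Then exp x >=
    (x / k)^k with x = \<open>u powr \<sigma>\<close> beats the power of \<open>u\<close> and leaves
    \<open>u powr - 2\<close>.\<close>
  define k where "k = Suc (nat \<lceil>(\<bar>\<gamma>\<bar> + 2) / \<sigma>\<rceil>)"
  have "(\<bar>\<gamma>\<bar> + 2) / \<sigma> \<le> real k"
    unfolding k_def by linarith
  then have k: "\<gamma> + 2 \<le> k * \<sigma>"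
    using \<sigma> by (simp add: field_simps)
  have "u powr \<gamma> * exp (- (u powr \<sigma>)) \<le> real k ^ k * u powr - 2" if u: "u \<ge> 1" for u
  proof -
    have v: "u powr \<sigma> > 0" using u by simp
    have kp: "real k > 0" by (simp add: k_def)
    have "(u powr \<sigma> / real k) ^ k \<le> (1 + u powr \<sigma> / real k) ^ k"
      using v by (intro power_mono) auto
    also have "\<dots> \<le> exp (u powr \<sigma>)"
    proof (rule exp_ge_one_plus_x_over_n_power_n)
      show "- real k \<le> u powr \<sigma>"
        using v of_nat_0_le_iff[of k] by linarith
    qed (simp add: k_def)
    finally have "exp (- (u powr \<sigma>)) \<le> real k ^ k / (u powr \<sigma>) ^ k"
      using v kp by (simp add: exp_minus power_divide field_simps)
    also have "(u powr \<sigma>) ^ k = u powr (k * \<sigma>)"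
      using u by (simp add: powr_realpow[symmetric] powr_powr mult.commute)
    finally have "u powr \<gamma> * exp (- (u powr \<sigma>)) \<le> u powr \<gamma> * (real k ^ k / u powr (k * \<sigma>))"
      by (intro mult_left_mono) auto
    also have "\<dots> = real k ^ k * u powr (\<gamma> - k * \<sigma>)"
      using u by (simp add: powr_diff)
    also have "\<dots> \<le> real k ^ k * u powr - 2"
      using k u by (intro mult_left_mono powr_mono) auto
    finally show ?thesis .
  qed
  then show ?thesis by (intro exI[of _ "real k ^ k"]) (auto simp: k_def)
qed

lemma integrable_powr_exp:
  fixes \<gamma> \<sigma> :: real
  assumes \<gamma>: "\<gamma> > -1" and \<sigma>: "\<sigma> > 0"
  shows "integrable lborel (\<lambda>u. indicator {0<..} u * (u powr \<gamma> * exp (- (u powr \<sigma>))))"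
proof -
  obtain C where C: "C > 0" "\<And>u. u \<ge> 1 \<Longrightarrow> u powr \<gamma> * exp (- (u powr \<sigma>)) \<le> C * u powr - 2"
    using powr_mult_exp_neg_le[OF \<sigma>] by blast
  have "(\<lambda>x. x powr \<gamma>) integrable_on {0..1}"
    using \<gamma> by (intro integrable_on_powr_from_0) auto
  then have "set_integrable lebesgue {0..1} (\<lambda>x. x powr \<gamma>)"
    by (intro nonnegative_absolutely_integrable_1) auto
  then have 1: "integrable lborel (\<lambda>x. indicat_real {0..1} x * x powr \<gamma>)"
    unfolding set_integrable_def by (subst (asm) integrable_completion) auto
  have "(\<lambda>x. x powr - 2) integrable_on {1::real..}"
    using has_integral_powr_to_inf[of "-2" 1] by (auto simp: integrable_on_def)
  then have "set_integrable lebesgue {1..} (\<lambda>x::real. x powr - 2)"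
    by (intro nonnegative_absolutely_integrable_1) auto
  then have 2: "integrable lborel (\<lambda>x. indicat_real {1..} x * x powr - 2)"
    unfolding set_integrable_def by (subst (asm) integrable_completion) auto
  \<comment> \<open>The majorant is split at 1: near 0 the power is integrable because
    \<open>\<gamma> > -1\<close>, beyond 1 the exponential leaves an inverse square.\<close>
  have le: "indicator {0<..} u * (u powr \<gamma> * exp (- (u powr \<sigma>))) \<le>
      indicat_real {0..1} u * u powr \<gamma> + C * (indicat_real {1..} u * u powr - 2)" for u
  proof (cases "u < 1")
    case True
    have "u powr \<gamma> * exp (- (u powr \<sigma>)) \<le> u powr \<gamma> * 1"
      by (intro mult_left_mono) auto
    then show ?thesis using True C(1) by (auto simp: indicator_def)
  next
    case False
    have "0 \<le> indicat_real {0..1} u * u powr \<gamma>" by auto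
    then show ?thesis using False C(2)[of u] by (auto simp: indicator_def)
  qed
  have nn: "0 \<le> indicator {0<..} u * (u powr \<gamma> * exp (- (u powr \<sigma>)))" for u :: real
    by auto
  show ?thesis
  proof (rule Bochner_Integration.integrable_bound)
    show "integrable lborel (\<lambda>u. indicat_real {0..1} u * u powr \<gamma> + C * (indicat_real {1..} u * u powr - 2))"
      using 1 2 by auto
    show "AE u in lborel. norm (indicator {0<..} u * (u powr \<gamma> * exp (- (u powr \<sigma>)))) \<le>
        norm (indicat_real {0..1} u * u powr \<gamma> + C * (indicat_real {1..} u * u powr - 2))"
      using le nn by (intro AE_I2) (smt (verit) real_norm_def)
  qed measurable
qed

lemma tendsto_powr_exp:
  fixes \<gamma> \<sigma> :: real
  assumes \<sigma>: "\<sigma> > 0"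
  shows "((\<lambda>u. u powr \<gamma> * exp (- (u powr \<sigma>))) \<longlongrightarrow> 0) at_top"
proof -
  obtain C where C: "C > 0" "\<And>u. u \<ge> 1 \<Longrightarrow> u powr \<gamma> * exp (- (u powr \<sigma>)) \<le> C * u powr - 2"
    using powr_mult_exp_neg_le[OF \<sigma>] by blast
  have "((\<lambda>u::real. u powr - 2) \<longlongrightarrow> 0) at_top"
    by (intro tendsto_neg_powr filterlim_ident) auto
  then have "((\<lambda>u. C * u powr - 2) \<longlongrightarrow> 0) at_top"
    by (rule tendsto_mult_right_zero)
  then show ?thesis
  proof (rule Lim_null_comparison[rotated])
    show "\<forall>\<^sub>F u in at_top. norm (u powr \<gamma> * exp (- (u powr \<sigma>))) \<le> C * u powr - 2"
      using eventually_ge_at_top[of 1] by eventually_elim (use C in auto)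
  qed
qed

text \<open>The \<open>k\<close>-th derivative of \<open>u powr \<beta> * exp (- (u powr \<sigma>))\<close> is
  \<open>(-1) ^ k * u powr (\<beta> - k) * poly (derivp \<beta> \<sigma> k) (u powr \<sigma>) * exp (- (u powr \<sigma>))\<close>.\<close>

primrec derivp :: "real \<Rightarrow> real \<Rightarrow> nat \<Rightarrow> real poly" where
  "derivp \<beta> \<sigma> 0 = 1"
| "derivp \<beta> \<sigma> (Suc k) = smult (real k - \<beta>) (derivp \<beta> \<sigma> k) +
     pCons 0 (smult \<sigma> (derivp \<beta> \<sigma> k - pderiv (derivp \<beta> \<sigma> k)))"

definition pexp :: "real poly \<Rightarrow> real \<Rightarrow> real \<Rightarrow> real \<Rightarrow> real" where
  "pexp P \<beta> \<sigma> u = u powr \<beta> * poly P (u powr \<sigma>) * exp (- (u powr \<sigma>))"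

lemma borel_measurable_poly [measurable (raw)]:
  "f \<in> borel_measurable M \<Longrightarrow> (\<lambda>x. poly (P :: real poly) (f x)) \<in> borel_measurable M"
  by (rule measurable_compose[OF _ borel_measurable_continuous_onI]) (auto intro!: continuous_intros)

lemma borel_measurable_pexp [measurable]: "pexp P \<beta> \<sigma> \<in> borel_measurable borel"
  unfolding pexp_def[abs_def] by measurable

lemma pexp_monomials:
  fixes \<beta> \<sigma> u :: real
  shows "u > 0 \<Longrightarrow> pexp P \<beta> \<sigma> u = (\<Sum>i\<le>degree P. coeff P i * (u powr (\<beta> + i * \<sigma>) * exp (- (u powr \<sigma>))))"
proof -
  assume u: "u > 0"
  have "(u powr \<sigma>) ^ i = u powr (i * \<sigma>)" for i :: nat
    using u by (simp add: powr_realpow[symmetric] powr_powr mult.commute)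
  then show ?thesis
    unfolding pexp_def poly_altdef sum_distrib_left sum_distrib_right
    by (intro sum.cong) (simp_all add: powr_add mult_ac)
qed

lemma integrable_pexp:
  assumes \<gamma>: "\<gamma> > -1" and \<sigma>: "\<sigma> > 0"
  shows "integrable lborel (\<lambda>u. indicator {0<..} u * pexp P \<gamma> \<sigma> u)"
proof -
  have "integrable lborel (\<lambda>u. \<Sum>i\<le>degree P. coeff P i * (indicator {0<..} u * (u powr (\<gamma> + i * \<sigma>) * exp (- (u powr \<sigma>)))))"
    using assms by (intro Bochner_Integration.integrable_sum integrable_mult_right integrable_powr_exp) (auto intro: less_le_trans)
  also have "(\<lambda>u. \<Sum>i\<le>degree P. coeff P i * (indicator {0<..} u * (u powr (\<gamma> + i * \<sigma>) * exp (- (u powr \<sigma>))))) =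
      (\<lambda>u. indicator {0<..} u * pexp P \<gamma> \<sigma> u)"
    by (auto simp: fun_eq_iff indicator_def intro!: pexp_monomials[symmetric])
  finally show ?thesis .
qed

lemma tendsto_pexp:
  assumes "\<sigma> > 0" shows "(pexp P \<gamma> \<sigma> \<longlongrightarrow> 0) at_top"
proof -
  have "((\<lambda>u. \<Sum>i\<le>degree P. coeff P i * (u powr (\<gamma> + i * \<sigma>) * exp (- (u powr \<sigma>)))) \<longlongrightarrow> (\<Sum>i\<le>degree P. coeff P i * 0)) at_top"
    by (intro tendsto_intros tendsto_powr_exp assms)
  then have "((\<lambda>u. \<Sum>i\<le>degree P. coeff P i * (u powr (\<gamma> + i * \<sigma>) * exp (- (u powr \<sigma>)))) \<longlongrightarrow> 0) at_top"
    by simp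
  then show ?thesis
  proof (rule Lim_transform_eventually)
    show "\<forall>\<^sub>F u in at_top. (\<Sum>i\<le>degree P. coeff P i * (u powr (\<gamma> + i * \<sigma>) * exp (- (u powr \<sigma>)))) = pexp P \<gamma> \<sigma> u"
      using eventually_gt_at_top[of 0] by eventually_elim (rule pexp_monomials[symmetric])
  qed
qed

lemma pexp_powr: "u > 0 \<Longrightarrow> u powr c * pexp P \<beta> \<sigma> u = pexp P (\<beta> + c) \<sigma> u"
  by (simp add: pexp_def powr_add mult_ac)

section \<open>Taylor's formula at infinity\<close>

text \<open>The factor (-1)^k of the k-th derivative is dropped, so that Taylor's formula at
  infinity carries no alternating signs.\<close>

definition nderiv :: "real \<Rightarrow> real \<Rightarrow> nat \<Rightarrow> real \<Rightarrow> real" where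
  "nderiv \<beta> \<sigma> k = pexp (derivp \<beta> \<sigma> k) (\<beta> - k) \<sigma>"

lemma DERIV_nderiv:
  assumes u: "u > 0"
  shows "(nderiv \<beta> \<sigma> k has_real_derivative - nderiv \<beta> \<sigma> (Suc k) u) (at u)"
proof -
  define P where "P = derivp \<beta> \<sigma> k"
  have d1: "((\<lambda>u. u powr c) has_real_derivative c * u powr c / u) (at u)" for c
    using has_real_derivative_powr[OF u, of c] u by (simp add: powr_diff)
  have d2: "((\<lambda>u. poly P (u powr \<sigma>)) has_real_derivative poly (pderiv P) (u powr \<sigma>) * (\<sigma> * u powr \<sigma> / u)) (at u)"
    by (rule DERIV_chain2[OF poly_DERIV d1])
  have d3: "((\<lambda>u. exp (- (u powr \<sigma>))) has_real_derivative exp (- (u powr \<sigma>)) * - (\<sigma> * u powr \<sigma> / u)) (at u)"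
    by (rule DERIV_chain2[OF DERIV_exp DERIV_minus[OF d1]])
  have "(nderiv \<beta> \<sigma> k has_real_derivative
      ((\<beta> - k) * u powr (\<beta> - k) / u * poly P (u powr \<sigma>) + poly (pderiv P) (u powr \<sigma>) * (\<sigma> * u powr \<sigma> / u) * u powr (\<beta> - k)) * exp (- (u powr \<sigma>))
      + exp (- (u powr \<sigma>)) * - (\<sigma> * u powr \<sigma> / u) * (u powr (\<beta> - k) * poly P (u powr \<sigma>))) (at u)"
    unfolding nderiv_def pexp_def[abs_def] P_def[symmetric]
    by (rule DERIV_mult'[OF DERIV_mult'[OF d1 d2] d3, THEN DERIV_cong]) (simp add: algebra_simps)
  also have "((\<beta> - k) * u powr (\<beta> - k) / u * poly P (u powr \<sigma>) + poly (pderiv P) (u powr \<sigma>) * (\<sigma> * u powr \<sigma> / u) * u powr (\<beta> - k)) * exp (- (u powr \<sigma>))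
      + exp (- (u powr \<sigma>)) * - (\<sigma> * u powr \<sigma> / u) * (u powr (\<beta> - k) * poly P (u powr \<sigma>)) = - nderiv \<beta> \<sigma> (Suc k) u"
  proof -
    have e: "u powr (\<beta> - real (Suc k)) = u powr (\<beta> - k) / u"
      using u powr_diff[of u "\<beta> - k" 1] by (simp add: algebra_simps)
    have S: "nderiv \<beta> \<sigma> (Suc k) u = (u powr (\<beta> - k) / u) *
        ((real k - \<beta>) * poly P (u powr \<sigma>) + u powr \<sigma> * (\<sigma> * (poly P (u powr \<sigma>) - poly (pderiv P) (u powr \<sigma>)))) * exp (- (u powr \<sigma>))"
      unfolding nderiv_def pexp_def derivp.simps P_def[symmetric] e by simp
    show ?thesis
      unfolding S using u by (simp add: field_simps)
  qed
  finally show ?thesis .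
qed

lemma continuous_nderiv: "u > 0 \<Longrightarrow> isCont (nderiv \<beta> \<sigma> k) u"
  using DERIV_isCont[OF DERIV_nderiv] .

text \<open>Allows the shifted power in Taylor's formula to be replaced by \<open>u ^ k\<close>,
  which merges with \<open>nderiv\<close> into a single \<open>pexp\<close>.\<close>

lemma abs_shifted_power_le:
  fixes s u X :: real
  assumes "0 < s" "s < u"
  shows "\<bar>(u - s) ^ k / fact k * X\<bar> \<le> \<bar>u ^ k * X\<bar>"
proof -
  have "(u - s) ^ k / fact k \<le> (u - s) ^ k / 1"
    using assms by (intro divide_left_mono) (auto simp: fact_ge_1)
  also have "\<dots> \<le> u ^ k"
    using assms by (auto intro!: power_mono)
  finally have "\<bar>(u - s) ^ k / fact k\<bar> \<le> \<bar>u ^ k\<bar>"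
    using assms by simp
  then show ?thesis
    unfolding abs_mult by (rule mult_right_mono) simp
qed

text \<open>The primitive \<open>G u\<close> is minus the Taylor polynomial of degree
  \<open>M\<close> about \<open>u\<close>, evaluated at \<open>s\<close>. Its derivative telescopes
  to the remainder term, it vanishes as \<open>u\<close> tends to infinity, and at
  \<open>u = s\<close> only the term of order 0 survives.\<close>

lemma integral_Taylor_tail:
  assumes \<sigma>: "\<sigma> > 0" and \<beta>: "\<beta> > 0" and s: "s > 0"
  shows "(LINT u|lborel. indicator {s<..} u * ((u - s) ^ M / fact M * nderiv \<beta> \<sigma> (Suc M) u)) = s powr \<beta> * exp (- (s powr \<sigma>))"
proof -
  define G where "G u = - (\<Sum>k\<le>M. (u - s) ^ k / fact k * nderiv \<beta> \<sigma> k u)" for u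
  define g where "g u = (u - s) ^ M / fact M * nderiv \<beta> \<sigma> (Suc M) u" for u
  have dG: "(G has_real_derivative g u) (at u)" if u: "u > 0" for u
    unfolding G_def[abs_def] g_def
  proof (induction M)
    case 0
    then show ?case using DERIV_minus[OF DERIV_nderiv[OF u, of \<beta> \<sigma> 0]] by simp
  next
    case (Suc M)
    have "((\<lambda>u. (u - s) ^ Suc M / fact (Suc M)) has_real_derivative (u - s) ^ M / fact M) (at u)"
    proof -
      have "((\<lambda>u. (u - s) ^ Suc M) has_real_derivative real (Suc M) * (u - s) ^ (Suc M - Suc 0) * 1) (at u)"
        by (rule DERIV_chain2[OF DERIV_pow]) (auto intro!: derivative_eq_intros)
      moreover have "real (Suc M) * (u - s) ^ (Suc M - Suc 0) * 1 / fact (Suc M) = (u - s) ^ M / fact M"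
        by (simp del: of_nat_Suc)
      ultimately show ?thesis
        using DERIV_cdivide[of "\<lambda>u. (u - s) ^ Suc M" _ u UNIV "fact (Suc M)"] by metis
    qed
    from DERIV_minus[OF DERIV_mult'[OF this DERIV_nderiv[OF u, of \<beta> \<sigma> "Suc M"]]]
    have "((\<lambda>u. - ((u - s) ^ Suc M / fact (Suc M) * nderiv \<beta> \<sigma> (Suc M) u)) has_real_derivative
      - ((u - s) ^ Suc M / fact (Suc M) * - nderiv \<beta> \<sigma> (Suc (Suc M)) u + (u - s) ^ M / fact M * nderiv \<beta> \<sigma> (Suc M) u)) (at u)" .
    from DERIV_add[OF Suc.IH this] show ?case
      unfolding sum.atMost_Suc minus_add_distrib by (rule DERIV_cong) simp
  qed
  have gi: "set_integrable lborel (einterval s \<infinity>) g"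
  proof -
    \<comment> \<open>Positivity of \<beta> enters here: it makes the exponent
      \<open>\<beta> - 1\<close> of the majorant exceed -1.\<close>
    have "integrable lborel (\<lambda>u. indicator {0<..} u * pexp (derivp \<beta> \<sigma> (Suc M)) (\<beta> - 1) \<sigma> u)"
      using \<beta> \<sigma> by (intro integrable_pexp) auto
    then show ?thesis unfolding set_integrable_def
    proof (rule Bochner_Integration.integrable_bound)
      show "(\<lambda>u. indicat_real (einterval s \<infinity>) u *\<^sub>R g u) \<in> borel_measurable lborel"
        unfolding g_def[abs_def] nderiv_def by measurable
      have "norm (indicat_real (einterval s \<infinity>) u *\<^sub>R g u) \<le>
         norm (indicator {0<..} u * pexp (derivp \<beta> \<sigma> (Suc M)) (\<beta> - 1) \<sigma> u)" for u
      proof (cases "u > s")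
        case True
        then have u: "u > 0" using s by simp
        have "pexp (derivp \<beta> \<sigma> (Suc M)) (\<beta> - 1) \<sigma> u = u ^ M * nderiv \<beta> \<sigma> (Suc M) u"
          using pexp_powr[OF u, of M "derivp \<beta> \<sigma> (Suc M)" "\<beta> - Suc M" \<sigma>] u
          by (simp add: nderiv_def powr_realpow)
        then show ?thesis
          using True u abs_shifted_power_le[OF s True, of M "nderiv \<beta> \<sigma> (Suc M) u"]
          by (simp add: g_def einterval_def del: derivp.simps)
      qed (auto simp: einterval_def)
      then show "AE u in lborel. norm (indicat_real (einterval s \<infinity>) u *\<^sub>R g u) \<le>
         norm (indicator {0<..} u * pexp (derivp \<beta> \<sigma> (Suc M)) (\<beta> - 1) \<sigma> u)"
        by simp
    qed
  qed
  have "(LBINT u=s..\<infinity>. g u) = 0 - G s"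
  proof (rule interval_integral_FTC_integrable[OF _ _ _ gi])
    show "(G has_vector_derivative g u) (at u)" if "ereal s < ereal u" for u
      using dG[of u] that s by (simp add: has_real_derivative_iff_has_vector_derivative)
    show "isCont g u" if "ereal s < ereal u" for u
      unfolding g_def using that s by (intro continuous_intros continuous_nderiv) auto
    have "((\<lambda>x. G x) \<longlongrightarrow> G s) (at s within {s<..})"
      using DERIV_isCont[OF dG[OF s]] by (simp add: continuous_within tendsto_within_subset[of _ _ _ UNIV] isCont_def)
    then show "((G \<circ> real_of_ereal) \<longlongrightarrow> G s) (at_right (ereal s))"
      by (simp add: at_right_ereal tendsto_compose_filtermap o_def filterlim_filtermap)
    have "((\<lambda>u. (u - s) ^ k / fact k * nderiv \<beta> \<sigma> k u) \<longlongrightarrow> 0) at_top" for k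
    proof (rule Lim_null_comparison[OF _ tendsto_rabs_zero[OF tendsto_pexp[OF \<sigma>, of "derivp \<beta> \<sigma> k" \<beta>]]])
      show "\<forall>\<^sub>F u in at_top. norm ((u - s) ^ k / fact k * nderiv \<beta> \<sigma> k u) \<le> \<bar>pexp (derivp \<beta> \<sigma> k) \<beta> \<sigma> u\<bar>"
        using eventually_gt_at_top[of s]
      proof eventually_elim
        case (elim u)
        then have u: "u > 0" using s by simp
        have "pexp (derivp \<beta> \<sigma> k) \<beta> \<sigma> u = u ^ k * nderiv \<beta> \<sigma> k u"
          using pexp_powr[OF u, of k "derivp \<beta> \<sigma> k" "\<beta> - k" \<sigma>] u
          by (simp add: nderiv_def powr_realpow)
        then show ?case
          using abs_shifted_power_le[OF s elim, of k "nderiv \<beta> \<sigma> k u"] by simp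
      qed
    qed
    then have "(G \<longlongrightarrow> - (\<Sum>k\<le>M. 0)) at_top"
      unfolding G_def[abs_def] by (intro tendsto_minus tendsto_sum)
    then have "(G \<longlongrightarrow> 0) at_top"
      by simp
    then show "((G \<circ> real_of_ereal) \<longlongrightarrow> 0) (at_left \<infinity>)"
      by (simp add: at_left_PInf o_def filterlim_filtermap)
  qed simp
  also have "G s = - (s powr \<beta> * exp (- (s powr \<sigma>)))"
    unfolding G_def by (subst sum.atMost_shift) (simp add: nderiv_def pexp_def)
  finally show ?thesis
    by (simp add: interval_lebesgue_integral_def set_lebesgue_integral_def einterval_def g_def
        greaterThan_def)
qed

lemma wiener_bdd_powr_exp:
  fixes \<beta> \<sigma> :: real
  assumes \<beta>: "\<beta> > 0" and \<sigma>: "\<sigma> > 0"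
  shows "\<exists>N B. wiener_bdd N B (\<lambda>\<xi>::'a::euclidean_space.
    of_real (norm \<xi> powr (2 * \<beta>) * exp (- (norm \<xi> powr (2 * \<sigma>)))))"
proof -
  \<comment> \<open>\<open>rapid_wiener_bdd\<close> asks for \<open>2 * DIM('a)\<close> derivatives,
    and \<open>rapid_bump\<close> provides fewer than \<open>M\<close>.\<close>
  define M where "M = Suc (2 * DIM('a))"
  obtain N B where NB: "wiener_bdd N B (\<lambda>x::'a. of_real (bump M x))"
    using rapid_wiener_bdd[OF rapid_bump[of "2 * DIM('a)" M]] by (auto simp: M_def)
  define h where "h u = indicator {0<..} u * (u ^ M / fact M * nderiv \<beta> \<sigma> (Suc M) u)" for u :: real
  \<comment> \<open>With this dilation the bump becomes the positive part of 1 - |\<xi>|^2 / u, to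
    the power \<open>M\<close>.\<close>
  define \<rho> where "\<rho> u = u powr (- 1 / 2)" for u :: real
  have h_eq: "h u = (1 / fact M) * (indicator {0<..} u * pexp (derivp \<beta> \<sigma> (Suc M)) (\<beta> - 1) \<sigma> u)" for u
    using pexp_powr[of u M "derivp \<beta> \<sigma> (Suc M)" "\<beta> - Suc M" \<sigma>]
    by (auto simp: h_def nderiv_def powr_realpow indicator_def)
  have hi: "integrable lborel h"
    unfolding h_eq[abs_def] using \<beta> \<sigma> by (intro integrable_mult_right integrable_pexp) auto
  \<comment> \<open>Division by \<open>\<rho> u ^ DIM('a)\<close> raises the exponent by half the
    dimension, which keeps it above -1.\<close>
  have hn_eq: "h u / \<rho> u ^ DIM('a) = (1 / fact M) * (indicator {0<..} u * pexp (derivp \<beta> \<sigma> (Suc M)) (\<beta> - 1 + DIM('a) / 2) \<sigma> u)" for u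
  proof (cases "u > 0")
    case True
    then have r: "\<rho> u ^ DIM('a) = u powr (- (DIM('a) / 2))"
      by (simp add: \<rho>_def powr_realpow[symmetric] powr_powr)
    have "h u / \<rho> u ^ DIM('a) = h u * u powr (DIM('a) / 2)"
      unfolding r powr_minus divide_inverse inverse_inverse_eq ..
    also have "\<dots> = (1 / fact M) * (indicator {0<..} u *
        (u powr (DIM('a) / 2) * pexp (derivp \<beta> \<sigma> (Suc M)) (\<beta> - 1) \<sigma> u))"
      by (simp add: h_eq del: derivp.simps)
    finally show ?thesis
      unfolding pexp_powr[OF True] .
  qed (simp add: h_def)
  have hni: "integrable lborel (\<lambda>u. h u / \<rho> u ^ DIM('a))"
    unfolding hn_eq[abs_def] using \<beta> \<sigma> by (intro integrable_mult_right integrable_pexp) (auto intro: add_pos_nonneg less_le_trans)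
  have \<rho>m: "\<rho> \<in> borel_measurable borel" unfolding \<rho>_def[abs_def] by measurable
  have \<rho>p: "\<rho> u > 0" if "h u \<noteq> 0" for u
    using that by (auto simp: h_def \<rho>_def indicator_def split: if_splits)
  define m where "m \<xi> = (LINT u|lborel. h u *\<^sub>R complex_of_real (bump M (\<rho> u *\<^sub>R \<xi>)))" for \<xi> :: 'a
  define m' where "m' \<xi> = complex_of_real (norm \<xi> powr (2 * \<beta>) * exp (- (norm \<xi> powr (2 * \<sigma>))))" for \<xi> :: 'a
  have W: "wiener_bdd ((LINT \<tau>|lborel. \<bar>h \<tau>\<bar>) * N) ((LINT \<tau>|lborel. \<bar>h \<tau> / \<rho> \<tau> ^ DIM('a)\<bar>) * B) m"
    unfolding m_def[abs_def] by (rule wiener_bdd_superposition[OF NB hi \<rho>m \<rho>p hni])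
  have eq: "m \<xi> = m' \<xi>" if "\<xi> \<noteq> 0" for \<xi>
  proof -
    define s where "s = (norm \<xi>)\<^sup>2"
    have s: "s > 0" using that by (simp add: s_def)
    have "h u *\<^sub>R complex_of_real (bump M (\<rho> u *\<^sub>R \<xi>)) =
        of_real (indicator {s<..} u * ((u - s) ^ M / fact M * nderiv \<beta> \<sigma> (Suc M) u))" for u
    proof (cases "u > 0")
      case True
      have "(norm (\<rho> u *\<^sub>R \<xi>))\<^sup>2 = s / u"
      proof -
        have "\<rho> u * \<rho> u = u powr (- 1)"
          unfolding \<rho>_def powr_add[symmetric] by simp
        then have "(\<rho> u)\<^sup>2 = 1 / u"
          using True by (simp add: power2_eq_square powr_minus_divide)
        then show ?thesis
          by (simp add: s_def power_mult_distrib)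
      qed
      then have "u ^ M * bump M (\<rho> u *\<^sub>R \<xi>) = (u * max 0 (1 - s / u)) ^ M"
        by (simp add: bump_def power_mult_distrib)
      also have "u * max 0 (1 - s / u) = max 0 (u - s)"
        using True by (simp add: max_def field_simps)
      also have "max 0 (u - s) ^ M = indicator {s<..} u * (u - s) ^ M"
        by (auto simp: M_def max_def indicator_def)
      finally have "u ^ M * bump M (\<rho> u *\<^sub>R \<xi>) = indicator {s<..} u * (u - s) ^ M" .
      then have "h u * bump M (\<rho> u *\<^sub>R \<xi>) = indicator {s<..} u * ((u - s) ^ M / fact M * nderiv \<beta> \<sigma> (Suc M) u)"
        using True by (simp add: h_def field_simps)
      then show ?thesis
        by (simp add: scaleR_conv_of_real del: of_real_mult flip: of_real_mult)
    next
      case False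
      then show ?thesis using s by (simp add: h_def)
    qed
    then have "m \<xi> = of_real (LINT u|lborel. indicator {s<..} u * ((u - s) ^ M / fact M * nderiv \<beta> \<sigma> (Suc M) u))"
      unfolding m_def by (simp del: of_real_mult)
    also have "\<dots> = m' \<xi>"
    proof -
      have "s powr c = norm \<xi> powr (2 * c)" for c
        using powr_powr[of "norm \<xi>" 2 c] that by (simp add: s_def)
      then show ?thesis
        unfolding integral_Taylor_tail[OF \<sigma> \<beta> s] m'_def by simp
    qed
    finally show ?thesis .
  qed
  \<comment> \<open>Taylor's formula was used with \<open>s > 0\<close>. At the origin both symbols
    are continuous, so their agreement elsewhere extends to it.\<close>
  have "m 0 = m' 0"
  proof -
    have "continuous_on UNIV m"
      using W by (intro wiener_continuous[OF wiener_bdd_imp_wiener])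
    then have 1: "(m \<longlongrightarrow> m 0) (at 0)"
      by (simp add: continuous_on_def)
    have "((\<lambda>\<xi>::'a. norm \<xi> powr (2 * \<beta>)) \<longlongrightarrow> 0 powr (2 * \<beta>)) (at 0)"
      using \<beta> by (intro tendsto_powr' tendsto_norm_zero) auto
    moreover have "((\<lambda>\<xi>::'a. norm \<xi> powr (2 * \<sigma>)) \<longlongrightarrow> 0 powr (2 * \<sigma>)) (at 0)"
      using \<sigma> by (intro tendsto_powr' tendsto_norm_zero) auto
    ultimately have "(m' \<longlongrightarrow> of_real (0 powr (2 * \<beta>) * exp (- (0 powr (2 * \<sigma>))))) (at 0)"
      unfolding m'_def[abs_def] by (intro tendsto_of_real tendsto_mult tendsto_exp tendsto_minus)
    then have "(m' \<longlongrightarrow> m' 0) (at 0)"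
      by (simp add: m'_def)
    then have "(m \<longlongrightarrow> m' 0) (at 0)"
      by (rule Lim_transform_eventually) (auto simp: eventually_at_filter eq)
    with 1 show ?thesis
      by (intro tendsto_unique[OF _ 1]) (auto simp: trivial_limit_at)
  qed
  with eq have "m = m'" by (metis ext)
  with W show ?thesis unfolding m'_def[abs_def] by blast
qed


section \<open>Superpositions of heat symbols\<close>

text \<open>By scaling, |\<xi>|^c exp (- \<tau> |\<xi>|^(2\<sigma>)) is
  \<open>\<tau> powr (- c / (2 * \<sigma>))\<close> times the symbol at unit time, evaluated at
  \<xi> dilated by \<open>\<tau> powr (1 / (2 * \<sigma>))\<close>. The constant is fixed before the
  weight \<open>g\<close>, so decay rates can be read off from the two integrals.\<close>

lemma wiener_heat_superposition:
  fixes c \<sigma> :: real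
  assumes c: "c > 0" and \<sigma>: "\<sigma> > 0"
  shows "\<exists>C. \<forall>g. (\<forall>\<tau>\<le>0. g \<tau> = 0) \<and> integrable lborel (\<lambda>\<tau>. g \<tau> * \<tau> powr (- c / (2 * \<sigma>))) \<longrightarrow>
      wiener (C * (LINT \<tau>|lborel. \<bar>g \<tau> * \<tau> powr (- c / (2 * \<sigma>))\<bar>))
        (\<lambda>\<xi>::'a::euclidean_space. of_real (norm \<xi> powr c * (LINT \<tau>|lborel. g \<tau> * exp (- \<tau> * norm \<xi> powr (2 * \<sigma>))))) \<and>
      (integrable lborel (\<lambda>\<tau>. g \<tau> * \<tau> powr (- (c + DIM('a)) / (2 * \<sigma>))) \<longrightarrow>
       wiener_bdd (C * (LINT \<tau>|lborel. \<bar>g \<tau> * \<tau> powr (- c / (2 * \<sigma>))\<bar>))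
        (C * (LINT \<tau>|lborel. \<bar>g \<tau> * \<tau> powr (- (c + DIM('a)) / (2 * \<sigma>))\<bar>))
        (\<lambda>\<xi>::'a. of_real (norm \<xi> powr c * (LINT \<tau>|lborel. g \<tau> * exp (- \<tau> * norm \<xi> powr (2 * \<sigma>))))))"
proof -
  define m0 where "m0 \<xi> = complex_of_real (norm \<xi> powr c * exp (- (norm \<xi> powr (2 * \<sigma>))))" for \<xi> :: 'a
  obtain N0 B0 where NB0: "wiener_bdd N0 B0 m0"
    using wiener_bdd_powr_exp[of "c / 2" \<sigma>] c \<sigma> unfolding m0_def[abs_def] by auto
  define C where "C = max N0 B0"
  have NB: "wiener_bdd C C m0"
    using NB0 by (rule wiener_bdd_mono) (auto simp: C_def)
  define \<rho> :: "real \<Rightarrow> real" where "\<rho> \<tau> = \<tau> powr (1 / (2 * \<sigma>))" for \<tau>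
  have \<rho>m: "\<rho> \<in> borel_measurable borel" unfolding \<rho>_def[abs_def] by measurable
  show ?thesis
  proof (intro exI[of _ C] allI impI conjI; elim conjE)
    fix g :: "real \<Rightarrow> real"
    assume g0: "\<forall>\<tau>\<le>0. g \<tau> = 0" and gi: "integrable lborel (\<lambda>\<tau>. g \<tau> * \<tau> powr (- c / (2 * \<sigma>)))"
    define h where "h \<tau> = g \<tau> * \<tau> powr (- c / (2 * \<sigma>))" for \<tau>
    define m where "m = (\<lambda>\<xi>::'a. complex_of_real (norm \<xi> powr c * (LINT \<tau>|lborel. g \<tau> * exp (- \<tau> * norm \<xi> powr (2 * \<sigma>)))))"
    have \<rho>p: "\<rho> \<tau> > 0" if "h \<tau> \<noteq> 0" for \<tau>
      using that by (auto simp: h_def \<rho>_def)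
    have hi: "integrable lborel h" unfolding h_def[abs_def] by (rule gi)
    have m: "(\<lambda>\<xi>. LINT \<tau>|lborel. h \<tau> *\<^sub>R m0 (\<rho> \<tau> *\<^sub>R \<xi>)) = m"
    proof
      fix \<xi> :: 'a
      have H: "h \<tau> *\<^sub>R m0 (\<rho> \<tau> *\<^sub>R \<xi>) = of_real (norm \<xi> powr c * (g \<tau> * exp (- \<tau> * norm \<xi> powr (2 * \<sigma>))))" for \<tau>
      proof (cases "\<tau> > 0")
        case True
        have "norm (\<rho> \<tau> *\<^sub>R \<xi>) powr c = \<tau> powr (c / (2 * \<sigma>)) * norm \<xi> powr c"
          using True by (simp add: \<rho>_def powr_mult powr_powr)
        moreover have "norm (\<rho> \<tau> *\<^sub>R \<xi>) powr (2 * \<sigma>) = \<tau> * norm \<xi> powr (2 * \<sigma>)"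
          using True \<sigma> by (simp add: \<rho>_def powr_mult powr_powr)
        moreover have "\<tau> powr (- c / (2 * \<sigma>)) * \<tau> powr (c / (2 * \<sigma>)) = 1"
          using True by (simp add: powr_add[symmetric])
        ultimately show ?thesis
          by (simp add: h_def m0_def scaleR_conv_of_real mult_ac flip: of_real_mult)
      qed (simp add: h_def g0)
      show "(LINT \<tau>|lborel. h \<tau> *\<^sub>R m0 (\<rho> \<tau> *\<^sub>R \<xi>)) = m \<xi>"
        unfolding m_def H integral_complex_of_real integral_mult_right_zero ..
    qed
    have absh: "(LINT \<tau>|lborel. \<bar>h \<tau>\<bar>) * C = C * (LINT \<tau>|lborel. \<bar>g \<tau> * \<tau> powr (- c / (2 * \<sigma>))\<bar>)"
      by (simp add: h_def mult.commute)
    show "wiener (C * (LINT \<tau>|lborel. \<bar>g \<tau> * \<tau> powr (- c / (2 * \<sigma>))\<bar>)) (\<lambda>\<xi>::'a. complex_of_real (norm \<xi> powr c * (LINT \<tau>|lborel. g \<tau> * exp (- \<tau> * norm \<xi> powr (2 * \<sigma>)))))"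
      using wiener_superposition[OF wiener_bdd_imp_wiener[OF NB] hi \<rho>m \<rho>p] unfolding m absh m_def .
    assume gi2: "integrable lborel (\<lambda>\<tau>. g \<tau> * \<tau> powr (- (c + DIM('a)) / (2 * \<sigma>)))"
    have hn: "h \<tau> / \<rho> \<tau> ^ DIM('a) = g \<tau> * \<tau> powr (- (c + DIM('a)) / (2 * \<sigma>))" for \<tau>
    proof (cases "\<tau> > 0")
      case True
      then have "\<rho> \<tau> ^ DIM('a) = \<tau> powr (DIM('a) / (2 * \<sigma>))"
        by (simp add: \<rho>_def powr_realpow[symmetric] powr_powr)
      moreover have "- (c + DIM('a)) / (2 * \<sigma>) = - c / (2 * \<sigma>) - DIM('a) / (2 * \<sigma>)"
        by (simp add: diff_divide_distrib)
      ultimately show ?thesis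
        by (simp add: h_def powr_diff)
    qed (simp add: h_def g0)
    have abshn: "(LINT \<tau>|lborel. \<bar>h \<tau> / \<rho> \<tau> ^ DIM('a)\<bar>) * C = C * (LINT \<tau>|lborel. \<bar>g \<tau> * \<tau> powr (- (c + DIM('a)) / (2 * \<sigma>))\<bar>)"
      by (simp add: hn mult.commute)
    have hin: "integrable lborel (\<lambda>\<tau>. h \<tau> / \<rho> \<tau> ^ DIM('a))"
      unfolding hn by (rule gi2)
    show "wiener_bdd (C * (LINT \<tau>|lborel. \<bar>g \<tau> * \<tau> powr (- c / (2 * \<sigma>))\<bar>))
        (C * (LINT \<tau>|lborel. \<bar>g \<tau> * \<tau> powr (- (c + DIM('a)) / (2 * \<sigma>))\<bar>))
        (\<lambda>\<xi>::'a. complex_of_real (norm \<xi> powr c * (LINT \<tau>|lborel. g \<tau> * exp (- \<tau> * norm \<xi> powr (2 * \<sigma>)))))"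
      using wiener_bdd_superposition[OF NB hi \<rho>m \<rho>p hin] unfolding m absh abshn m_def .
  qed
qed

section \<open>Integrals over bounded intervals and the decomposition of powers\<close>

lemma integrable_Ioc:
  fixes f :: "real \<Rightarrow> real"
  assumes "continuous_on {l..u} f"
  shows "integrable lborel (\<lambda>\<tau>. indicator {l<..u} \<tau> * f \<tau>)"
proof -
  have "set_integrable lborel {l<..u} f"
    by (rule set_integrable_subset[OF borel_integrable_atLeastAtMost'[OF assms]]) auto
  then show ?thesis
    by (simp add: set_integrable_def)
qed

lemma integral_Ioc_FTC:
  fixes f F :: "real \<Rightarrow> real"
  assumes "l \<le> u" and F: "\<And>x. (F has_real_derivative f x) (at x)" and f: "continuous_on {l..u} f"
  shows "(LINT \<tau>|lborel. indicator {l<..u} \<tau> * f \<tau>) = F u - F l"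
proof -
  have "(LINT \<tau>|lborel. indicator {l<..u} \<tau> * f \<tau>) = (LINT \<tau>|lborel. indicator {l..u} \<tau> *\<^sub>R f \<tau>)"
  proof (rule integral_cong_AE)
    show "(\<lambda>\<tau>. indicator {l<..u} \<tau> * f \<tau>) \<in> borel_measurable lborel"
      using integrable_Ioc[OF f] by auto
    show "(\<lambda>\<tau>. indicator {l..u} \<tau> *\<^sub>R f \<tau>) \<in> borel_measurable lborel"
      using borel_integrable_atLeastAtMost'[OF f] by (auto simp: set_integrable_def)
    show "AE \<tau> in lborel. indicator {l<..u} \<tau> * f \<tau> = indicator {l..u} \<tau> *\<^sub>R f \<tau>"
      using AE_lborel_singleton[of l] by eventually_elim (auto simp: indicator_def)
  qed
  also have "\<dots> = F u - F l"
  proof (rule integral_FTC_atLeastAtMost[OF assms(1) _ f])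
    show "(F has_vector_derivative f x) (at x within {l..u})" for x
      using F[of x] by (simp add: has_real_derivative_iff_has_vector_derivative has_vector_derivative_at_within)
  qed
  finally show ?thesis .
qed

lemma integral_exp_Ioc:
  fixes R :: real
  assumes "l \<le> u"
  shows "R * (LINT \<tau>|lborel. indicator {l<..u} \<tau> * exp (- \<tau> * R)) = exp (- l * R) - exp (- u * R)"
proof -
  have "R * (LINT \<tau>|lborel. indicator {l<..u} \<tau> * exp (- \<tau> * R)) = (LINT \<tau>|lborel. indicator {l<..u} \<tau> * (R * exp (- \<tau> * R)))"
    by (simp add: mult.left_commute flip: integral_mult_right_zero)
  also have "\<dots> = - exp (- u * R) - - exp (- l * R)"
    using assms by (intro integral_Ioc_FTC) (auto intro!: derivative_eq_intros continuous_intros)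
  finally show ?thesis by simp
qed

lemma integrable_Ioc_powr:
  fixes \<gamma> :: real and f :: "real \<Rightarrow> real"
  assumes \<gamma>: "\<gamma> > -1" and f: "continuous_on {0..u} f" 
  shows "integrable lborel (\<lambda>\<tau>. indicator {0<..u} \<tau> * f \<tau> * \<tau> powr \<gamma>)"
proof (cases "u \<ge> 0")
  case True
  obtain B where "\<forall>y\<in>f ` {0..u}. norm y \<le> B"
    using compact_imp_bounded[OF compact_continuous_image[OF f compact_Icc]] unfolding bounded_iff by blast
  then have B: "\<bar>f x\<bar> \<le> B" if "x \<in> {0..u}" for x
    using that by auto
  have "(\<lambda>x. x powr \<gamma>) integrable_on {0..u}"
    using \<gamma> True by (intro integrable_on_powr_from_0) auto
  then have "set_integrable lebesgue {0..u} (\<lambda>x. x powr \<gamma>)"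
    by (intro nonnegative_absolutely_integrable_1) auto
  then have 1: "integrable lborel (\<lambda>x. B * (indicat_real {0..u} x * x powr \<gamma>))"
    unfolding set_integrable_def by (subst (asm) integrable_completion) auto
  show ?thesis
  proof (rule Bochner_Integration.integrable_bound[OF 1])
    have "(\<lambda>\<tau>. indicator {0<..u} \<tau> * f \<tau>) \<in> borel_measurable lborel"
      using integrable_Ioc[OF f] by auto
    then show "(\<lambda>\<tau>. indicator {0<..u} \<tau> * f \<tau> * \<tau> powr \<gamma>) \<in> borel_measurable lborel"
      by measurable
    have "norm (indicator {0<..u} \<tau> * f \<tau> * \<tau> powr \<gamma>) \<le> norm (B * (indicat_real {0..u} \<tau> * \<tau> powr \<gamma>))" for \<tau>
    proof (cases "\<tau> \<in> {0<..u}")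
      case True
      then have "\<bar>f \<tau>\<bar> \<le> \<bar>B\<bar>" using B[of \<tau>] by auto
      then show ?thesis using True by (auto simp: abs_mult intro!: mult_right_mono)
    qed simp
    then show "AE \<tau> in lborel. norm (indicator {0<..u} \<tau> * f \<tau> * \<tau> powr \<gamma>) \<le> norm (B * (indicat_real {0..u} \<tau> * \<tau> powr \<gamma>))"
      by simp
  qed
qed simp

text \<open>With \<open>R = |\<xi>| powr (2 * k - a + 2)\<close> one has
  \<open>|\<xi>| powr a = |\<xi>| powr a * exp (- R) + |\<xi>| powr (2 * k) * (|\<xi>| powr 2 * (1 - exp (- R)) / R)\<close>.\<close>

lemma norm_powr_decomposition:
  fixes a :: real
  assumes a: "a > 0"
  shows "\<exists>k N N' m m'. wiener N m \<and> wiener N' m' \<and>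
    (\<forall>\<xi>::'a::euclidean_space. of_real (norm \<xi> powr a) = m \<xi> + of_real (norm \<xi> ^ (2 * k)) * m' \<xi>)"
proof -
  \<comment> \<open>Any \<open>k > a / 2\<close> makes \<kappa> exceed 1, and then
    \<open>\<tau> powr (- 2 / (2 * \<kappa>))\<close> is integrable at 0.\<close>
  define k where "k = Suc (nat \<lceil>a / 2\<rceil>)"
  define \<kappa> where "\<kappa> = real k - a / 2 + 1"
  have \<kappa>: "\<kappa> > 1" unfolding \<kappa>_def k_def by linarith
  define m where "m \<xi> = complex_of_real (norm \<xi> powr a * exp (- (norm \<xi> powr (2 * \<kappa>))))" for \<xi> :: 'a
  obtain N B where m: "wiener_bdd N B m"
    using wiener_bdd_powr_exp[of "a / 2" \<kappa>] a \<kappa> unfolding m_def[abs_def] by auto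
  \<comment> \<open>This weight represents (1 - exp (- R)) / R as the integral of exp (- \<tau> R)
    over 0 < \<tau> \<le> 1.\<close>
  define g where "g \<tau> = indicat_real {0<..1} \<tau>" for \<tau> :: real
  define m' where "m' \<xi> = complex_of_real (norm \<xi> powr 2 * (LINT \<tau>|lborel. g \<tau> * exp (- \<tau> * norm \<xi> powr (2 * \<kappa>))))" for \<xi> :: 'a
  have "- 1 < - 2 / (2 * \<kappa>)"
    using \<kappa> by (simp add: field_simps)
  from integrable_Ioc_powr[OF this, of 1 "\<lambda>_. 1"]
  have gi: "integrable lborel (\<lambda>\<tau>. g \<tau> * \<tau> powr (- 2 / (2 * \<kappa>)))"
    unfolding g_def mult_1_right by simp
  have g0: "\<forall>\<tau>\<le>0. g \<tau> = 0" by (simp add: g_def)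
  have "(0::real) < 2" "0 < \<kappa>" using \<kappa> by auto
  from wiener_heat_superposition[OF this, where 'a='a]
  obtain C where "\<forall>g. (\<forall>\<tau>\<le>0. g \<tau> = 0) \<and> integrable lborel (\<lambda>\<tau>. g \<tau> * \<tau> powr (- 2 / (2 * \<kappa>))) \<longrightarrow>
      wiener (C * (LINT \<tau>|lborel. \<bar>g \<tau> * \<tau> powr (- 2 / (2 * \<kappa>))\<bar>))
        (\<lambda>\<xi>::'a. of_real (norm \<xi> powr 2 * (LINT \<tau>|lborel. g \<tau> * exp (- \<tau> * norm \<xi> powr (2 * \<kappa>)))))"
    by blast
  from this[rule_format, OF conjI[OF g0 gi]] obtain N' where m': "wiener N' m'"
    unfolding m'_def[abs_def] by blast
  have "of_real (norm \<xi> powr a) = m \<xi> + of_real (norm \<xi> ^ (2 * k)) * m' \<xi>" for \<xi> :: 'a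
  proof (cases "\<xi> = 0")
    case False
    define R where "R = norm \<xi> powr (2 * \<kappa>)"
    have R: "R > 0" using False by (simp add: R_def)
    have "norm \<xi> powr real (2 * k) = norm \<xi> ^ (2 * k)"
      using False by (subst powr_realpow) auto
    then have "norm \<xi> ^ (2 * k) * norm \<xi> powr 2 = norm \<xi> powr (real (2 * k) + 2)"
      unfolding powr_add by (rule arg_cong[OF sym])
    also have "real (2 * k) + 2 = a + 2 * \<kappa>"
      by (simp add: \<kappa>_def)
    finally have e: "norm \<xi> ^ (2 * k) * norm \<xi> powr 2 = norm \<xi> powr a * R"
      unfolding R_def powr_add .
    have "norm \<xi> ^ (2 * k) * (norm \<xi> powr 2 * (LINT \<tau>|lborel. g \<tau> * exp (- \<tau> * R))) =
        norm \<xi> powr a * (R * (LINT \<tau>|lborel. g \<tau> * exp (- \<tau> * R)))"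
      unfolding mult.assoc[symmetric] e ..
    also have "\<dots> = norm \<xi> powr a * (1 - exp (- R))"
      using integral_exp_Ioc[of 0 1 R] by (simp add: g_def)
    finally have "norm \<xi> powr a * exp (- R) + norm \<xi> ^ (2 * k) * (norm \<xi> powr 2 * (LINT \<tau>|lborel. g \<tau> * exp (- \<tau> * R))) = norm \<xi> powr a"
      by (simp add: algebra_simps)
    then have "norm \<xi> powr a = norm \<xi> powr a * exp (- R) + norm \<xi> ^ (2 * k) * (norm \<xi> powr 2 * (LINT \<tau>|lborel. g \<tau> * exp (- \<tau> * R)))" ..
    then show ?thesis
      unfolding m_def m'_def R_def[symmetric] by (metis of_real_add of_real_mult)
  qed (simp add: m_def m'_def)
  with wiener_bdd_imp_wiener[OF m] m' show ?thesis by blast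
qed

text \<open>The symbol of \<open>abs_D a\<close> as a real-valued function.\<close>

definition pw :: "real \<Rightarrow> 'a::euclidean_space \<Rightarrow> real" where
  "pw a \<xi> = (if a = 0 then 1 else norm \<xi> powr a)"

lemma pw_mult: "a \<ge> 0 \<Longrightarrow> b \<ge> 0 \<Longrightarrow> pw a \<xi> * pw b \<xi> = pw (a + b) \<xi>"
  by (auto simp: pw_def powr_add)

lemma pw_pos: "a > 0 \<Longrightarrow> pw a \<xi> = norm \<xi> powr a"
  by (simp add: pw_def)

text \<open>The power is neither smooth at the origin nor bounded. Its decomposition leaves only a
  polynomial as unbounded factor, and the cut-off absorbs that one smoothly.\<close>

lemma cutoff_pw_wiener:
  fixes chi :: "'a::euclidean_space \<Rightarrow> real"
  assumes chi: "radial_cutoff chi" and a: "a \<ge> 0"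
  shows "\<exists>N B. wiener_bdd N B (\<lambda>\<xi>. of_real (chi \<xi> * pw a \<xi>))"
proof (cases "a = 0")
  case True
  then show ?thesis using rapid_wiener_bdd[OF cutoff_rapid[OF chi]] by (simp add: pw_def)
next
  case False
  then have "a > 0" using a by simp
  then obtain k N N' m m' where m: "wiener N m" "wiener N' m'"
    and eq: "\<And>\<xi>::'a. of_real (norm \<xi> powr a) = m \<xi> + of_real (norm \<xi> ^ (2 * k)) * m' \<xi>"
    using norm_powr_decomposition[of a, where 'a='a] by blast
  obtain N1 B1 where 1: "wiener_bdd N1 B1 (\<lambda>x. complex_of_real (chi x))"
    using rapid_wiener_bdd[OF cutoff_rapid[OF chi]] by blast
  obtain N2 B2 where 2: "wiener_bdd N2 B2 (\<lambda>x. of_real (norm x ^ (2 * k)) * complex_of_real (chi x))"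
    using rapid_wiener_bdd[OF rapid_norm_power[OF cutoff_rapid[OF chi]]] by blast
  note w = wiener_bdd_add[OF wiener_bdd_mult[OF m(1) 1] wiener_bdd_mult[OF m(2) 2]]
  have "(\<lambda>\<xi>. m \<xi> * of_real (chi \<xi>) + m' \<xi> * (of_real (norm \<xi> ^ (2 * k)) * of_real (chi \<xi>))) =
      (\<lambda>\<xi>. of_real (chi \<xi> * pw a \<xi>))"
  proof
    fix \<xi> :: 'a
    have "complex_of_real (chi \<xi> * pw a \<xi>) = of_real (chi \<xi>) * (m \<xi> + of_real (norm \<xi> ^ (2 * k)) * m' \<xi>)"
      using False eq[of \<xi>] by (simp add: pw_def)
    then show "m \<xi> * of_real (chi \<xi>) + m' \<xi> * (of_real (norm \<xi> ^ (2 * k)) * of_real (chi \<xi>)) = of_real (chi \<xi> * pw a \<xi>)"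
      by (simp add: algebra_simps)
  qed
  with w show ?thesis by metis
qed

section \<open>Exponentials against powers, and the symbols in terms of \<open>zfun\<close>\<close>

lemma powr_le_exp_half:
  "\<exists>C>0. \<forall>x\<ge>0. (1 + x) powr \<gamma> \<le> C * exp (x / 2)" for \<gamma> :: real
proof (cases "\<gamma> > 0")
  case True
  define C where "C = exp (1 / 2 + \<gamma> * ln (2 * \<gamma>))"
  have "(1 + x) powr \<gamma> \<le> C * exp (x / 2)" if x: "x \<ge> 0" for x
  proof -
    \<comment> \<open>The inequality ln y \<le> y at y = (1 + x) / (2 \<gamma>) produces exactly the
      slope 1/2.\<close>
    have "ln ((1 + x) / (2 * \<gamma>)) \<le> (1 + x) / (2 * \<gamma>)"
      using ln_bound[of "(1 + x) / (2 * \<gamma>)"] x True by simp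
    then have "ln (1 + x) \<le> (1 + x) / (2 * \<gamma>) + ln (2 * \<gamma>)"
      using x True by (simp add: ln_div)
    then have "\<gamma> * ln (1 + x) \<le> \<gamma> * ((1 + x) / (2 * \<gamma>) + ln (2 * \<gamma>))"
      using True by (intro mult_left_mono) auto
    also have "\<dots> = 1 / 2 + \<gamma> * ln (2 * \<gamma>) + x / 2"
      using True by (simp add: field_simps)
    finally show ?thesis
      using x by (simp add: powr_def C_def mult_exp_exp)
  qed
  then show ?thesis by (intro exI[of _ C]) (auto simp: C_def)
next
  case False
  have "(1 + x) powr \<gamma> \<le> 1 * exp (x / 2)" if x: "x \<ge> 0" for x
  proof -
    have "(1 + x) powr \<gamma> \<le> (1 + x) powr 0" using x False by (intro powr_mono) auto
    also have "\<dots> \<le> 1 * exp (x / 2)" using x by simp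
    finally show ?thesis .
  qed
  then show ?thesis by (intro exI[of _ 1]) auto
qed

lemma exp_le_powr: "\<exists>C>0. \<forall>s\<ge>0. exp (- s) \<le> C * (1 + s) powr - \<gamma>" for \<gamma> :: real
proof -
  obtain C where C: "C > 0" "\<And>x. x \<ge> 0 \<Longrightarrow> (1 + x) powr \<gamma> \<le> C * exp (x / 2)"
    using powr_le_exp_half by blast
  have "exp (- s) \<le> C * (1 + s) powr - \<gamma>" if s: "s \<ge> 0" for s
  proof -
    have "exp (- s) * (1 + s) powr \<gamma> \<le> exp (- s) * (C * exp (s / 2))"
      using C(2)[OF s] by (intro mult_left_mono) auto
    also have "\<dots> = C * exp (- s / 2)"
      by (simp add: mult.left_commute mult_exp_exp)
    also have "\<dots> \<le> C" using C s by simp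
    finally show ?thesis using s by (simp add: powr_minus field_simps)
  qed
  with C show ?thesis by blast
qed

text \<open>The exponential concentrates the integral near \<tau> = s, where the power has the
  claimed size. Farther away the loss is a power of 1 + s - \<tau>, paid for by half of the
  exponential.\<close>

lemma integral_exp_powr_le:
  fixes \<gamma> :: real
  assumes \<gamma>: "\<gamma> \<ge> 0"
  shows "\<exists>C. \<forall>s\<ge>1. (LINT \<tau>|lborel. \<bar>indicator {1<..s} \<tau> * exp \<tau> * \<tau> powr - \<gamma>\<bar>) \<le> C * (exp s * (1 + s) powr - \<gamma>)"
proof -
  obtain C where C: "C > 0" "\<And>x. x \<ge> 0 \<Longrightarrow> (1 + x) powr \<gamma> \<le> C * exp (x / 2)"
    using powr_le_exp_half by blast
  have pt: "\<tau> powr - \<gamma> \<le> 2 powr \<gamma> * C * ((1 + s) powr - \<gamma> * exp ((s - \<tau>) / 2))" if \<tau>: "1 \<le> \<tau>" "\<tau> \<le> s" for \<tau> s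
  proof -
    \<comment> \<open>The right-hand side is the difference of the two sides of 1 + s \<le> 2 \<tau>
      (1 + (s - \<tau>)), the inequality that trades \<tau> for \<open>s\<close>.\<close>
    have "0 \<le> (\<tau> - 1) + (s - \<tau>) * (2 * \<tau> - 1)"
      using \<tau> by (intro add_nonneg_nonneg mult_nonneg_nonneg) auto
    then have "1 + s \<le> 2 * \<tau> * (1 + (s - \<tau>))"
      by (simp add: algebra_simps)
    then have "(1 + s) powr \<gamma> \<le> (2 * \<tau> * (1 + (s - \<tau>))) powr \<gamma>"
      using \<tau> \<gamma> by (intro powr_mono2) auto
    also have "\<dots> = 2 powr \<gamma> * \<tau> powr \<gamma> * (1 + (s - \<tau>)) powr \<gamma>"
      using \<tau> by (simp add: powr_mult)
    also have "\<dots> \<le> 2 powr \<gamma> * \<tau> powr \<gamma> * (C * exp ((s - \<tau>) / 2))"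
      using C(2)[of "s - \<tau>"] \<tau> by (intro mult_left_mono) auto
    finally show ?thesis
      using \<tau> by (simp add: powr_minus field_simps)
  qed
  have "(LINT \<tau>|lborel. \<bar>indicator {1<..s} \<tau> * exp \<tau> * \<tau> powr - \<gamma>\<bar>) \<le> (2 powr \<gamma> * C * 2) * (exp s * (1 + s) powr - \<gamma>)" if s: "s \<ge> 1" for s
  proof -
    define D where "D = 2 powr \<gamma> * C * (1 + s) powr - \<gamma> * exp (s / 2)"
    have D: "D \<ge> 0" using C by (simp add: D_def)
    have "(LINT \<tau>|lborel. \<bar>indicator {1<..s} \<tau> * exp \<tau> * \<tau> powr - \<gamma>\<bar>) \<le> (LINT \<tau>|lborel. indicator {1<..s} \<tau> * (D * exp (\<tau> / 2)))"
    proof (rule integral_mono')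
      show "integrable lborel (\<lambda>\<tau>. indicator {1<..s} \<tau> * (D * exp (\<tau> / 2)))"
        by (intro integrable_Ioc continuous_intros) auto
      fix \<tau>
      show "0 \<le> indicator {1<..s} \<tau> * (D * exp (\<tau> / 2))" using D by simp
      show "\<bar>indicator {1<..s} \<tau> * exp \<tau> * \<tau> powr - \<gamma>\<bar> \<le> indicator {1<..s} \<tau> * (D * exp (\<tau> / 2))"
      proof (cases "\<tau> \<in> {1<..s}")
        case True
        have "exp \<tau> * \<tau> powr - \<gamma> \<le> exp \<tau> * (2 powr \<gamma> * C * ((1 + s) powr - \<gamma> * exp ((s - \<tau>) / 2)))"
          using pt[of \<tau> s] True by (intro mult_left_mono) auto
        also have "\<dots> = 2 powr \<gamma> * C * (1 + s) powr - \<gamma> * (exp \<tau> * exp ((s - \<tau>) / 2))"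
          by (simp add: mult_ac)
        also have "exp \<tau> * exp ((s - \<tau>) / 2) = exp (s / 2) * exp (\<tau> / 2)"
          unfolding mult_exp_exp by (simp add: field_simps)
        finally show ?thesis using True by (simp add: D_def mult_ac)
      qed simp
    qed
    also have "\<dots> = 2 * D * exp (s / 2) - 2 * D * exp (1 / 2)"
      using s by (intro integral_Ioc_FTC) (auto intro!: derivative_eq_intros continuous_intros)
    also have "\<dots> \<le> 2 * D * exp (s / 2)" using D by simp
    also have "\<dots> = (2 powr \<gamma> * C * 2) * ((exp (s / 2) * exp (s / 2)) * (1 + s) powr - \<gamma>)"
      by (simp add: D_def mult_ac)
    also have "exp (s / 2) * exp (s / 2) = exp s"
      by (simp add: mult_exp_exp)
    finally show ?thesis .
  qed
  then show ?thesis by blast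
qed

text \<open>\<open>zfun s r\<close> is the integral of \<open>exp (\<tau> * (1 - r))\<close> over \<open>0 < \<tau> < s\<close>.\<close>

definition efun :: "real \<Rightarrow> real \<Rightarrow> real" where
  "efun r \<tau> = (if r = 1 then \<tau> else exp (\<tau> * (1 - r)) / (1 - r))"

definition zfun :: "real \<Rightarrow> real \<Rightarrow> real" where
  "zfun s r = efun r s - efun r 0"

lemma DERIV_efun: "(efun r has_real_derivative exp (\<tau> * (1 - r))) (at \<tau>)"
  unfolding efun_def[abs_def] by (cases "r = 1") (auto intro!: derivative_eq_intros)

lemma zfun_diff: "l \<le> u \<Longrightarrow> zfun u r - zfun l r = (LINT \<tau>|lborel. indicator {l<..u} \<tau> * exp (\<tau> * (1 - r)))"
  by (subst integral_Ioc_FTC[where F="efun r"]) (auto intro!: DERIV_efun continuous_intros simp: zfun_def)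

lemma zfun_mult: "(1 - r) * zfun s r = exp (s * (1 - r)) - 1"
  by (auto simp: zfun_def efun_def diff_divide_distrib[symmetric])

lemma zfun_0 [simp]: "zfun 0 r = 0"
  by (simp add: zfun_def)

text \<open>Taylor's formula of first order in \<open>s\<close> with integral remainder: the second
  derivative of \<open>zfun\<close> in \<open>s\<close> is
  \<open>(1 - r) * exp (s * (1 - r))\<close>. Minimum, maximum and absolute value let a negative
  step share the formula.\<close>

lemma zfun_remainder:
  "zfun (s + h) r - zfun s r - h * exp (s * (1 - r)) =
    (1 - r) * (LINT \<tau>|lborel. indicator {min s (s + h)<..max s (s + h)} \<tau> * (\<bar>s + h - \<tau>\<bar> * exp (\<tau> * (1 - r))))"
proof -
  have F: "((\<lambda>\<tau>. (s + h - \<tau>) * exp (\<tau> * (1 - r)) + efun r \<tau>) has_real_derivative (1 - r) * ((s + h - \<tau>) * exp (\<tau> * (1 - r)))) (at \<tau>)" for \<tau>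
    by (auto intro!: derivative_eq_intros DERIV_efun simp: algebra_simps)
  show ?thesis
  proof (cases "h \<ge> 0")
    case True
    have "(1 - r) * (LINT \<tau>|lborel. indicator {min s (s + h)<..max s (s + h)} \<tau> * (\<bar>s + h - \<tau>\<bar> * exp (\<tau> * (1 - r)))) =
       (LINT \<tau>|lborel. indicator {s<..s + h} \<tau> * ((1 - r) * ((s + h - \<tau>) * exp (\<tau> * (1 - r)))))"
      unfolding integral_mult_right_zero[symmetric] using True
      by (intro Bochner_Integration.integral_cong) (auto simp: indicator_def)
    also have "\<dots> = ((s + h - (s + h)) * exp ((s + h) * (1 - r)) + efun r (s + h)) - ((s + h - s) * exp (s * (1 - r)) + efun r s)"
      using True by (intro integral_Ioc_FTC F) (auto intro!: continuous_intros)
    finally show ?thesis by (simp add: zfun_def)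
  next
    case False
    have "(1 - r) * (LINT \<tau>|lborel. indicator {min s (s + h)<..max s (s + h)} \<tau> * (\<bar>s + h - \<tau>\<bar> * exp (\<tau> * (1 - r)))) =
       (LINT \<tau>|lborel. indicator {s + h<..s} \<tau> * (- ((1 - r) * ((s + h - \<tau>) * exp (\<tau> * (1 - r))))))"
      unfolding integral_mult_right_zero[symmetric] using False
      by (intro Bochner_Integration.integral_cong) (auto simp: indicator_def algebra_simps)
    also have "\<dots> = - ((s + h - s) * exp (s * (1 - r)) + efun r s) - - ((s + h - (s + h)) * exp ((s + h) * (1 - r)) + efun r (s + h))"
      using False by (intro integral_Ioc_FTC DERIV_minus F) (auto intro!: continuous_intros)
    finally show ?thesis by (simp add: zfun_def)
  qed
qed

text \<open>\<open>exp (- t) * zfun t r\<close> is the integral w(t) of the overview. Away from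
  \<open>r = 1\<close> the two sides are compared after multiplication by
  \<open>1 - r\<close>.\<close>

lemma symb0_eq: "symb0 \<sigma> t \<xi> = exp (- t * norm \<xi> powr (2 * \<sigma>)) +
    exp (- t) * (norm \<xi> powr (2 * \<sigma>) * zfun t (norm \<xi> powr (2 * \<sigma>)))"
proof -
  define r where "r = norm \<xi> powr (2 * \<sigma>)"
  show ?thesis
  proof (cases "r = 1")
    case True
    then show ?thesis unfolding symb0_def r_def[symmetric] by (simp add: zfun_def efun_def algebra_simps)
  next
    case False
    have e: "exp (- t) * exp (t * (1 - r)) = exp (- t * r)"
      by (simp add: mult_exp_exp algebra_simps)
    have "(1 - r) * (exp (- t * r) + exp (- t) * (r * zfun t r)) =
        (1 - r) * exp (- t * r) + r * exp (- t) * ((1 - r) * zfun t r)"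
      by (simp add: algebra_simps)
    also have "\<dots> = (1 - r) * exp (- t * r) + (r * (exp (- t) * exp (t * (1 - r))) - r * exp (- t))"
      unfolding zfun_mult by (simp add: right_diff_distrib mult.assoc)
    also have "\<dots> = exp (- t * r) - r * exp (- t)"
      unfolding e by (simp add: algebra_simps)
    finally have "exp (- t * r) + exp (- t) * (r * zfun t r) = (exp (- t * r) - r * exp (- t)) / (1 - r)"
      using False by (subst eq_divide_eq) (simp add: mult.commute)
    then show ?thesis
      using False unfolding symb0_def r_def[symmetric] by (simp add: Let_def)
  qed
qed

lemma symb1_eq: "symb1 \<sigma> t \<xi> = symb0 \<sigma> t \<xi> - exp (- t)"
proof -
  have "(A - e) / (1 - r) = (A - r * e) / (1 - r) - e" if "r \<noteq> 1" for A e r :: real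
    using that by (simp add: field_simps)
  then show ?thesis
    unfolding symb0_def symb1_def Let_def by (simp add: algebra_simps)
qed


section \<open>Decay of the kernels\<close>

text \<open>Staying away from \<tau> = 0 makes both weights integrable, whatever their exponents;
  \<open>C\<close> serves all intervals and all \<open>f\<close>.\<close>

lemma wiener_heat_bdd_Ioc:
  fixes c \<sigma> :: real
  assumes c: "c > 0" and \<sigma>: "\<sigma> > 0"
  shows "\<exists>C\<ge>0. \<forall>l u f. 0 < l \<and> continuous_on {l..u} f \<longrightarrow>
      wiener_bdd (C * (LINT \<tau>|lborel. \<bar>indicator {l<..u} \<tau> * f \<tau> * \<tau> powr - (c / (2 * \<sigma>))\<bar>))
        (C * (LINT \<tau>|lborel. \<bar>indicator {l<..u} \<tau> * f \<tau> * \<tau> powr - ((c + DIM('a)) / (2 * \<sigma>))\<bar>))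
        (\<lambda>\<xi>::'a::euclidean_space. of_real (norm \<xi> powr c * (LINT \<tau>|lborel. indicator {l<..u} \<tau> * f \<tau> * exp (- \<tau> * norm \<xi> powr (2 * \<sigma>)))))"
proof -
  obtain C where C: "\<forall>g. (\<forall>\<tau>\<le>0. g \<tau> = 0) \<and> integrable lborel (\<lambda>\<tau>. g \<tau> * \<tau> powr (- c / (2 * \<sigma>))) \<longrightarrow>
      wiener (C * (LINT \<tau>|lborel. \<bar>g \<tau> * \<tau> powr (- c / (2 * \<sigma>))\<bar>))
        (\<lambda>\<xi>::'a::euclidean_space. of_real (norm \<xi> powr c * (LINT \<tau>|lborel. g \<tau> * exp (- \<tau> * norm \<xi> powr (2 * \<sigma>))))) \<and>
      (integrable lborel (\<lambda>\<tau>. g \<tau> * \<tau> powr (- (c + DIM('a)) / (2 * \<sigma>))) \<longrightarrow>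
       wiener_bdd (C * (LINT \<tau>|lborel. \<bar>g \<tau> * \<tau> powr (- c / (2 * \<sigma>))\<bar>))
        (C * (LINT \<tau>|lborel. \<bar>g \<tau> * \<tau> powr (- (c + DIM('a)) / (2 * \<sigma>))\<bar>))
        (\<lambda>\<xi>::'a. of_real (norm \<xi> powr c * (LINT \<tau>|lborel. g \<tau> * exp (- \<tau> * norm \<xi> powr (2 * \<sigma>))))))"
    using wiener_heat_superposition[OF c \<sigma>, where 'a='a] by blast
  show ?thesis
  proof (intro exI[of _ "\<bar>C\<bar>"] conjI allI impI; (elim conjE)?)
    fix l u :: real and f :: "real \<Rightarrow> real"
    assume l: "0 < l" and f: "continuous_on {l..u} f"
    have i: "integrable lborel (\<lambda>\<tau>. indicator {l<..u} \<tau> * f \<tau> * \<tau> powr e)" for e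
    proof -
      have "integrable lborel (\<lambda>\<tau>. indicator {l<..u} \<tau> * (f \<tau> * \<tau> powr e))"
        using l f by (intro integrable_Ioc continuous_intros) auto
      then show ?thesis by (simp add: mult.assoc)
    qed
    have z: "\<forall>\<tau>\<le>0. indicator {l<..u} \<tau> * f \<tau> = 0"
      using l by auto
    have "wiener_bdd (C * (LINT \<tau>|lborel. \<bar>indicator {l<..u} \<tau> * f \<tau> * \<tau> powr (- c / (2 * \<sigma>))\<bar>))
        (C * (LINT \<tau>|lborel. \<bar>indicator {l<..u} \<tau> * f \<tau> * \<tau> powr (- (c + DIM('a)) / (2 * \<sigma>))\<bar>))
        (\<lambda>\<xi>::'a::euclidean_space. of_real (norm \<xi> powr c * (LINT \<tau>|lborel. indicator {l<..u} \<tau> * f \<tau> * exp (- \<tau> * norm \<xi> powr (2 * \<sigma>)))))"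
      using C[rule_format, OF conjI[OF z i]] i by blast
    then show "wiener_bdd (\<bar>C\<bar> * (LINT \<tau>|lborel. \<bar>indicator {l<..u} \<tau> * f \<tau> * \<tau> powr - (c / (2 * \<sigma>))\<bar>))
        (\<bar>C\<bar> * (LINT \<tau>|lborel. \<bar>indicator {l<..u} \<tau> * f \<tau> * \<tau> powr - ((c + DIM('a)) / (2 * \<sigma>))\<bar>))
        (\<lambda>\<xi>::'a::euclidean_space. of_real (norm \<xi> powr c * (LINT \<tau>|lborel. indicator {l<..u} \<tau> * f \<tau> * exp (- \<tau> * norm \<xi> powr (2 * \<sigma>)))))"
      unfolding minus_divide_left[symmetric]
      by (rule wiener_bdd_mono) (auto intro!: mult_right_mono)
  qed simp
qed

text \<open>The power \<sigma> costs \<tau>^(-1/2), integrable down to 0, whereas 2\<sigma> would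
  cost \<tau>^(-1). This is why |\<xi>|^(2\<sigma>) is split into two halves by
  \<open>pw_two_mult\<close>.\<close>

lemma wiener_heat_Ioc:
  fixes \<sigma> :: real
  assumes \<sigma>: "\<sigma> > 0" and f: "continuous_on {0..u} f"
  shows "\<exists>N. wiener N (\<lambda>\<xi>::'a::euclidean_space. of_real (pw \<sigma> \<xi> * (LINT \<tau>|lborel. indicator {0<..u} \<tau> * f \<tau> * exp (- \<tau> * norm \<xi> powr (2 * \<sigma>)))))"
proof -
  have z: "\<forall>\<tau>\<le>0. indicator {0<..u} \<tau> * f \<tau> = 0"
    by auto
  have e: "- \<sigma> / (2 * \<sigma>) = - 1 / 2" using \<sigma> by simp
  have i: "integrable lborel (\<lambda>\<tau>. indicator {0<..u} \<tau> * f \<tau> * \<tau> powr (- \<sigma> / (2 * \<sigma>)))"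
    unfolding e by (rule integrable_Ioc_powr[OF _ f]) simp
  obtain C where "\<forall>g. (\<forall>\<tau>\<le>0. g \<tau> = 0) \<and> integrable lborel (\<lambda>\<tau>. g \<tau> * \<tau> powr (- \<sigma> / (2 * \<sigma>))) \<longrightarrow>
      wiener (C * (LINT \<tau>|lborel. \<bar>g \<tau> * \<tau> powr (- \<sigma> / (2 * \<sigma>))\<bar>))
        (\<lambda>\<xi>::'a::euclidean_space. of_real (norm \<xi> powr \<sigma> * (LINT \<tau>|lborel. g \<tau> * exp (- \<tau> * norm \<xi> powr (2 * \<sigma>)))))"
    using wiener_heat_superposition[OF \<sigma> \<sigma>, where 'a='a] by blast
  from this[rule_format, OF conjI[OF z i]] show ?thesis
    unfolding pw_pos[OF \<sigma>] by blast
qed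

lemma pw_two_mult: "\<sigma> > 0 \<Longrightarrow> norm \<xi> powr (2 * \<sigma>) = pw \<sigma> \<xi> * pw \<sigma> \<xi>"
  by (simp add: pw_def powr_add[symmetric])

text \<open>For \<open>a = 0\<close> this lies outside \<open>wiener_bdd_powr_exp\<close>. With R =
  |\<xi>|^(2\<sigma>), the exponential is 1 minus R times the integral of exp (- \<tau> R) over 0 <
  \<tau> \<le> s; one half of R joins the cut-off, the other half the integral.\<close>

lemma wiener_cutoff_exp:
  fixes chi :: "'a::euclidean_space \<Rightarrow> real"
  assumes chi: "radial_cutoff chi" and a: "a \<ge> 0" and \<sigma>: "\<sigma> > 0" and s: "s \<ge> 0"
  shows "\<exists>N. wiener N (\<lambda>\<xi>. of_real (chi \<xi> * pw a \<xi> * exp (- s * norm \<xi> powr (2 * \<sigma>))))"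
proof -
  obtain N B where 1: "wiener_bdd N B (\<lambda>\<xi>. complex_of_real (chi \<xi> * pw a \<xi>))"
    using cutoff_pw_wiener[OF chi a] by blast
  obtain N' B' where 2: "wiener_bdd N' B' (\<lambda>\<xi>. complex_of_real (chi \<xi> * pw (a + \<sigma>) \<xi>))"
    using cutoff_pw_wiener[OF chi, of "a + \<sigma>"] a \<sigma> by auto
  obtain N'' where 3: "wiener N'' (\<lambda>\<xi>::'a. complex_of_real (pw \<sigma> \<xi> * (LINT \<tau>|lborel. indicator {0<..s} \<tau> * 1 * exp (- \<tau> * norm \<xi> powr (2 * \<sigma>)))))"
    using wiener_heat_Ioc[OF \<sigma>, of s "\<lambda>_. 1"] by auto
  have eq: "of_real (chi \<xi> * pw a \<xi>) + (-1) * (of_real (chi \<xi> * pw (a + \<sigma>) \<xi>) *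
      of_real (pw \<sigma> \<xi> * (LINT \<tau>|lborel. indicator {0<..s} \<tau> * 1 * exp (- \<tau> * norm \<xi> powr (2 * \<sigma>))))) =
      complex_of_real (chi \<xi> * pw a \<xi> * exp (- s * norm \<xi> powr (2 * \<sigma>)))" for \<xi>
  proof -
    define I where "I = (LINT \<tau>|lborel. indicator {0<..s} \<tau> * 1 * exp (- \<tau> * norm \<xi> powr (2 * \<sigma>)))"
    have "pw \<sigma> \<xi> * pw \<sigma> \<xi> * I = 1 - exp (- s * norm \<xi> powr (2 * \<sigma>))"
      unfolding pw_two_mult[OF \<sigma>, symmetric] I_def using integral_exp_Ioc[OF s, of "norm \<xi> powr (2 * \<sigma>)"] by simp
    then have "chi \<xi> * pw a \<xi> * exp (- s * norm \<xi> powr (2 * \<sigma>)) = chi \<xi> * pw a \<xi> * (1 - pw \<sigma> \<xi> * pw \<sigma> \<xi> * I)"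
      by simp
    also have "\<dots> = chi \<xi> * pw a \<xi> + (-1) * (chi \<xi> * pw (a + \<sigma>) \<xi> * (pw \<sigma> \<xi> * I))"
      using a \<sigma> by (simp add: pw_mult[symmetric] algebra_simps)
    finally show ?thesis
      unfolding I_def by (simp only: of_real_add of_real_mult of_real_minus of_real_1)
  qed
  from wiener_add[OF wiener_bdd_imp_wiener[OF 1] wiener_cmult[OF wiener_mult[OF wiener_bdd_imp_wiener[OF 2] 3], of "-1"]]
  show ?thesis
    unfolding eq by blast
qed

text \<open>The exponential dominates every power; \<gamma> and \<delta> are left free so that they
  can be matched with the rates of the heat part.\<close>

lemma wiener_bdd_cutoff_exp_decay:
  fixes chi :: "'a::euclidean_space \<Rightarrow> real"
  assumes chi: "radial_cutoff chi" and a: "a \<ge> 0"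
  shows "\<exists>C. \<forall>s\<ge>1. wiener_bdd (C * (1 + s) powr - \<gamma>) (C * (1 + s) powr - \<delta>) (\<lambda>\<xi>. of_real (exp (- s) * (chi \<xi> * pw a \<xi>)))"
proof -
  obtain N B where 1: "wiener_bdd N B (\<lambda>\<xi>. complex_of_real (chi \<xi> * pw a \<xi>))"
    using cutoff_pw_wiener[OF chi a] by blast
  have NB: "N \<ge> 0" "B \<ge> 0" using wiener_bdd_nonneg[OF 1] by auto
  obtain C1 where C1: "C1 > 0" "\<And>s. s \<ge> 0 \<Longrightarrow> exp (- s) \<le> C1 * (1 + s) powr - \<gamma>"
    using exp_le_powr by blast
  obtain C2 where C2: "C2 > 0" "\<And>s. s \<ge> 0 \<Longrightarrow> exp (- s) \<le> C2 * (1 + s) powr - \<delta>"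
    using exp_le_powr by blast
  have "wiener_bdd ((C1 * N + C2 * B) * (1 + s) powr - \<gamma>) ((C1 * N + C2 * B) * (1 + s) powr - \<delta>) (\<lambda>\<xi>. of_real (exp (- s) * (chi \<xi> * pw a \<xi>)))"
    if s: "s \<ge> 1" for s
  proof -
    have "wiener_bdd (exp (- s) * N) (exp (- s) * B) (\<lambda>\<xi>. of_real (exp (- s) * (chi \<xi> * pw a \<xi>)))"
      using wiener_bdd_cmult[OF 1, of "of_real (exp (- s))"] by (simp add: norm_exp_eq_Re)
    then show ?thesis
    proof (rule wiener_bdd_mono)
      have "exp (- s) * N \<le> (C1 * (1 + s) powr - \<gamma>) * N"
        using C1(2)[of s] s NB by (intro mult_right_mono) auto
      also have "\<dots> = (C1 * N) * (1 + s) powr - \<gamma>" by simp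
      also have "\<dots> \<le> (C1 * N + C2 * B) * (1 + s) powr - \<gamma>"
        using C2 NB by (intro mult_right_mono) auto
      finally show "exp (- s) * N \<le> (C1 * N + C2 * B) * (1 + s) powr - \<gamma>" .
      have "exp (- s) * B \<le> (C2 * (1 + s) powr - \<delta>) * B"
        using C2(2)[of s] s NB by (intro mult_right_mono) auto
      also have "\<dots> = (C2 * B) * (1 + s) powr - \<delta>" by simp
      also have "\<dots> \<le> (C1 * N + C2 * B) * (1 + s) powr - \<delta>"
        using C1 NB by (intro mult_right_mono) auto
      finally show "exp (- s) * B \<le> (C1 * N + C2 * B) * (1 + s) powr - \<delta>" .
    qed
  qed
  then show ?thesis by blast
qed

lemma wiener_bdd_decay_add:
  assumes "\<exists>C. \<forall>s\<ge>(1::real). wiener_bdd (C * f s) (C * g s) (m s)" "\<exists>C. \<forall>s\<ge>1. wiener_bdd (C * f s) (C * g s) (m' s)"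
  shows "\<exists>C. \<forall>s\<ge>1. wiener_bdd (C * f s) (C * g s) (\<lambda>\<xi>. m s \<xi> + m' s \<xi>)"
proof -
  from assms obtain C C' where C: "\<And>s. s \<ge> 1 \<Longrightarrow> wiener_bdd (C * f s) (C * g s) (m s)"
    and C': "\<And>s. s \<ge> 1 \<Longrightarrow> wiener_bdd (C' * f s) (C' * g s) (m' s)" by blast
  have "\<forall>s\<ge>1. wiener_bdd ((C + C') * f s) ((C + C') * g s) (\<lambda>\<xi>. m s \<xi> + m' s \<xi>)"
    using wiener_bdd_add[OF C C'] by (simp add: distrib_right)
  then show ?thesis by blast
qed

lemma wiener_bdd_decay_minus:
  assumes "\<exists>C. \<forall>s\<ge>(1::real). wiener_bdd (C * f s) (C * g s) (m s)"
  shows "\<exists>C. \<forall>s\<ge>1. wiener_bdd (C * f s) (C * g s) (\<lambda>\<xi>. - m s \<xi>)"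
  using assms wiener_bdd_cmult[where c="-1"] by fastforce

text \<open>The part of \<^const>\<open>zfun\<close> with \<open>\<tau> < 1\<close> only contributes an exponentially decaying term;
  the part with \<open>\<tau> > 1\<close> is a superposition of heat kernels.\<close>

lemma wiener_bdd_cutoff_zfun:
  fixes chi :: "'a::euclidean_space \<Rightarrow> real"
  assumes chi: "radial_cutoff chi" and a: "a \<ge> 0" and \<sigma>: "\<sigma> > 0"
  shows "\<exists>C. \<forall>s\<ge>1. wiener_bdd (C * (1 + s) powr - ((a + 2 * \<sigma>) / (2 * \<sigma>)))
      (C * (1 + s) powr - ((a + 2 * \<sigma> + DIM('a)) / (2 * \<sigma>)))
      (\<lambda>\<xi>. of_real (chi \<xi> * pw a \<xi> * (exp (- s) * (norm \<xi> powr (2 * \<sigma>) * zfun s (norm \<xi> powr (2 * \<sigma>))))))"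
proof -
  define \<gamma> where "\<gamma> = (a + 2 * \<sigma>) / (2 * \<sigma>)"
  define \<delta> where "\<delta> = (a + 2 * \<sigma> + DIM('a)) / (2 * \<sigma>)"
  have \<gamma>0: "\<gamma> \<ge> 0" "\<delta> \<ge> 0" using a \<sigma> by (auto simp: \<gamma>_def \<delta>_def)
  define r where "r \<xi> = norm \<xi> powr (2 * \<sigma>)" for \<xi> :: 'a
  define I1 where "I1 \<xi> = (LINT \<tau>|lborel. indicator {0<..1} \<tau> * exp \<tau> * exp (- \<tau> * r \<xi>))" for \<xi>
  define I2 where "I2 s \<xi> = (LINT \<tau>|lborel. indicator {1<..s} \<tau> * exp \<tau> * exp (- \<tau> * r \<xi>))" for s \<xi>
  obtain N0 B0 where W0: "wiener_bdd N0 B0 (\<lambda>\<xi>. complex_of_real (chi \<xi> * pw 0 \<xi>))"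
    using cutoff_pw_wiener[OF chi, of 0] by auto
  have N0: "N0 \<ge> 0" using wiener_bdd_nonneg[OF W0] by simp
  obtain N1 B1 where W1: "wiener_bdd N1 B1 (\<lambda>\<xi>. complex_of_real (chi \<xi> * pw (a + \<sigma>) \<xi>))"
    using cutoff_pw_wiener[OF chi, of "a + \<sigma>"] a \<sigma> by auto
  have "continuous_on {0..1} (exp :: real \<Rightarrow> real)"
    by (intro continuous_intros)
  from wiener_heat_Ioc[OF \<sigma> this] obtain N1' where W1': "wiener N1' (\<lambda>\<xi>::'a. complex_of_real (pw \<sigma> \<xi> * I1 \<xi>))"
    unfolding I1_def[abs_def] r_def by blast
  \<comment> \<open>For \<tau> \<le> 1 only |\<xi>|^\<sigma> stays with the integral; the remaining
    |\<xi>|^(a + \<sigma>) is put on the cut-off.\<close>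
  define m1 where "m1 \<xi> = complex_of_real (pw \<sigma> \<xi> * I1 \<xi>) * of_real (chi \<xi> * pw (a + \<sigma>) \<xi>)" for \<xi>
  have m1: "wiener_bdd (N1' * N1) (N1' * B1) m1"
    unfolding m1_def[abs_def] by (rule wiener_bdd_mult[OF W1' W1])
  obtain C2 where C2: "C2 \<ge> 0" and W2: "\<And>l u f. 0 < l \<Longrightarrow> continuous_on {l..u} f \<Longrightarrow>
      wiener_bdd (C2 * (LINT \<tau>|lborel. \<bar>indicator {l<..u} \<tau> * f \<tau> * \<tau> powr - \<gamma>\<bar>))
        (C2 * (LINT \<tau>|lborel. \<bar>indicator {l<..u} \<tau> * f \<tau> * \<tau> powr - \<delta>\<bar>))
        (\<lambda>\<xi>::'a. complex_of_real (norm \<xi> powr (a + 2 * \<sigma>) * (LINT \<tau>|lborel. indicator {l<..u} \<tau> * f \<tau> * exp (- \<tau> * norm \<xi> powr (2 * \<sigma>)))))"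
    using wiener_heat_bdd_Ioc[of "a + 2 * \<sigma>" \<sigma>, where 'a='a] a \<sigma> unfolding \<gamma>_def \<delta>_def by (auto simp: add_nonneg_pos)
  obtain C3 where C3: "\<And>s. s \<ge> 1 \<Longrightarrow> (LINT \<tau>|lborel. \<bar>indicator {1<..s} \<tau> * exp \<tau> * \<tau> powr - \<gamma>\<bar>) \<le> C3 * (exp s * (1 + s) powr - \<gamma>)"
    using integral_exp_powr_le[OF \<gamma>0(1)] by blast
  obtain C4 where C4: "\<And>s. s \<ge> 1 \<Longrightarrow> (LINT \<tau>|lborel. \<bar>indicator {1<..s} \<tau> * exp \<tau> * \<tau> powr - \<delta>\<bar>) \<le> C4 * (exp s * (1 + s) powr - \<delta>)"
    using integral_exp_powr_le[OF \<gamma>0(2)] by blast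
  obtain D1 where D1: "D1 > 0" "\<And>s. s \<ge> 0 \<Longrightarrow> exp (- s) \<le> D1 * (1 + s) powr - \<gamma>"
    using exp_le_powr by blast
  obtain D2 where D2: "D2 > 0" "\<And>s. s \<ge> 0 \<Longrightarrow> exp (- s) \<le> D2 * (1 + s) powr - \<delta>"
    using exp_le_powr by blast
  \<comment> \<open>For \<tau> > 1 the whole power |\<xi>|^(a + 2\<sigma>) stays with the heat
    symbol, since it produces the decay; the cut-off contributes only the factor
    \<open>N0\<close>.\<close>
  define m2 where "m2 s \<xi> = complex_of_real (chi \<xi> * pw 0 \<xi>) * of_real (norm \<xi> powr (a + 2 * \<sigma>) * I2 s \<xi>)" for s \<xi>
  have m2: "wiener_bdd (N0 * (C2 * (C3 * (exp s * (1 + s) powr - \<gamma>)))) (N0 * (C2 * (C4 * (exp s * (1 + s) powr - \<delta>)))) (m2 s)"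
    if s: "s \<ge> 1" for s
  proof (rule wiener_bdd_mono)
    show "wiener_bdd (N0 * (C2 * (LINT \<tau>|lborel. \<bar>indicator {1<..s} \<tau> * exp \<tau> * \<tau> powr - \<gamma>\<bar>)))
        (N0 * (C2 * (LINT \<tau>|lborel. \<bar>indicator {1<..s} \<tau> * exp \<tau> * \<tau> powr - \<delta>\<bar>))) (m2 s)"
      unfolding m2_def[abs_def] I2_def r_def
      by (intro wiener_bdd_mult wiener_bdd_imp_wiener[OF W0] W2) (auto intro!: continuous_intros)
  qed (use N0 C2 C3[OF s] C4[OF s] in \<open>auto intro!: mult_left_mono\<close>)
  have eq: "of_real (chi \<xi> * pw a \<xi> * (exp (- s) * (r \<xi> * zfun s (r \<xi>)))) =
      of_real (exp (- s)) * (m1 \<xi> + m2 s \<xi>)" if s: "s \<ge> 1" for s \<xi>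
  proof -
    have e: "exp \<tau> * exp (- \<tau> * r \<xi>) = exp (\<tau> * (1 - r \<xi>))" for \<tau>
      by (simp add: mult_exp_exp algebra_simps)
    have "zfun s (r \<xi>) = I1 \<xi> + I2 s \<xi>"
      using zfun_diff[of 0 1 "r \<xi>"] zfun_diff[OF s, of "r \<xi>"]
      unfolding I1_def I2_def mult.assoc e by simp
    then have "chi \<xi> * pw a \<xi> * (exp (- s) * (r \<xi> * zfun s (r \<xi>))) =
        exp (- s) * ((chi \<xi> * pw a \<xi> * r \<xi>) * I1 \<xi> + (chi \<xi> * pw a \<xi> * r \<xi>) * I2 s \<xi>)"
      by (simp add: algebra_simps)
    also have "(chi \<xi> * pw a \<xi> * r \<xi>) * I1 \<xi> = pw \<sigma> \<xi> * I1 \<xi> * (chi \<xi> * pw (a + \<sigma>) \<xi>)"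
    proof -
      have "r \<xi> = pw \<sigma> \<xi> * pw \<sigma> \<xi>"
        unfolding r_def by (rule pw_two_mult[OF \<sigma>])
      then show ?thesis
        using a \<sigma> by (simp add: pw_mult[symmetric] mult_ac)
    qed
    also have "(chi \<xi> * pw a \<xi> * r \<xi>) * I2 s \<xi> = (chi \<xi> * pw 0 \<xi>) * (norm \<xi> powr (a + 2 * \<sigma>) * I2 s \<xi>)"
      using pw_mult[of a "2 * \<sigma>" \<xi>] a \<sigma> by (simp add: r_def pw_pos[symmetric] pw_def[of 0] mult_ac)
    finally show ?thesis
      unfolding m1_def m2_def by (simp only: of_real_mult of_real_add)
  qed
  \<comment> \<open>One constant for both bounds. The terms from \<open>m1\<close> use the decay of
    exp (- s) against the two rates; in those from \<open>m2\<close> it cancels exp s.\<close>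
  define C where "C = D1 * (N1' * N1) + D2 * (N1' * B1) + \<bar>N0 * (C2 * C3)\<bar> + \<bar>N0 * (C2 * C4)\<bar>"
  have NB1: "0 \<le> N1' * N1" "0 \<le> N1' * B1" using wiener_bdd_nonneg[OF m1] by auto
  have "wiener_bdd (C * (1 + s) powr - \<gamma>) (C * (1 + s) powr - \<delta>)
      (\<lambda>\<xi>. of_real (chi \<xi> * pw a \<xi> * (exp (- s) * (r \<xi> * zfun s (r \<xi>)))))" if s: "s \<ge> 1" for s
  proof -
    have n: "norm (complex_of_real (exp (- s))) = exp (- s)"
      unfolding norm_of_real by simp
    have es: "exp (- s) * exp s = 1" by (simp add: mult_exp_exp)
    have "wiener_bdd (exp (- s) * (N1' * N1 + N0 * (C2 * (C3 * (exp s * (1 + s) powr - \<gamma>)))))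
      (exp (- s) * (N1' * B1 + N0 * (C2 * (C4 * (exp s * (1 + s) powr - \<delta>)))))
      (\<lambda>\<xi>. of_real (chi \<xi> * pw a \<xi> * (exp (- s) * (r \<xi> * zfun s (r \<xi>)))))"
      unfolding eq[OF s] using wiener_bdd_cmult[OF wiener_bdd_add[OF m1 m2[OF s]], of "of_real (exp (- s))"]
      unfolding n .
    then show ?thesis
    proof (rule wiener_bdd_mono)
      have "exp (- s) * (N1' * N1 + N0 * (C2 * (C3 * (exp s * (1 + s) powr - \<gamma>)))) =
          exp (- s) * (N1' * N1) + (exp (- s) * exp s) * (N0 * (C2 * C3) * (1 + s) powr - \<gamma>)"
        by (simp add: algebra_simps)
      also have "\<dots> \<le> (D1 * (1 + s) powr - \<gamma>) * (N1' * N1) + 1 * (\<bar>N0 * (C2 * C3)\<bar> * (1 + s) powr - \<gamma>)"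
        unfolding es using D1(2)[of s] s NB1 by (intro add_mono mult_right_mono mult_left_mono) auto
      also have "\<dots> = (D1 * (N1' * N1) + \<bar>N0 * (C2 * C3)\<bar>) * (1 + s) powr - \<gamma>"
        by (simp add: algebra_simps)
      also have "\<dots> \<le> C * (1 + s) powr - \<gamma>"
        using NB1 D2 by (intro mult_right_mono) (auto simp: C_def)
      finally show "exp (- s) * (N1' * N1 + N0 * (C2 * (C3 * (exp s * (1 + s) powr - \<gamma>)))) \<le> C * (1 + s) powr - \<gamma>" .
      have "exp (- s) * (N1' * B1 + N0 * (C2 * (C4 * (exp s * (1 + s) powr - \<delta>)))) =
          exp (- s) * (N1' * B1) + (exp (- s) * exp s) * (N0 * (C2 * C4) * (1 + s) powr - \<delta>)"
        by (simp add: algebra_simps)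
      also have "\<dots> \<le> (D2 * (1 + s) powr - \<delta>) * (N1' * B1) + 1 * (\<bar>N0 * (C2 * C4)\<bar> * (1 + s) powr - \<delta>)"
        unfolding es using D2(2)[of s] s NB1 by (intro add_mono mult_right_mono mult_left_mono) auto
      also have "\<dots> = (D2 * (N1' * B1) + \<bar>N0 * (C2 * C4)\<bar>) * (1 + s) powr - \<delta>"
        by (simp add: algebra_simps)
      also have "\<dots> \<le> C * (1 + s) powr - \<delta>"
        using NB1 D1 by (intro mult_right_mono) (auto simp: C_def)
      finally show "exp (- s) * (N1' * B1 + N0 * (C2 * (C4 * (exp s * (1 + s) powr - \<delta>)))) \<le> C * (1 + s) powr - \<delta>" .
    qed
  qed
  then show ?thesis unfolding \<gamma>_def \<delta>_def r_def by blast
qed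

text \<open>The remainder integral has an interval of length \<open>\<bar>h\<bar>\<close> and a
  weight bounded by a multiple of \<open>\<bar>h\<bar>\<close>, hence the square. With
  \<open>s \<ge> 1\<close> and \<open>\<bar>h\<bar> \<le> 1 / 2\<close> the interval keeps \<tau>
  \<ge> 1/2, away from the singularity. The factor \<open>1 - r\<close> in the remainder is the
  reason for the two powers \<open>a + 2 * \<sigma>\<close> and
  \<open>a + 4 * \<sigma>\<close>.\<close>

lemma wiener_cutoff_remainder:
  fixes chi :: "'a::euclidean_space \<Rightarrow> real"
  assumes chi: "radial_cutoff chi" and a: "a \<ge> 0" and \<sigma>: "\<sigma> > 0" and s: "s \<ge> 1"
  shows "\<exists>C. \<forall>h. \<bar>h\<bar> \<le> 1 / 2 \<longrightarrow> wiener (C * h\<^sup>2)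
      (\<lambda>\<xi>. of_real (chi \<xi> * pw a \<xi> * (norm \<xi> powr (2 * \<sigma>) *
        (zfun (s + h) (norm \<xi> powr (2 * \<sigma>)) - zfun s (norm \<xi> powr (2 * \<sigma>)) - h * exp (s * (1 - norm \<xi> powr (2 * \<sigma>)))))))"
proof -
  define r where "r \<xi> = norm \<xi> powr (2 * \<sigma>)" for \<xi> :: 'a
  obtain N0 B0 where W0: "wiener_bdd N0 B0 (\<lambda>\<xi>. complex_of_real (chi \<xi> * pw 0 \<xi>))"
    using cutoff_pw_wiener[OF chi, of 0] by auto
  have N0: "N0 \<ge> 0" using wiener_bdd_nonneg[OF W0] by simp
  have ex: "\<exists>C\<ge>0. \<forall>h. \<bar>h\<bar> \<le> 1 / 2 \<longrightarrow> wiener (C * h\<^sup>2)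
     (\<lambda>\<xi>::'a. complex_of_real (norm \<xi> powr c * (LINT \<tau>|lborel. indicator {min s (s + h)<..max s (s + h)} \<tau> * (\<bar>s + h - \<tau>\<bar> * exp \<tau>) * exp (- \<tau> * r \<xi>))))"
    if c: "c > 0" for c
  proof -
    obtain C2 where C2: "C2 \<ge> 0" and W2: "\<And>l u f. 0 < l \<Longrightarrow> continuous_on {l..u} f \<Longrightarrow>
        wiener_bdd (C2 * (LINT \<tau>|lborel. \<bar>indicator {l<..u} \<tau> * f \<tau> * \<tau> powr - (c / (2 * \<sigma>))\<bar>))
          (C2 * (LINT \<tau>|lborel. \<bar>indicator {l<..u} \<tau> * f \<tau> * \<tau> powr - ((c + DIM('a)) / (2 * \<sigma>))\<bar>))
          (\<lambda>\<xi>::'a. complex_of_real (norm \<xi> powr c * (LINT \<tau>|lborel. indicator {l<..u} \<tau> * f \<tau> * exp (- \<tau> * r \<xi>))))"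
      using wiener_heat_bdd_Ioc[OF c \<sigma>, where 'a='a] unfolding r_def by auto
    define D where "D = exp (s + 1) * (1 / 2) powr - (c / (2 * \<sigma>))"
    have "wiener ((C2 * D) * h\<^sup>2) (\<lambda>\<xi>::'a. complex_of_real (norm \<xi> powr c * (LINT \<tau>|lborel. indicator {min s (s + h)<..max s (s + h)} \<tau> * (\<bar>s + h - \<tau>\<bar> * exp \<tau>) * exp (- \<tau> * r \<xi>))))"
      if h: "\<bar>h\<bar> \<le> 1 / 2" for h
    proof (rule wiener_mono)
      define A where "A = {min s (s + h)<..max s (s + h)}"
      show "wiener (C2 * (LINT \<tau>|lborel. \<bar>indicator A \<tau> * (\<bar>s + h - \<tau>\<bar> * exp \<tau>) * \<tau> powr - (c / (2 * \<sigma>))\<bar>))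
          (\<lambda>\<xi>::'a. complex_of_real (norm \<xi> powr c * (LINT \<tau>|lborel. indicator {min s (s + h)<..max s (s + h)} \<tau> * (\<bar>s + h - \<tau>\<bar> * exp \<tau>) * exp (- \<tau> * r \<xi>))))"
        unfolding A_def
        by (intro wiener_bdd_imp_wiener[OF W2] continuous_intros) (use s h in auto)
      have "(LINT \<tau>|lborel. \<bar>indicator A \<tau> * (\<bar>s + h - \<tau>\<bar> * exp \<tau>) * \<tau> powr - (c / (2 * \<sigma>))\<bar>) \<le> (LINT \<tau>|lborel. indicator A \<tau> * (\<bar>h\<bar> * D))"
      proof (rule integral_mono')
        show "integrable lborel (\<lambda>\<tau>. indicator A \<tau> * (\<bar>h\<bar> * D))"
          unfolding A_def by (intro integrable_Ioc continuous_intros)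
        fix \<tau>
        show "0 \<le> indicator A \<tau> * (\<bar>h\<bar> * D)" by (simp add: D_def)
        show "\<bar>indicator A \<tau> * (\<bar>s + h - \<tau>\<bar> * exp \<tau>) * \<tau> powr - (c / (2 * \<sigma>))\<bar> \<le> indicator A \<tau> * (\<bar>h\<bar> * D)"
        proof (cases "\<tau> \<in> A")
          case True
          then have \<tau>: "\<tau> \<ge> 1 / 2" "\<tau> \<le> s + 1" "\<bar>s + h - \<tau>\<bar> \<le> \<bar>h\<bar>"
            using s h by (auto simp: A_def min_def max_def split: if_splits)
          have "\<tau> powr - (c / (2 * \<sigma>)) \<le> (1 / 2) powr - (c / (2 * \<sigma>))"
            using \<tau> c \<sigma> by (intro powr_mono2') auto
          then have "\<bar>s + h - \<tau>\<bar> * (exp \<tau> * \<tau> powr - (c / (2 * \<sigma>))) \<le> \<bar>h\<bar> * D"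
            unfolding D_def using \<tau> by (intro mult_mono) auto
          then show ?thesis using True \<tau> by (simp add: abs_mult mult.assoc)
        qed simp
      qed
      also have "\<dots> = \<bar>h\<bar> * D * \<bar>h\<bar>"
        unfolding A_def by (subst integral_Ioc_FTC[where F="\<lambda>\<tau>. (\<bar>h\<bar> * D) * \<tau>"])
          (auto intro!: derivative_eq_intros simp: min_def max_def algebra_simps)
      also have "\<dots> = D * h\<^sup>2"
        by (simp add: power2_eq_square)
      finally show "C2 * (LINT \<tau>|lborel. \<bar>indicator A \<tau> * (\<bar>s + h - \<tau>\<bar> * exp \<tau>) * \<tau> powr - (c / (2 * \<sigma>))\<bar>) \<le> C2 * D * h\<^sup>2"
        using C2 by (simp add: mult.assoc mult_left_mono)
    qed
    moreover have "C2 * D \<ge> 0" using C2 by (simp add: D_def)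
    ultimately show ?thesis by blast
  qed
  obtain C1 where C1: "\<And>h. \<bar>h\<bar> \<le> 1 / 2 \<Longrightarrow> wiener (C1 * h\<^sup>2)
     (\<lambda>\<xi>::'a. complex_of_real (norm \<xi> powr (a + 2 * \<sigma>) * (LINT \<tau>|lborel. indicator {min s (s + h)<..max s (s + h)} \<tau> * (\<bar>s + h - \<tau>\<bar> * exp \<tau>) * exp (- \<tau> * r \<xi>))))"
    using ex[of "a + 2 * \<sigma>"] a \<sigma> by (auto simp: add_nonneg_pos)
  obtain C2 where C2: "\<And>h. \<bar>h\<bar> \<le> 1 / 2 \<Longrightarrow> wiener (C2 * h\<^sup>2)
     (\<lambda>\<xi>::'a. complex_of_real (norm \<xi> powr (a + 4 * \<sigma>) * (LINT \<tau>|lborel. indicator {min s (s + h)<..max s (s + h)} \<tau> * (\<bar>s + h - \<tau>\<bar> * exp \<tau>) * exp (- \<tau> * r \<xi>))))"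
    using ex[of "a + 4 * \<sigma>"] a \<sigma> by (auto simp: add_nonneg_pos)
  have "wiener (N0 * (C1 + C2) * h\<^sup>2)
      (\<lambda>\<xi>. of_real (chi \<xi> * pw a \<xi> * (r \<xi> * (zfun (s + h) (r \<xi>) - zfun s (r \<xi>) - h * exp (s * (1 - r \<xi>))))))"
    if h: "\<bar>h\<bar> \<le> 1 / 2" for h
  proof -
    define J where "J \<xi> = (LINT \<tau>|lborel. indicator {min s (s + h)<..max s (s + h)} \<tau> * (\<bar>s + h - \<tau>\<bar> * exp \<tau>) * exp (- \<tau> * r \<xi>))" for \<xi>
    have eq: "of_real (chi \<xi> * pw 0 \<xi>) * (of_real (norm \<xi> powr (a + 2 * \<sigma>) * J \<xi>) + (-1) * of_real (norm \<xi> powr (a + 4 * \<sigma>) * J \<xi>)) =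
       complex_of_real (chi \<xi> * pw a \<xi> * (r \<xi> * (zfun (s + h) (r \<xi>) - zfun s (r \<xi>) - h * exp (s * (1 - r \<xi>)))))" for \<xi>
    proof -
      have e: "exp \<tau> * exp (- \<tau> * r \<xi>) = exp (\<tau> * (1 - r \<xi>))" for \<tau>
        by (simp add: mult_exp_exp algebra_simps)
      have d: "zfun (s + h) (r \<xi>) - zfun s (r \<xi>) - h * exp (s * (1 - r \<xi>)) = (1 - r \<xi>) * J \<xi>"
        unfolding zfun_remainder J_def mult.assoc e ..
      have "chi \<xi> * pw a \<xi> * (r \<xi> * (zfun (s + h) (r \<xi>) - zfun s (r \<xi>) - h * exp (s * (1 - r \<xi>)))) =
        chi \<xi> * ((pw a \<xi> * r \<xi>) * J \<xi> + (-1) * ((pw a \<xi> * r \<xi> * r \<xi>) * J \<xi>))"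
        unfolding d by (simp add: algebra_simps)
      also have "pw a \<xi> * r \<xi> = norm \<xi> powr (a + 2 * \<sigma>)"
        using pw_mult[of a "2 * \<sigma>" \<xi>] a \<sigma> by (simp add: r_def pw_pos[symmetric])
      also have "norm \<xi> powr (a + 2 * \<sigma>) * r \<xi> = norm \<xi> powr (a + 4 * \<sigma>)"
        unfolding r_def powr_add[symmetric] by (simp add: algebra_simps)
      finally have E: "chi \<xi> * pw a \<xi> * (r \<xi> * (zfun (s + h) (r \<xi>) - zfun s (r \<xi>) - h * exp (s * (1 - r \<xi>)))) =
        chi \<xi> * (norm \<xi> powr (a + 2 * \<sigma>) * J \<xi> + - 1 * (norm \<xi> powr (a + 4 * \<sigma>) * J \<xi>))" .
      show ?thesis
        unfolding E by (simp add: pw_def[of 0])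
    qed
    have "norm (- 1 :: complex) = 1" by simp
    with wiener_mult[OF wiener_bdd_imp_wiener[OF W0] wiener_add[OF C1[OF h] wiener_cmult[OF C2[OF h], of "-1"]]]
    have "wiener (N0 * (C1 * h\<^sup>2 + C2 * h\<^sup>2)) (\<lambda>\<xi>. complex_of_real (chi \<xi> * pw 0 \<xi>) * (of_real (norm \<xi> powr (a + 2 * \<sigma>) * J \<xi>) + (-1) * of_real (norm \<xi> powr (a + 4 * \<sigma>) * J \<xi>)))"
      unfolding J_def by simp
    then show ?thesis
      unfolding eq by (simp add: algebra_simps)
  qed
  then show ?thesis unfolding r_def by blast
qed

text \<open>The \<open>j\<close>-th time derivatives of the symbols of \<open>u - v\<close> acting on \<open>u\<^sub>0\<close> and \<open>u\<^sub>1\<close>, for \<open>j \<le> 1\<close>.\<close>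

definition du0 :: "real \<Rightarrow> nat \<Rightarrow> real \<Rightarrow> 'a::euclidean_space \<Rightarrow> real" where
  "du0 \<sigma> j s \<xi> = (let r = norm \<xi> powr (2 * \<sigma>); w = exp (- s) * (r * zfun s r)
     in if j = 0 then w else exp (- s) * r - r * w)"

definition du1 :: "real \<Rightarrow> nat \<Rightarrow> real \<Rightarrow> 'a::euclidean_space \<Rightarrow> real" where
  "du1 \<sigma> j s \<xi> = du0 \<sigma> j s \<xi> - (- 1) ^ j * exp (- s)"

text \<open>For \<open>j = 1\<close> the extra factor \<open>r\<close> amounts to raising
  \<open>a\<close> by \<open>2 * \<sigma>\<close>, which improves both rates by one power of
  \<open>1 + s\<close>. All other terms carry exp (- s) in front of a cut-off power.\<close>

lemma wiener_bdd_du: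
  fixes chi :: "'a::euclidean_space \<Rightarrow> real"
  assumes chi: "radial_cutoff chi" and a: "a \<ge> 0" and \<sigma>: "\<sigma> > 0" and j: "j \<in> {0, 1}"
  defines "\<gamma> \<equiv> a / (2 * \<sigma>) + real j + 1"
  shows "\<exists>C. \<forall>s\<ge>1. wiener_bdd (C * (1 + s) powr - \<gamma>) (C * (1 + s) powr - (\<gamma> + DIM('a) / (2 * \<sigma>)))
      (\<lambda>\<xi>. of_real (chi \<xi> * pw a \<xi> * du0 \<sigma> j s \<xi>))" (is ?P0)
    and "\<exists>C. \<forall>s\<ge>1. wiener_bdd (C * (1 + s) powr - \<gamma>) (C * (1 + s) powr - (\<gamma> + DIM('a) / (2 * \<sigma>)))
      (\<lambda>\<xi>. of_real (chi \<xi> * pw a \<xi> * du1 \<sigma> j s \<xi>))" (is ?P1)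
proof -
  show 0: ?P0
  proof (cases "j = 0")
    case True
    have "(a + 2 * \<sigma>) / (2 * \<sigma>) = \<gamma>" "(a + 2 * \<sigma> + DIM('a)) / (2 * \<sigma>) = \<gamma> + DIM('a) / (2 * \<sigma>)"
      using \<sigma> True by (auto simp: \<gamma>_def field_simps)
    then show ?thesis
      using wiener_bdd_cutoff_zfun[OF chi a \<sigma>] True by (simp only: du0_def Let_def simp_thms if_True)
  next
    case False
    then have j1: "j = 1" using j by simp
    have a2: "a + 2 * \<sigma> \<ge> 0" using a \<sigma> by simp
    have e: "((a + 2 * \<sigma>) + 2 * \<sigma>) / (2 * \<sigma>) = \<gamma>" "((a + 2 * \<sigma>) + 2 * \<sigma> + DIM('a)) / (2 * \<sigma>) = \<gamma> + DIM('a) / (2 * \<sigma>)"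
      using \<sigma> j1 by (auto simp: \<gamma>_def field_simps)
    note z = wiener_bdd_decay_minus[OF wiener_bdd_cutoff_zfun[OF chi a2 \<sigma>, unfolded e]]
    note x = wiener_bdd_cutoff_exp_decay[OF chi a2, of \<gamma> "\<gamma> + DIM('a) / (2 * \<sigma>)"]
    have eq: "of_real (exp (- s) * (chi \<xi> * pw (a + 2 * \<sigma>) \<xi>)) +
      - complex_of_real (chi \<xi> * pw (a + 2 * \<sigma>) \<xi> * (exp (- s) * (norm \<xi> powr (2 * \<sigma>) * zfun s (norm \<xi> powr (2 * \<sigma>))))) =
       of_real (chi \<xi> * pw a \<xi> * du0 \<sigma> j s \<xi>)" for s \<xi>
    proof -
      have "pw (a + 2 * \<sigma>) \<xi> = pw a \<xi> * norm \<xi> powr (2 * \<sigma>)"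
        using pw_mult[of a "2 * \<sigma>" \<xi>] a \<sigma> by (simp add: pw_pos)
      then show ?thesis
        by (simp add: du0_def j1 Let_def algebra_simps)
    qed
    from wiener_bdd_decay_add[OF x z] show ?thesis
      unfolding eq .
  qed
  have 1: "\<exists>C. \<forall>s\<ge>1. wiener_bdd (C * (1 + s) powr - \<gamma>) (C * (1 + s) powr - (\<gamma> + DIM('a) / (2 * \<sigma>)))
      (\<lambda>\<xi>. of_real (- ((- 1) ^ j) * (exp (- s) * (chi \<xi> * pw a \<xi>))))"
  proof -
    note x = wiener_bdd_cutoff_exp_decay[OF chi a, of \<gamma> "\<gamma> + DIM('a) / (2 * \<sigma>)"]
    consider "(- ((- 1) ^ j) :: real) = 1" | "(- ((- 1) ^ j) :: real) = - 1"
      using j by auto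
    then show ?thesis
    proof cases
      case 1
      then show ?thesis unfolding 1 mult_1 using x by blast
    next
      case 2
      then show ?thesis unfolding 2 mult_minus1 of_real_minus
        using wiener_bdd_decay_minus[OF x] by blast
    qed
  qed
  have eq: "complex_of_real (chi \<xi> * pw a \<xi> * du0 \<sigma> j s \<xi>) + of_real (- ((- 1) ^ j) * (exp (- s) * (chi \<xi> * pw a \<xi>))) =
    of_real (chi \<xi> * pw a \<xi> * du1 \<sigma> j s \<xi>)" for \<xi> s
    by (simp add: du1_def algebra_simps)
  from wiener_bdd_decay_add[OF 0 1] show ?P1
    unfolding eq .
qed


section \<open>Pairings and Young's inequality\<close>

text \<open>Contains every L^p with 1 \<le> p \<le> \<infinity>, so that pairings are treated for
  all exponents at once. A majorant takes the place of an actual decomposition.\<close>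

definition L1_plus_Linf :: "('a::euclidean_space \<Rightarrow> complex) \<Rightarrow> bool" where
  "L1_plus_Linf u \<longleftrightarrow> u \<in> borel_measurable borel \<and>
    (\<exists>B v. 0 \<le> B \<and> integrable lborel v \<and> (\<forall>x. 0 \<le> v x) \<and> (AE x in lborel. norm (u x) \<le> B + v x))"

text \<open>The transpose of convolution with \<mu>. Functions of this form will represent the
  distributions to be estimated.\<close>

definition corr :: "('a::euclidean_space \<Rightarrow> complex) \<Rightarrow> ('a \<Rightarrow> complex) \<Rightarrow> 'a \<Rightarrow> complex" where
  "corr u \<mu> z = (LINT y|lborel. u (z + y) * \<mu> y)"

lemma borel_measurable_corr [measurable]:
  fixes u \<mu> :: "'a::euclidean_space \<Rightarrow> complex"
  assumes [measurable]: "u \<in> borel_measurable borel" "\<mu> \<in> borel_measurable borel"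
  shows "corr u \<mu> \<in> borel_measurable borel"
  unfolding corr_def[abs_def] by measurable

lemma AE_lborel_shift:
  fixes z :: "'a::euclidean_space"
  assumes "AE x in lborel. P x"
  shows "AE y in lborel. P (z + y)"
proof -
  have "AE x in distr lborel borel ((+) z). P x"
    by (subst lborel_distr_plus) (rule assms)
  then show ?thesis
    by (rule AE_distrD[rotated]) simp
qed

text \<open>The majorant \<open>S * norm (\<phi> (x - y)) + B * v x\<close> has an integral
  independent of \<open>y\<close>, by translation invariance.\<close>

lemma
  fixes u \<phi> :: "'a::euclidean_space \<Rightarrow> complex"
  assumes u: "L1_plus_Linf u" and \<phi>: "integrable lborel \<phi>" and b: "\<And>x. norm (\<phi> x) \<le> B"
  shows L1_plus_Linf_integrable: "integrable lborel (\<lambda>x. u x * \<phi> (x - y))"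
    and L1_plus_Linf_bound: "\<exists>K\<ge>0. \<forall>y. (LINT x|lborel. norm (u x * \<phi> (x - y))) \<le> K"
proof -
  obtain S v where S: "0 \<le> S" and v: "integrable lborel v" "\<And>x. 0 \<le> v x"
    and le: "AE x in lborel. norm (u x) \<le> S + v x"
    using u unfolding L1_plus_Linf_def by blast
  have [measurable]: "u \<in> borel_measurable borel" "\<phi> \<in> borel_measurable borel" "v \<in> borel_measurable borel"
    using u \<phi> v unfolding L1_plus_Linf_def by auto
  have B: "B \<ge> 0" using b[of 0] norm_ge_zero[of "\<phi> 0"] by linarith
  have \<phi>y: "integrable lborel (\<lambda>x. \<phi> (x - y))" for y
    using lborel_integrable_shift[OF \<phi>, of "- y"] by simp
  have maj: "integrable lborel (\<lambda>x. S * norm (\<phi> (x - y)) + B * v x)" for y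
    using \<phi>y v by auto
  have AE: "AE x in lborel. norm (u x * \<phi> (x - y)) \<le> S * norm (\<phi> (x - y)) + B * v x" for y
    using le
  proof eventually_elim
    case (elim x)
    have "norm (u x * \<phi> (x - y)) \<le> (S + v x) * norm (\<phi> (x - y))"
      unfolding norm_mult using elim by (rule mult_right_mono) simp
    also have "\<dots> \<le> S * norm (\<phi> (x - y)) + v x * B"
      unfolding distrib_right using b v(2) by (intro add_left_mono mult_left_mono) auto
    finally show ?case by (simp add: mult.commute)
  qed
  show i: "integrable lborel (\<lambda>x. u x * \<phi> (x - y))" for y
  proof (rule Bochner_Integration.integrable_bound[OF maj])
    show "AE x in lborel. norm (u x * \<phi> (x - y)) \<le> norm (S * norm (\<phi> (x - y)) + B * v x)"
      using AE[of y]
    proof eventually_elim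
      case (elim x)
      then show ?case using abs_ge_self[of "S * norm (\<phi> (x - y)) + B * v x"] by simp
    qed
  qed measurable
  have "(LINT x|lborel. norm (u x * \<phi> (x - y))) \<le> S * (LINT x|lborel. norm (\<phi> x)) + B * (LINT x|lborel. v x)" for y
  proof -
    have "(LINT x|lborel. norm (u x * \<phi> (x - y))) \<le> (LINT x|lborel. S * norm (\<phi> (x - y)) + B * v x)"
      using AE by (intro integral_mono_AE integrable_norm i maj) auto
    also have "\<dots> = S * (LINT x|lborel. norm (\<phi> (x - y))) + B * (LINT x|lborel. v x)"
      using \<phi>y v by simp
    also have "(LINT x|lborel. norm (\<phi> (x - y))) = (LINT x|lborel. norm (\<phi> x))"
      using lborel_integral_shift[of "\<lambda>x. norm (\<phi> x)" "- y"] by simp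
    finally show ?thesis .
  qed
  moreover have "S * (LINT x|lborel. norm (\<phi> x)) + B * (LINT x|lborel. v x) \<ge> 0"
    using S B v by (intro add_nonneg_nonneg mult_nonneg_nonneg Bochner_Integration.integral_nonneg) auto
  ultimately show "\<exists>K\<ge>0. \<forall>y. (LINT x|lborel. norm (u x * \<phi> (x - y))) \<le> K"
    by blast
qed

text \<open>Fubini and a translation. \<open>K\<close> depends on \<open>u\<close> and \<phi> but
  not on \<mu>, so symbols with small kernel norm have small pairings; the differentiation in time
  rests on this.\<close>

lemma mult_conv_pairing:
  fixes u \<phi> :: "'a::euclidean_space \<Rightarrow> complex"
  assumes u: "L1_plus_Linf u" and \<phi>: "integrable lborel \<phi>" and b: "\<And>x. norm (\<phi> x) \<le> B"
  shows "\<exists>K\<ge>0. \<forall>\<mu>. integrable lborel \<mu> \<longrightarrow> integrable lborel (\<lambda>x. u x * conv \<mu> \<phi> x) \<and>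
      integrable lborel (\<lambda>z. corr u \<mu> z * \<phi> z) \<and>
      (LINT x|lborel. u x * conv \<mu> \<phi> x) = (LINT z|lborel. corr u \<mu> z * \<phi> z) \<and>
      norm (LINT x|lborel. u x * conv \<mu> \<phi> x) \<le> K * (LINT y|lborel. norm (\<mu> y))"
proof -
  have [measurable]: "u \<in> borel_measurable borel" "\<phi> \<in> borel_measurable borel"
    using u \<phi> unfolding L1_plus_Linf_def by auto
  obtain K where K: "K \<ge> 0" "\<And>y. (LINT x|lborel. norm (u x * \<phi> (x - y))) \<le> K"
    using L1_plus_Linf_bound[OF u \<phi> b] by blast
  note i = L1_plus_Linf_integrable[OF u \<phi> b]
  have main: "integrable lborel (\<lambda>x. u x * conv \<mu> \<phi> x) \<and>
      integrable lborel (\<lambda>z. corr u \<mu> z * \<phi> z) \<and>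
      (LINT x|lborel. u x * conv \<mu> \<phi> x) = (LINT z|lborel. corr u \<mu> z * \<phi> z) \<and>
      norm (LINT x|lborel. u x * conv \<mu> \<phi> x) \<le> K * (LINT y|lborel. norm (\<mu> y))"
    if \<mu>: "integrable lborel \<mu>" for \<mu>
  proof -
    have [measurable]: "\<mu> \<in> borel_measurable borel" using \<mu> by auto
    define Q where "Q y = (LINT x|lborel. norm (u x * \<phi> (x - y)))" for y
    have Qm [measurable]: "Q \<in> borel_measurable borel"
      unfolding Q_def[abs_def] by measurable
    have Q0: "Q y \<ge> 0" for y unfolding Q_def by simp
    have iQ: "integrable lborel (\<lambda>y. norm (\<mu> y) * Q y)"
    proof (rule Bochner_Integration.integrable_bound)
      show "integrable lborel (\<lambda>y. norm (\<mu> y) * K)" using \<mu> by auto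
      show "AE y in lborel. norm (norm (\<mu> y) * Q y) \<le> norm (norm (\<mu> y) * K)"
        using K Q0 by (intro AE_I2) (simp add: abs_mult Q_def mult_left_mono)
    qed measurable
    have int: "integrable (lborel \<Otimes>\<^sub>M lborel) (\<lambda>(y, x). u x * (\<mu> y * \<phi> (x - y)))"
    proof (rule lborel_pair.Fubini_integrable)
      show "(\<lambda>(y, x). u x * (\<mu> y * \<phi> (x - y))) \<in> borel_measurable (lborel \<Otimes>\<^sub>M lborel)"
        by measurable
      have "(LINT x|lborel. norm (u x * (\<mu> y * \<phi> (x - y)))) = norm (\<mu> y) * Q y" for y
        unfolding Q_def integral_mult_right_zero[symmetric] by (simp add: norm_mult mult_ac)
      then show "integrable lborel (\<lambda>y. LINT x|lborel. norm (case (y, x) of (y, x) \<Rightarrow> u x * (\<mu> y * \<phi> (x - y))))"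
        using iQ by simp
      have "integrable lborel (\<lambda>x. \<mu> y * (u x * \<phi> (x - y)))" for y
        by (intro integrable_mult_right i)
      then show "AE y in lborel. integrable lborel (\<lambda>x. case (y, x) of (y, x) \<Rightarrow> u x * (\<mu> y * \<phi> (x - y)))"
        by (simp add: mult.left_commute)
    qed
    have int': "integrable (lborel \<Otimes>\<^sub>M lborel) (\<lambda>(y, z). u (z + y) * \<mu> y * \<phi> z)"
    proof (rule lborel_pair.Fubini_integrable)
      show "(\<lambda>(y, z). u (z + y) * \<mu> y * \<phi> z) \<in> borel_measurable (lborel \<Otimes>\<^sub>M lborel)"
        by measurable
      have "(LINT z|lborel. norm (u (z + y) * \<mu> y * \<phi> z)) = norm (\<mu> y) * Q y" for y
      proof -
        have "Q y = (LINT z|lborel. norm (u (z + y) * \<phi> (z + y - y)))"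
          unfolding Q_def by (rule lborel_integral_shift[symmetric]) measurable
        then show ?thesis
          unfolding integral_mult_right_zero[symmetric] by (simp add: norm_mult mult_ac flip: integral_mult_right_zero)
      qed
      then show "integrable lborel (\<lambda>y. LINT z|lborel. norm (case (y, z) of (y, z) \<Rightarrow> u (z + y) * \<mu> y * \<phi> z))"
        using iQ by simp
      have "integrable lborel (\<lambda>z. \<mu> y * (u (z + y) * \<phi> (z + y - y)))" for y
        by (intro integrable_mult_right lborel_integrable_shift[OF i])
      then show "AE y in lborel. integrable lborel (\<lambda>z. case (y, z) of (y, z) \<Rightarrow> u (z + y) * \<mu> y * \<phi> z)"
        by (simp add: mult_ac)
    qed
    have uc: "u x * conv \<mu> \<phi> x = (LINT y|lborel. u x * (\<mu> y * \<phi> (x - y)))" for x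
      by (simp add: conv_def)
    have 1: "integrable lborel (\<lambda>x. u x * conv \<mu> \<phi> x)"
      unfolding uc using lborel_pair.integrable_snd[OF int] by simp
    have sw: "(LINT x|lborel. u x * conv \<mu> \<phi> x) = (LINT y|lborel. LINT x|lborel. u x * (\<mu> y * \<phi> (x - y)))"
      unfolding uc using lborel_pair.Fubini_integral[OF int] by simp
    also have "\<dots> = (LINT y|lborel. LINT z|lborel. u (z + y) * \<mu> y * \<phi> z)"
    proof (rule Bochner_Integration.integral_cong[OF refl])
      fix y
      have "(LINT x|lborel. u x * (\<mu> y * \<phi> (x - y))) = (LINT z|lborel. u (z + y) * (\<mu> y * \<phi> (z + y - y)))"
        by (rule lborel_integral_shift[symmetric]) measurable
      then show "(LINT x|lborel. u x * (\<mu> y * \<phi> (x - y))) = (LINT z|lborel. u (z + y) * \<mu> y * \<phi> z)"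
        by (simp add: mult.assoc)
    qed
    also have "\<dots> = (LINT z|lborel. LINT y|lborel. u (z + y) * \<mu> y * \<phi> z)"
      using lborel_pair.Fubini_integral[OF int'] by simp
    also have "\<dots> = (LINT z|lborel. corr u \<mu> z * \<phi> z)"
      by (simp add: corr_def)
    finally have 2: "(LINT x|lborel. u x * conv \<mu> \<phi> x) = (LINT z|lborel. corr u \<mu> z * \<phi> z)" .
    have "norm (LINT x|lborel. u x * conv \<mu> \<phi> x) \<le> (LINT y|lborel. norm (\<mu> y) * K)"
      unfolding sw
    proof (rule order_trans[OF integral_norm_bound], rule integral_mono')
      show "integrable lborel (\<lambda>y. norm (\<mu> y) * K)" using \<mu> by auto
      show "norm (LINT x|lborel. u x * (\<mu> y * \<phi> (x - y))) \<le> norm (\<mu> y) * K" for y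
      proof -
        have "(LINT x|lborel. u x * (\<mu> y * \<phi> (x - y))) = \<mu> y * (LINT x|lborel. u x * \<phi> (x - y))"
          unfolding integral_mult_right_zero[symmetric] by (simp add: mult_ac)
        moreover have "norm (LINT x|lborel. u x * \<phi> (x - y)) \<le> K"
          using integral_norm_bound[of lborel "\<lambda>x. u x * \<phi> (x - y)"] K(2)[of y] by linarith
        ultimately show ?thesis by (simp add: norm_mult mult_left_mono)
      qed
    qed (use K in auto)
    then have "norm (LINT x|lborel. u x * conv \<mu> \<phi> x) \<le> K * (LINT y|lborel. norm (\<mu> y))"
      by (simp add: mult.commute)
    moreover have "integrable lborel (\<lambda>z. corr u \<mu> z * \<phi> z)"
      using lborel_pair.integrable_snd[OF int'] by (simp add: corr_def)
    ultimately show ?thesis using 1 2 by blast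
  qed
  then show ?thesis
    using K(1) by blast
qed

section \<open>Lebesgue norms as integrals and essential bounds\<close>

lemma enn2real_one_divide: "p' > 0 \<Longrightarrow> enn2real (1 / ennreal p') = 1 / p'"
  unfolding ennreal_1[symmetric] by (subst divide_ennreal) auto

lemma Lp_space_finite:
  fixes u :: "'a::euclidean_space \<Rightarrow> complex"
  assumes "u \<in> Lp_space (ennreal p)" "p \<ge> 1"
  shows "u \<in> borel_measurable borel" "integrable lborel (\<lambda>x. norm (u x) powr p)"
    "Lp_norm (ennreal p) u = ennreal ((LINT x|lborel. norm (u x) powr p) powr (1 / p))"
proof -
  show [measurable]: "u \<in> borel_measurable borel" using assms by (simp add: Lp_space_def)
  have fin: "(\<integral>\<^sup>+ x. ennreal (norm (u x) powr p) \<partial>lborel) \<noteq> \<infinity>"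
    using assms by (auto simp: Lp_space_def Lp_norm_def Let_def split: if_splits)
  show i: "integrable lborel (\<lambda>x. norm (u x) powr p)"
    using fin by (intro integrableI_bounded) (auto simp: less_top)
  show "Lp_norm (ennreal p) u = ennreal ((LINT x|lborel. norm (u x) powr p) powr (1 / p))"
    using fin assms(2) unfolding Lp_norm_def Let_def
    by (simp add: enn2real_one_divide nn_integral_eq_integral[OF i])
qed

lemma Lp_norm_le_finite:
  fixes g :: "'a::euclidean_space \<Rightarrow> complex"
  assumes q: "q \<ge> 1" and i: "integrable lborel (\<lambda>x. norm (g x) powr q)"
    and le: "(LINT x|lborel. norm (g x) powr q) \<le> V powr q" and V: "V \<ge> 0"
  shows "Lp_norm (ennreal q) g \<le> ennreal V"
proof -
  have "Lp_norm (ennreal q) g = ennreal ((LINT x|lborel. norm (g x) powr q) powr (1 / q))"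
    using q unfolding Lp_norm_def Let_def
    by (simp add: enn2real_one_divide nn_integral_eq_integral[OF i])
  also have "\<dots> \<le> ennreal ((V powr q) powr (1 / q))"
    using le q by (intro ennreal_leI powr_mono2) auto
  also have "(V powr q) powr (1 / q) = V"
    using V q by (simp add: powr_powr)
  finally show ?thesis .
qed

lemma Lp_space_infinity:
  fixes u :: "'a::euclidean_space \<Rightarrow> complex"
  assumes "u \<in> Lp_space \<infinity>"
  shows "u \<in> borel_measurable borel" "\<exists>S\<ge>0. Lp_norm \<infinity> u = ennreal S \<and> (AE x in lborel. norm (u x) \<le> S)"
proof -
  show "u \<in> borel_measurable borel" using assms by (simp add: Lp_space_def)
  have "esssup lborel (\<lambda>x. ennreal (norm (u x))) < \<infinity>"
    using assms by (simp add: Lp_space_def Lp_norm_def)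
  then obtain S where S: "S \<ge> 0" "esssup lborel (\<lambda>x. ennreal (norm (u x))) = ennreal S"
    by (cases "esssup lborel (\<lambda>x. ennreal (norm (u x)))") auto
  have "AE x in lborel. ennreal (norm (u x)) \<le> ennreal S"
    using esssup_AE[of "\<lambda>x. ennreal (norm (u x))" lborel] S by simp
  then have "AE x in lborel. norm (u x) \<le> S"
    using S by simp
  with S show "\<exists>S\<ge>0. Lp_norm \<infinity> u = ennreal S \<and> (AE x in lborel. norm (u x) \<le> S)"
    by (auto simp: Lp_norm_def)
qed

lemma Lp_norm_infinity_le:
  fixes g :: "'a::euclidean_space \<Rightarrow> complex"
  assumes [measurable]: "g \<in> borel_measurable borel" and "\<And>x. norm (g x) \<le> V"
  shows "Lp_norm \<infinity> g \<le> ennreal V"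
  unfolding Lp_norm_def using assms(2) by (auto intro!: esssup_I ennreal_leI)

text \<open>For finite \<open>p\<close> the majorant is 1 + |u|^p, for
  \<open>p = \<infinity>\<close> it is the essential bound.\<close>

lemma Lp_space_L1_plus_Linf:
  fixes u :: "'a::euclidean_space \<Rightarrow> complex"
  assumes u: "u \<in> Lp_space p" and p: "1 \<le> p"
  shows "L1_plus_Linf u"
proof (cases p)
  case (real p')
  then have p': "p' \<ge> 1" using p by (simp add: ennreal_1[symmetric] del: ennreal_1)
  note f = Lp_space_finite[OF u[unfolded real(2)] p']
  have "norm (u x) \<le> 1 + norm (u x) powr p'" for x
  proof (cases "norm (u x) \<le> 1")
    case True
    then show ?thesis by (meson add_increasing2 powr_ge_zero)
  next
    case False
    then have "norm (u x) powr 1 \<le> norm (u x) powr p'" using p' by (intro powr_mono) auto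
    then show ?thesis using False by simp
  qed
  with f show ?thesis
    unfolding L1_plus_Linf_def by (intro conjI exI[of _ 1] exI[of _ "\<lambda>x. norm (u x) powr p'"]) auto
next
  case top
  then have u': "u \<in> Lp_space \<infinity>" using u by simp
  from Lp_space_infinity[OF u'] obtain S where "u \<in> borel_measurable borel" "S \<ge> 0" "AE x in lborel. norm (u x) \<le> S" by blast
  then show ?thesis
    unfolding L1_plus_Linf_def by (intro conjI exI[of _ S] exI[of _ "\<lambda>x. 0"]) auto
qed

section \<open>Young's inequality by interpolation\<close>

text \<open>The convex power lies above its tangent at \<open>l\<close>; derived from the weighted
  inequality between geometric and arithmetic mean.\<close>

lemma tangent_powr:
  fixes p x l :: real
  assumes p: "p \<ge> 1" and x: "x \<ge> 0" and l: "l > 0"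
  shows "p * l powr (p - 1) * x \<le> x powr p + (p - 1) * l powr p"
proof (cases "x = 0")
  case False
  then have x: "x > 0" using x by simp
  have "(x powr p) powr (1 / p) * (l powr p) powr (1 - 1 / p) \<le> 1 / p * x powr p + (1 - 1 / p) * l powr p"
    using p x l by (intro Youngs_inequality_0) (auto simp: field_simps)
  also have "(x powr p) powr (1 / p) * (l powr p) powr (1 - 1 / p) = x * l powr (p - 1)"
    using p x by (simp add: powr_powr right_diff_distrib)
  finally have "p * (x * l powr (p - 1)) \<le> p * (1 / p * x powr p + (1 - 1 / p) * l powr p)"
    using p by (intro mult_left_mono) auto
  also have "\<dots> = x powr p + (p - 1) * l powr p"
    using p by (simp add: field_simps)
  finally show ?thesis by (simp add: mult_ac)
qed (use p in auto)

text \<open>Jensen's inequality for a weight of mass at most \<open>N\<close>: the tangent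
  inequality at \<open>l = A / N\<close> is integrated against \<open>w\<close>.\<close>

lemma weighted_power_mean:
  fixes F w :: "'a::euclidean_space \<Rightarrow> real"
  assumes p: "p \<ge> 1" and F: "\<And>y. F y \<ge> 0" and w: "\<And>y. w y \<ge> 0"
    and [measurable]: "F \<in> borel_measurable borel" and wi: "integrable lborel w" and N: "(LINT y|lborel. w y) \<le> N" "N > 0"
    and Fi: "integrable lborel (\<lambda>y. F y powr p * w y)"
  shows "(LINT y|lborel. F y * w y) powr p \<le> N powr (p - 1) * (LINT y|lborel. F y powr p * w y)"
proof -
  define A where "A = (LINT y|lborel. F y * w y)"
  define J where "J = (LINT y|lborel. F y powr p * w y)"
  have A0: "A \<ge> 0" unfolding A_def using F w by simp
  have J0: "J \<ge> 0" unfolding J_def using w by simp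
  show ?thesis
  proof (cases "A = 0")
    case True
    then show ?thesis using p J0 unfolding A_def J_def by simp
  next
    case False
    then have A: "A > 0" using A0 by simp
    define l where "l = A / N"
    have l: "l > 0" using A N by (simp add: l_def)
    have [measurable]: "w \<in> borel_measurable borel" using wi by auto
    \<comment> \<open>The integral of a non-integrable function is 0 by convention, so
      \<open>A \<noteq> 0\<close> yields integrability.\<close>
    have Fw: "integrable lborel (\<lambda>y. F y * w y)"
      using False not_integrable_integral_eq[of lborel "\<lambda>y. F y * w y"] unfolding A_def by blast
    have "p * l powr (p - 1) * A = (LINT y|lborel. p * l powr (p - 1) * (F y * w y))"
      by (simp add: A_def)
    also have "\<dots> \<le> (LINT y|lborel. F y powr p * w y + (p - 1) * l powr p * w y)"
    proof (rule integral_mono)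
      show "integrable lborel (\<lambda>y. p * l powr (p - 1) * (F y * w y))" using Fw by simp
      show "integrable lborel (\<lambda>y. F y powr p * w y + (p - 1) * l powr p * w y)" using Fi wi by simp
      show "p * l powr (p - 1) * (F y * w y) \<le> F y powr p * w y + (p - 1) * l powr p * w y" for y
        using mult_right_mono[OF tangent_powr[OF p F l] w, of y y] by (simp add: distrib_right mult.assoc)
    qed
    also have "\<dots> = J + (p - 1) * l powr p * (LINT y|lborel. w y)"
      using Fi wi by (simp add: J_def)
    also have "\<dots> \<le> J + (p - 1) * l powr p * N"
      using N p by (intro add_left_mono mult_left_mono) auto
    finally have *: "p * l powr (p - 1) * A \<le> J + (p - 1) * l powr p * N" .
    have e: "l powr p * N = l powr (p - 1) * A"
      using l N A powr_add[of l "p - 1" 1] by (simp add: l_def)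
    have "(p - 1) * l powr p * N = (p - 1) * (l powr (p - 1) * A)"
      by (simp only: mult.assoc e)
    with * have "l powr (p - 1) * A \<le> J"
      by (simp add: algebra_simps)
    then have "A powr (p - 1) * A / N powr (p - 1) \<le> J"
      using A N by (simp add: l_def powr_divide)
    moreover have "A powr (p - 1) * A = A powr p"
      using A powr_add[of A "p - 1" 1] by simp
    ultimately show ?thesis
      using N unfolding A_def J_def by (simp add: field_simps)
  qed
qed

text \<open>Jensen's inequality with weight |\<mu>| reduces everything to the average \<Phi> of
  |u|^p. Bounding |\<mu>| by \<open>B\<close> gives the pointwise estimate, Fubini the integral
  one.\<close>

lemma
  fixes u \<mu> :: "'a::euclidean_space \<Rightarrow> complex"
  assumes p: "p \<ge> 1" and [measurable]: "u \<in> borel_measurable borel" and ui: "integrable lborel (\<lambda>x. norm (u x) powr p)"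
    and \<mu>: "integrable lborel \<mu>" and N: "(LINT y|lborel. norm (\<mu> y)) \<le> N" "N > 0" and B: "\<And>y. norm (\<mu> y) \<le> B"
  defines "I \<equiv> LINT x|lborel. norm (u x) powr p"
  shows corr_pointwise: "norm (corr u \<mu> z) powr p \<le> N powr (p - 1) * (B * I)"
    and corr_powr_integrable: "integrable lborel (\<lambda>z. norm (corr u \<mu> z) powr p)"
    and corr_powr_integral: "(LINT z|lborel. norm (corr u \<mu> z) powr p) \<le> N powr p * I"
proof -
  have [measurable]: "\<mu> \<in> borel_measurable borel" using \<mu> by auto
  have B0: "B \<ge> 0" using B[of 0] norm_ge_zero[of "\<mu> 0"] by linarith
  define \<Phi> where "\<Phi> z = (LINT y|lborel. norm (u (z + y)) powr p * norm (\<mu> y))" for z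
  have ush: "integrable lborel (\<lambda>y. norm (u (z + y)) powr p)" for z
    using lborel_integrable_shift[OF ui, of z] by (simp add: add.commute)
  have sh: "(LINT y|lborel. norm (u (z + y)) powr p) = I" for z
    using lborel_integral_shift[of "\<lambda>x. norm (u x) powr p" z] by (simp add: add.commute I_def)
  have i1: "integrable lborel (\<lambda>y. norm (u (z + y)) powr p * norm (\<mu> y))" for z
  proof (rule Bochner_Integration.integrable_bound)
    show "integrable lborel (\<lambda>y. norm (u (z + y)) powr p * B)" using ush by simp
    show "AE y in lborel. norm (norm (u (z + y)) powr p * norm (\<mu> y)) \<le> norm (norm (u (z + y)) powr p * B)"
      using B B0 by (intro AE_I2) (simp add: abs_mult mult_left_mono)
  qed measurable
  have \<Phi>le: "\<Phi> z \<le> B * I" for z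
  proof -
    have "\<Phi> z \<le> (LINT y|lborel. norm (u (z + y)) powr p * B)"
      unfolding \<Phi>_def using ush B by (intro integral_mono i1 mult_left_mono) auto
    then show ?thesis by (simp add: sh mult.commute)
  qed
  have pt: "norm (corr u \<mu> z) powr p \<le> N powr (p - 1) * \<Phi> z" for z
  proof -
    have "norm (corr u \<mu> z) \<le> (LINT y|lborel. norm (u (z + y)) * norm (\<mu> y))"
      unfolding corr_def by (rule order_trans[OF integral_norm_bound]) (simp add: norm_mult)
    then have "norm (corr u \<mu> z) powr p \<le> (LINT y|lborel. norm (u (z + y)) * norm (\<mu> y)) powr p"
      using p by (intro powr_mono2) auto
    also have "\<dots> \<le> N powr (p - 1) * \<Phi> z"
      unfolding \<Phi>_def using \<mu> N by (intro weighted_power_mean[OF p] i1) auto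
    finally show ?thesis .
  qed
  show "norm (corr u \<mu> z) powr p \<le> N powr (p - 1) * (B * I)"
    by (rule order_trans[OF pt mult_left_mono[OF \<Phi>le]]) simp
  have int: "integrable (lborel \<Otimes>\<^sub>M lborel) (\<lambda>(y, z). norm (u (z + y)) powr p * norm (\<mu> y))"
  proof (rule lborel_pair.Fubini_integrable)
    show "(\<lambda>(y, z). norm (u (z + y)) powr p * norm (\<mu> y)) \<in> borel_measurable (lborel \<Otimes>\<^sub>M lborel)"
      by measurable
    have "(LINT z|lborel. norm (u (z + y)) powr p) = I" for y
      using sh[of y] by (simp add: add.commute)
    then show "integrable lborel (\<lambda>y. LINT z|lborel. norm (case (y, z) of (y, z) \<Rightarrow> norm (u (z + y)) powr p * norm (\<mu> y)))"
      using \<mu> by simp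
    show "AE y in lborel. integrable lborel (\<lambda>z. case (y, z) of (y, z) \<Rightarrow> norm (u (z + y)) powr p * norm (\<mu> y))"
      using lborel_integrable_shift[OF ui] by simp
  qed
  have i\<Phi>: "integrable lborel \<Phi>"
    unfolding \<Phi>_def[abs_def] using lborel_pair.integrable_snd[OF int] by simp
  have "(LINT z|lborel. \<Phi> z) = (LINT y|lborel. LINT z|lborel. norm (u (z + y)) powr p * norm (\<mu> y))"
    unfolding \<Phi>_def using lborel_pair.Fubini_integral[OF int] by simp
  also have "\<dots> = (LINT y|lborel. I * norm (\<mu> y))"
    using sh by (simp add: add.commute)
  also have "\<dots> \<le> I * N"
    using N by (simp add: mult_left_mono I_def)
  finally have \<Phi>I: "(LINT z|lborel. \<Phi> z) \<le> I * N" .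
  show ip: "integrable lborel (\<lambda>z. norm (corr u \<mu> z) powr p)"
  proof (rule Bochner_Integration.integrable_bound)
    show "integrable lborel (\<lambda>z. N powr (p - 1) * \<Phi> z)" using i\<Phi> by simp
    show "AE z in lborel. norm (norm (corr u \<mu> z) powr p) \<le> norm (N powr (p - 1) * \<Phi> z)"
      using pt by (intro AE_I2) (smt (verit) powr_ge_zero real_norm_def)
  qed measurable
  have "(LINT z|lborel. norm (corr u \<mu> z) powr p) \<le> (LINT z|lborel. N powr (p - 1) * \<Phi> z)"
    using i\<Phi> by (intro integral_mono ip pt) auto
  also have "\<dots> \<le> N powr (p - 1) * (I * N)"
    using \<Phi>I by (simp add: mult_left_mono)
  also have "\<dots> = N powr p * I"
    using N powr_add[of N "p - 1" 1] by simp
  finally show "(LINT z|lborel. norm (corr u \<mu> z) powr p) \<le> N powr p * I" .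
qed

text \<open>For finite \<open>p\<close>, the preceding bounds are the cases q = \<infinity> and q =
  p. With \<open>V\<close> the pointwise bound of the correlation g, they are joined by |g|^q \<le>
  V^(q - p) |g|^p.\<close>

lemma Lp_norm_corr_le:
  fixes u \<mu> :: "'a::euclidean_space \<Rightarrow> complex" and p q :: ennreal
  assumes p: "1 \<le> p" and pq: "p \<le> q" and u: "u \<in> Lp_space p"
    and \<mu>: "integrable lborel \<mu>" and N: "(LINT y|lborel. norm (\<mu> y)) \<le> N" "N > 0"
    and B: "\<And>y. norm (\<mu> y) \<le> B" "B > 0"
  defines "\<theta> \<equiv> enn2real (1 / p) - enn2real (1 / q)"
  shows "Lp_norm q (corr u \<mu>) \<le> ennreal (N powr (1 - \<theta>) * B powr \<theta>) * Lp_norm p u"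
proof (cases p)
  case top
  then have q: "q = \<infinity>" using pq by (simp add: top_unique)
  have u': "u \<in> Lp_space \<infinity>" using u top by simp
  from Lp_space_infinity[OF u'] obtain S where [measurable]: "u \<in> borel_measurable borel"
    and S: "S \<ge> 0" "Lp_norm \<infinity> u = ennreal S" "AE x in lborel. norm (u x) \<le> S" by blast
  have [measurable]: "\<mu> \<in> borel_measurable borel" using \<mu> by auto
  have "norm (corr u \<mu> z) \<le> N * S" for z
  proof -
    have le: "AE y in lborel. norm (u (z + y) * \<mu> y) \<le> S * norm (\<mu> y)"
      using AE_lborel_shift[OF S(3), of z] by eventually_elim (simp add: norm_mult mult_right_mono)
    have i: "integrable lborel (\<lambda>y. u (z + y) * \<mu> y)"
      by (rule Bochner_Integration.integrable_bound[of _ "\<lambda>y. S * norm (\<mu> y)"])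
         (use \<mu> le S in \<open>auto simp: abs_mult\<close>)
    have "norm (corr u \<mu> z) \<le> (LINT y|lborel. norm (u (z + y) * \<mu> y))"
      unfolding corr_def by (rule integral_norm_bound)
    also have "\<dots> \<le> (LINT y|lborel. S * norm (\<mu> y))"
      using \<mu> le i by (intro integral_mono_AE) auto
    also have "\<dots> \<le> N * S" using N S by (simp add: mult.commute[of N] mult_left_mono)
    finally show ?thesis .
  qed
  then have "Lp_norm \<infinity> (corr u \<mu>) \<le> ennreal (N * S)"
    by (intro Lp_norm_infinity_le) auto
  then show ?thesis
    using S N B q top by (simp add: \<theta>_def ennreal_mult'')
next
  case (real p')
  then have p': "p' \<ge> 1" using p by (simp add: ennreal_1[symmetric] del: ennreal_1)
  note f = Lp_space_finite[OF u[unfolded real(2)] p']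
  have [measurable]: "u \<in> borel_measurable borel" "\<mu> \<in> borel_measurable borel" using f \<mu> by auto
  define I where "I = (LINT x|lborel. norm (u x) powr p')"
  have I0: "I \<ge> 0" by (simp add: I_def)
  have ep: "enn2real (1 / p) = 1 / p'" using p' real by (simp add: enn2real_one_divide)
  note c = corr_pointwise[OF p' f(1,2) \<mu> N B(1), folded I_def]
    corr_powr_integrable[OF p' f(1,2) \<mu> N B(1)]
    corr_powr_integral[OF p' f(1,2) \<mu> N B(1), folded I_def]
  have nu: "Lp_norm p u = ennreal (I powr (1 / p'))"
    using f(3) by (simp add: real I_def)
  define V where "V = N powr (1 - 1 / p') * B powr (1 / p') * I powr (1 / p')"
  have V0: "V \<ge> 0" by (simp add: V_def)
  have ptV: "norm (corr u \<mu> z) \<le> V" for z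
  proof -
    have "(norm (corr u \<mu> z) powr p') powr (1 / p') \<le> (N powr (p' - 1) * (B * I)) powr (1 / p')"
      using c(1) p' by (intro powr_mono2) auto
    also have "(norm (corr u \<mu> z) powr p') powr (1 / p') = norm (corr u \<mu> z)"
      using p' by (simp add: powr_powr)
    also have "(N powr (p' - 1) * (B * I)) powr (1 / p') = V"
    proof -
      have "(p' - 1) * (1 / p') = 1 - 1 / p'" using p' by (simp add: field_simps)
      then show ?thesis
        using N B I0 by (simp add: V_def powr_mult powr_powr mult.assoc)
    qed
    finally show ?thesis .
  qed
  show ?thesis
  proof (cases q)
    case top
    have "Lp_norm \<infinity> (corr u \<mu>) \<le> ennreal V"
      by (intro Lp_norm_infinity_le ptV) auto
    then show ?thesis
      using top by (simp add: \<theta>_def ep nu V_def ennreal_mult'')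
  next
    case q: (real q')
    have pq': "p' \<le> q'" using pq q real by simp
    have eq: "enn2real (1 / q) = 1 / q'" using p' pq' q by (simp add: enn2real_one_divide)
    have split: "norm (corr u \<mu> z) powr q' \<le> V powr (q' - p') * norm (corr u \<mu> z) powr p'" for z
    proof -
      have "norm (corr u \<mu> z) powr q' = norm (corr u \<mu> z) powr (q' - p') * norm (corr u \<mu> z) powr p'"
        unfolding powr_add[symmetric] by simp
      also have "\<dots> \<le> V powr (q' - p') * norm (corr u \<mu> z) powr p'"
        using ptV pq' by (intro mult_right_mono powr_mono2) auto
      finally show ?thesis .
    qed
    have iq: "integrable lborel (\<lambda>z. norm (corr u \<mu> z) powr q')"
    proof (rule Bochner_Integration.integrable_bound)
      show "integrable lborel (\<lambda>z. V powr (q' - p') * norm (corr u \<mu> z) powr p')" using c(2) by simp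
      show "AE z in lborel. norm (norm (corr u \<mu> z) powr q') \<le> norm (V powr (q' - p') * norm (corr u \<mu> z) powr p')"
        using split by (intro AE_I2) (smt (verit) powr_ge_zero real_norm_def)
    qed measurable
    have "(LINT z|lborel. norm (corr u \<mu> z) powr q') \<le> (LINT z|lborel. V powr (q' - p') * norm (corr u \<mu> z) powr p')"
      using c(2) by (intro integral_mono iq split) auto
    also have "\<dots> \<le> V powr (q' - p') * (N powr p' * I)"
      using c(3) by (simp add: mult_left_mono)
    finally have le: "(LINT z|lborel. norm (corr u \<mu> z) powr q') \<le> V powr (q' - p') * (N powr p' * I)" .
    define W where "W = N powr (1 - \<theta>) * B powr \<theta> * I powr (1 / p')"
    have "V powr (q' - p') * (N powr p' * I) = W powr q'"
    proof (cases "I = 0")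
      case True
      then show ?thesis by (simp add: W_def)
    next
      case False
      then have I: "I > 0" using I0 by simp
      \<comment> \<open>The three identities match the exponents of \<open>N\<close>,
        \<open>B\<close> and \<open>I\<close> with those in \<open>W powr q'\<close>.\<close>
      have e1: "(1 - 1 / p') * (q' - p') + p' = (1 - \<theta>) * q'"
        using p' pq' by (simp add: \<theta>_def ep eq field_simps)
      have e2: "(1 / p') * (q' - p') = \<theta> * q'"
        using p' pq' by (simp add: \<theta>_def ep eq field_simps)
      have e3: "\<theta> * q' + 1 = (1 / p') * q'"
        using p' pq' by (simp add: \<theta>_def ep eq field_simps)
      have "V powr (q' - p') * (N powr p' * I) =
          (N powr ((1 - 1 / p') * (q' - p')) * N powr p') * B powr ((1 / p') * (q' - p')) * (I powr ((1 / p') * (q' - p')) * I powr 1)"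
        using N B I by (simp add: V_def powr_mult powr_powr mult_ac)
      also have "\<dots> = W powr q'"
        unfolding powr_add[symmetric] e1 e2 e3 using N B I by (simp add: W_def powr_mult powr_powr)
      finally show ?thesis .
    qed
    with le have "Lp_norm (ennreal q') (corr u \<mu>) \<le> ennreal W"
      using p' pq' by (intro Lp_norm_le_finite iq) (auto simp: W_def)
    then show ?thesis
      by (simp add: q nu W_def ennreal_mult'')
  qed
qed

text \<open>The 4 is 2 times 2: one factor from (x + y)^q \<le> 2^q (x^q + y^q), the other from 2
  \<le> 2^q. It ends up in the constant of the theorem.\<close>

lemma Lp_norm_add_le:
  fixes f g :: "'a::euclidean_space \<Rightarrow> complex" and q :: ennreal
  assumes q: "1 \<le> q" and [measurable]: "f \<in> borel_measurable borel" "g \<in> borel_measurable borel"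
    and V: "Lp_norm q f \<le> ennreal V" "Lp_norm q g \<le> ennreal V'" "V \<ge> 0" "V' \<ge> 0"
  shows "Lp_norm q (\<lambda>x. f x + g x) \<le> ennreal (4 * (V + V'))"
proof (cases q)
  case top
  have f: "AE x in lborel. norm (f x) \<le> V"
    using esssup_AE[of "\<lambda>x. ennreal (norm (f x))" lborel] V top
    by (auto simp: Lp_norm_def elim!: eventually_mono dest: order_trans)
  have g: "AE x in lborel. norm (g x) \<le> V'"
    using esssup_AE[of "\<lambda>x. ennreal (norm (g x))" lborel] V top
    by (auto simp: Lp_norm_def elim!: eventually_mono dest: order_trans)
  from f g have "AE x in lborel. ennreal (norm (f x + g x)) \<le> ennreal (4 * (V + V'))"
  proof eventually_elim
    case (elim x)
    have "norm (f x + g x) \<le> V + V'" using elim norm_triangle_ineq[of "f x" "g x"] by linarith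
    then show ?case using V(3,4) by (intro ennreal_leI) argo
  qed
  then show ?thesis unfolding Lp_norm_def using top by (auto intro!: esssup_I)
next
  case (real q')
  then have q': "q' \<ge> 1" using q by (simp add: ennreal_1[symmetric] del: ennreal_1)
  have "f \<in> Lp_space (ennreal q')" "g \<in> Lp_space (ennreal q')"
    using V real by (auto simp: Lp_space_def intro: le_less_trans)
  note F = Lp_space_finite[OF this(1) q'] and G = Lp_space_finite[OF this(2) q']
  define I where "I = (LINT x|lborel. norm (f x) powr q')"
  define J where "J = (LINT x|lborel. norm (g x) powr q')"
  have IJ: "I \<ge> 0" "J \<ge> 0" by (auto simp: I_def J_def)
  have VI: "I \<le> V powr q'"
  proof -
    have "I powr (1 / q') \<le> V" using V F(3) real by (simp add: I_def)
    then have "(I powr (1 / q')) powr q' \<le> V powr q'" using q' by (intro powr_mono2) auto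
    then show ?thesis using q' IJ by (simp add: powr_powr)
  qed
  have VJ: "J \<le> V' powr q'"
  proof -
    have "J powr (1 / q') \<le> V'" using V G(3) real by (simp add: J_def)
    then have "(J powr (1 / q')) powr q' \<le> V' powr q'" using q' by (intro powr_mono2) auto
    then show ?thesis using q' IJ by (simp add: powr_powr)
  qed
  have pt: "norm (f x + g x) powr q' \<le> 2 powr q' * (norm (f x) powr q' + norm (g x) powr q')" for x
  proof -
    have "norm (f x + g x) powr q' \<le> (2 * max (norm (f x)) (norm (g x))) powr q'"
      using norm_triangle_ineq[of "f x" "g x"] q' by (intro powr_mono2) auto
    also have "\<dots> = 2 powr q' * max (norm (f x)) (norm (g x)) powr q'"
      by (simp add: powr_mult)
    also have "\<dots> \<le> 2 powr q' * (norm (f x) powr q' + norm (g x) powr q')"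
      by (intro mult_left_mono) (auto simp: max_def)
    finally show ?thesis .
  qed
  have i: "integrable lborel (\<lambda>x. norm (f x + g x) powr q')"
  proof (rule Bochner_Integration.integrable_bound)
    show "integrable lborel (\<lambda>x. 2 powr q' * (norm (f x) powr q' + norm (g x) powr q'))" using F G by simp
    show "AE x in lborel. norm (norm (f x + g x) powr q') \<le> norm (2 powr q' * (norm (f x) powr q' + norm (g x) powr q'))"
      using pt by (intro AE_I2) (smt (verit) powr_ge_zero real_norm_def)
  qed measurable
  have "(LINT x|lborel. norm (f x + g x) powr q') \<le> (LINT x|lborel. 2 powr q' * (norm (f x) powr q' + norm (g x) powr q'))"
    using F G by (intro integral_mono i pt) auto
  also have "\<dots> = 2 powr q' * (I + J)" using F G by (simp add: I_def J_def)
  also have "\<dots> \<le> 2 powr q' * (2 * (V + V') powr q')"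
  proof (intro mult_left_mono)
    have "V powr q' \<le> (V + V') powr q'" "V' powr q' \<le> (V + V') powr q'"
      using V q' by (auto intro!: powr_mono2)
    then show "I + J \<le> 2 * (V + V') powr q'" using VI VJ by linarith
  qed simp
  also have "\<dots> \<le> 2 powr q' * (2 powr q' * (V + V') powr q')"
    using q' powr_mono[of 1 q' 2] by (intro mult_left_mono mult_right_mono) auto
  also have "\<dots> = (4 * (V + V')) powr q'"
  proof -
    have "(4 * (V + V')) powr q' = 4 powr q' * (V + V') powr q'"
      by (rule powr_mult)
    moreover have "(4::real) powr q' = 2 powr q' * 2 powr q'"
      using powr_mult[of 2 2 q'] by simp
    ultimately show ?thesis by simp
  qed
  finally have "(LINT x|lborel. norm (f x + g x) powr q') \<le> (4 * (V + V')) powr q'" .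
  then show ?thesis
    unfolding real using V by (intro Lp_norm_le_finite[OF q' i]) auto
qed


section \<open>The difference of the solutions\<close>

lemma wiener_mult_inv_fourier_integrable:
  fixes m \<phi> :: "'a::euclidean_space \<Rightarrow> complex"
  assumes m: "wiener N m" and \<phi>: "invertible \<phi>"
  shows "integrable lborel (\<lambda>\<xi>. m \<xi> * inv_fourier \<phi> \<xi>)"
proof -
  obtain \<mu> where \<mu>: "integrable lborel \<mu>" "m = ft \<mu>"
    using m unfolding wiener_def by blast
  have i: "integrable lborel (inv_fourier \<phi>)"
    using \<phi> unfolding invertible_def inv_fourier_eq_ft[abs_def] by simp
  have [measurable]: "m \<in> borel_measurable borel"
    unfolding \<mu>(2) using \<mu>(1) by auto
  have [measurable]: "inv_fourier \<phi> \<in> borel_measurable borel"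
    using i by auto
  show ?thesis
  proof (rule Bochner_Integration.integrable_bound)
    show "integrable lborel (\<lambda>\<xi>. (LINT y|lborel. norm (\<mu> y)) * norm (inv_fourier \<phi> \<xi>))"
      using i by simp
    show "AE \<xi> in lborel. norm (m \<xi> * inv_fourier \<phi> \<xi>) \<le> norm ((LINT y|lborel. norm (\<mu> y)) * norm (inv_fourier \<phi> \<xi>))"
      unfolding \<mu>(2) by (intro AE_I2) (simp add: norm_mult mult_right_mono norm_ft_le)
  qed measurable
qed

text \<open>The value of \<open>fourier_multiplier m (dist_of u)\<close> at \<phi>, arranged so that
  linearity in \<open>u\<close> and in \<open>m\<close> can be stated.\<close>

definition pairing :: "('a::euclidean_space \<Rightarrow> complex) \<Rightarrow> ('a \<Rightarrow> complex) \<Rightarrow> ('a \<Rightarrow> complex) \<Rightarrow> complex" where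
  "pairing u m \<phi> = dist_of u (fourier (\<lambda>\<xi>. m \<xi> * inv_fourier \<phi> \<xi>))"

lemma pairing_cmult: "pairing u (\<lambda>\<xi>. c * m \<xi>) \<phi> = c * pairing u m \<phi>"
proof -
  have "fourier (\<lambda>\<xi>. c * m \<xi> * inv_fourier \<phi> \<xi>) = (\<lambda>x. c * fourier (\<lambda>\<xi>. m \<xi> * inv_fourier \<phi> \<xi>) x)"
    unfolding fourier_eq_ft[abs_def] mult.assoc ft_cmult ..
  then show ?thesis
    by (simp add: pairing_def dist_of_def mult.left_commute[of _ c])
qed

text \<open>The inner transform is a convolution with the kernel of \<open>m\<close>, by
  \<open>fourier_multiplier_kernel\<close>; the bound is linear in \<open>N\<close> and uniform in
  the symbol.\<close>

lemma pairing_bounds: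
  fixes u \<phi> :: "'a::euclidean_space \<Rightarrow> complex"
  assumes u: "L1_plus_Linf u" and \<phi>: "invertible \<phi>"
  shows "\<exists>K\<ge>0. \<forall>N m. wiener N m \<longrightarrow>
      integrable lborel (\<lambda>x. u x * fourier (\<lambda>\<xi>. m \<xi> * inv_fourier \<phi> \<xi>) x) \<and> norm (pairing u m \<phi>) \<le> K * N"
proof -
  from \<phi> obtain B where \<phi>i: "integrable lborel \<phi>" and B: "\<And>x. norm (\<phi> x) \<le> B"
    unfolding invertible_def by auto
  obtain K where K: "K \<ge> 0" and main: "\<And>\<mu>. integrable lborel \<mu> \<Longrightarrow> integrable lborel (\<lambda>x. u x * conv \<mu> \<phi> x) \<and>
      norm (LINT x|lborel. u x * conv \<mu> \<phi> x) \<le> K * (LINT y|lborel. norm (\<mu> y))"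
    using mult_conv_pairing[OF u \<phi>i B] by blast
  show ?thesis
  proof (intro exI[of _ K] conjI allI impI K)
    fix N and m :: "'a \<Rightarrow> complex" assume "wiener N m"
    then obtain \<mu> where \<mu>: "integrable lborel \<mu>" "(LINT y|lborel. norm (\<mu> y)) \<le> N" "m = ft \<mu>"
      unfolding wiener_def by blast
    have f: "fourier (\<lambda>\<xi>. m \<xi> * inv_fourier \<phi> \<xi>) = conv \<mu> \<phi>"
      unfolding \<mu>(3) using fourier_multiplier_kernel(1)[OF \<mu>(1) \<phi>] by blast
    show "integrable lborel (\<lambda>x. u x * fourier (\<lambda>\<xi>. m \<xi> * inv_fourier \<phi> \<xi>) x)"
      unfolding f using main[OF \<mu>(1)] by blast
    have "norm (pairing u m \<phi>) \<le> K * (LINT y|lborel. norm (\<mu> y))"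
      unfolding pairing_def dist_of_def f using main[OF \<mu>(1)] by blast
    also have "\<dots> \<le> K * N" using \<mu> K by (simp add: mult_left_mono)
    finally show "norm (pairing u m \<phi>) \<le> K * N" .
  qed
qed

lemma pairing_integrable:
  assumes "L1_plus_Linf u" "invertible \<phi>" "wiener N m"
  shows "integrable lborel (\<lambda>x. u x * fourier (\<lambda>\<xi>. m \<xi> * inv_fourier \<phi> \<xi>) x)"
  using pairing_bounds[OF assms(1,2)] assms(3) by blast

lemma pairing_add:
  assumes u: "L1_plus_Linf u" and \<phi>: "invertible \<phi>" and m: "wiener N m" "wiener N' m'"
  shows "pairing u (\<lambda>\<xi>. m \<xi> + m' \<xi>) \<phi> = pairing u m \<phi> + pairing u m' \<phi>"
proof -
  have "fourier (\<lambda>\<xi>. (m \<xi> + m' \<xi>) * inv_fourier \<phi> \<xi>) x =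
      fourier (\<lambda>\<xi>. m \<xi> * inv_fourier \<phi> \<xi>) x + fourier (\<lambda>\<xi>. m' \<xi> * inv_fourier \<phi> \<xi>) x" for x
    unfolding fourier_eq_ft distrib_right
    by (intro ft_add wiener_mult_inv_fourier_integrable[OF m(1) \<phi>] wiener_mult_inv_fourier_integrable[OF m(2) \<phi>])
  then show ?thesis
    unfolding pairing_def dist_of_def
    using pairing_integrable[OF u \<phi> m(1)] pairing_integrable[OF u \<phi> m(2)] by (simp add: distrib_left)
qed

lemma pairing_add_left:
  assumes u: "L1_plus_Linf u" "L1_plus_Linf v" and \<phi>: "invertible \<phi>" and m: "wiener N m"
  shows "pairing (\<lambda>x. u x + v x) m \<phi> = pairing u m \<phi> + pairing v m \<phi>"
  unfolding pairing_def dist_of_def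
  using pairing_integrable[OF u(1) \<phi> m] pairing_integrable[OF u(2) \<phi> m] by (simp add: distrib_right)

text \<open>Needed because \<open>abs_D a\<close> reaches the test function before the cut-off does.
  In the decomposition of |\<xi>|^a the factor |\<xi>|^(2k) is absorbed by replacing \<phi> with
  \<psi>, a power of minus the Laplacian of \<phi>; then both summands are transforms of
  convolutions.\<close>

lemma inv_fourier_fourier_pw:
  fixes \<phi> :: "'a::euclidean_space \<Rightarrow> complex"
  assumes \<phi>: "\<And>k. rapid k \<phi>" and a: "a \<ge> 0"
  shows "inv_fourier (fourier (\<lambda>\<xi>. of_real (pw a \<xi>) * inv_fourier \<phi> \<xi>)) = (\<lambda>\<xi>. of_real (pw a \<xi>) * inv_fourier \<phi> \<xi>)"
proof (cases "a = 0")
  case True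
  have "invertible \<phi>" by (rule rapid_invertible[OF \<phi>])
  then have "fourier (inv_fourier \<phi>) = \<phi>" by (rule fourier_inv_fourier)
  then show ?thesis using True by (simp add: pw_def)
next
  case False
  then have a: "a > 0" using a by simp
  obtain k N N' m m' where m: "wiener N m" "wiener N' m'"
    and eq: "\<And>\<xi>::'a. of_real (norm \<xi> powr a) = m \<xi> + of_real (norm \<xi> ^ (2 * k)) * m' \<xi>"
    using norm_powr_decomposition[OF a, where 'a='a] by blast
  obtain \<psi> where \<psi>: "rapid (2 * DIM('a)) \<psi>" "\<And>\<xi>. ft \<psi> \<xi> = of_real (norm \<xi> ^ (2 * k)) * ft \<phi> \<xi>"
    using rapid_ft_norm[OF \<phi>, where m=k and k="2 * DIM('a)"] by blast
  have i\<phi>: "invertible \<phi>" "invertible \<psi>"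
    by (rule rapid_invertible[OF \<phi>], rule rapid_invertible[OF \<psi>(1)])
  have e: "of_real (pw a \<xi>) * inv_fourier \<phi> \<xi> = m \<xi> * inv_fourier \<phi> \<xi> + m' \<xi> * inv_fourier \<psi> \<xi>" for \<xi>
    unfolding pw_pos[OF a] eq by (simp add: inv_fourier_eq_ft \<psi>(2) algebra_simps add_divide_distrib)
  obtain \<mu> \<nu> where \<mu>: "integrable lborel \<mu>" "m = ft \<mu>" and \<nu>: "integrable lborel \<nu>" "m' = ft \<nu>"
    using m unfolding wiener_def by blast
  have ii: "integrable lborel \<phi>" "integrable lborel \<psi>"
    using i\<phi> unfolding invertible_def by auto
  have "fourier (\<lambda>\<xi>. of_real (pw a \<xi>) * inv_fourier \<phi> \<xi>) x = conv \<mu> \<phi> x + conv \<nu> \<psi> x" for x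
  proof -
    have "fourier (\<lambda>\<xi>. of_real (pw a \<xi>) * inv_fourier \<phi> \<xi>) x =
        fourier (\<lambda>\<xi>. m \<xi> * inv_fourier \<phi> \<xi>) x + fourier (\<lambda>\<xi>. m' \<xi> * inv_fourier \<psi> \<xi>) x"
      unfolding e fourier_eq_ft
      by (intro ft_add wiener_mult_inv_fourier_integrable[OF m(1) i\<phi>(1)] wiener_mult_inv_fourier_integrable[OF m(2) i\<phi>(2)])
    then show ?thesis
      unfolding \<mu>(2) \<nu>(2) fourier_multiplier_kernel(1)[OF \<mu>(1) i\<phi>(1)] fourier_multiplier_kernel(1)[OF \<nu>(1) i\<phi>(2)] .
  qed
  then have F: "fourier (\<lambda>\<xi>. of_real (pw a \<xi>) * inv_fourier \<phi> \<xi>) = (\<lambda>x. conv \<mu> \<phi> x + conv \<nu> \<psi> x)"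
    by blast
  have "inv_fourier (\<lambda>x. conv \<mu> \<phi> x + conv \<nu> \<psi> x) \<xi> = inv_fourier (conv \<mu> \<phi>) \<xi> + inv_fourier (conv \<nu> \<psi>) \<xi>" for \<xi>
    unfolding inv_fourier_eq_ft
    by (subst ft_add[OF integrable_conv[OF \<mu>(1) ii(1)] integrable_conv[OF \<nu>(1) ii(2)]]) (simp add: add_divide_distrib)
  then have "inv_fourier (\<lambda>x. conv \<mu> \<phi> x + conv \<nu> \<psi> x) \<xi> = m \<xi> * inv_fourier \<phi> \<xi> + m' \<xi> * inv_fourier \<psi> \<xi>" for \<xi>
    unfolding fourier_multiplier_kernel(2)[OF \<mu>(1) i\<phi>(1)] fourier_multiplier_kernel(2)[OF \<nu>(1) i\<phi>(2)] \<mu>(2) \<nu>(2) .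
  then show ?thesis
    unfolding F unfolding e by blast
qed

lemma inv_fourier_fourier_wiener:
  assumes m: "wiener N m" and \<phi>: "invertible \<phi>"
  shows "inv_fourier (fourier (\<lambda>\<xi>. m \<xi> * inv_fourier \<phi> \<xi>)) = (\<lambda>\<xi>. m \<xi> * inv_fourier \<phi> \<xi>)"
proof -
  obtain \<mu> where \<mu>: "integrable lborel \<mu>" "m = ft \<mu>"
    using m unfolding wiener_def by blast
  have f: "fourier (\<lambda>\<xi>. m \<xi> * inv_fourier \<phi> \<xi>) = conv \<mu> \<phi>"
    unfolding \<mu>(2) using fourier_multiplier_kernel(1)[OF \<mu>(1) \<phi>] by blast
  show ?thesis
    unfolding f unfolding \<mu>(2) using fourier_multiplier_kernel(2)[OF \<mu>(1) \<phi>] by blast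
qed

lemma fourier_multiplier_apply:
  "fourier_multiplier m T \<phi> = T (fourier (\<lambda>\<xi>. m \<xi> * inv_fourier \<phi> \<xi>))"
  by (simp add: fourier_multiplier_def dist_inv_fourier_def dist_mult_def dist_fourier_def)

lemma symb0_du0: "symb0 \<sigma> s \<xi> = exp (- s * norm \<xi> powr (2 * \<sigma>)) + du0 \<sigma> 0 s \<xi>"
  by (simp add: symb0_eq du0_def Let_def)

lemma symb1_du1: "symb1 \<sigma> s \<xi> = exp (- s * norm \<xi> powr (2 * \<sigma>)) + du1 \<sigma> 0 s \<xi>"
  by (simp add: symb1_eq symb0_du0 du1_def)

text \<open>By transposition the operators reach the test function from the outside in: |D|^a gives
  \<Phi>, the cut-off then gives \<Psi>. Each further \<open>inv_fourier\<close> cancels the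
  preceding \<open>fourier\<close>, so the symbols multiply, and the heat part \<open>E\<close>
  drops out because \<open>v\<close> starts from the sum of the data.\<close>

lemma difference_eq_pairing:
  fixes chi :: "'a::euclidean_space \<Rightarrow> real"
  assumes chi: "radial_cutoff chi" and a: "a \<ge> 0" and \<sigma>: "\<sigma> > 0" and s: "s \<ge> 1"
    and u: "L1_plus_Linf u0" "L1_plus_Linf u1" and \<phi>: "schwartz \<phi>"
  shows "abs_D a (dist_diff (low chi (sol_u \<sigma> u0 u1 s)) (low chi (sol_v \<sigma> (\<lambda>x. u0 x + u1 x) s))) \<phi> =
    pairing u0 (\<lambda>\<xi>. of_real (chi \<xi> * pw a \<xi> * du0 \<sigma> 0 s \<xi>)) \<phi> +
    pairing u1 (\<lambda>\<xi>. of_real (chi \<xi> * pw a \<xi> * du1 \<sigma> 0 s \<xi>)) \<phi>"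
proof -
  have r: "rapid k \<phi>" for k using \<phi> by (rule schwartz_rapid)
  have i\<phi>: "invertible \<phi>" by (rule rapid_invertible[OF r])
  define c where "c \<xi> = chi \<xi> * pw a \<xi>" for \<xi>
  define E where "E \<xi> = complex_of_real (c \<xi> * exp (- s * norm \<xi> powr (2 * \<sigma>)))" for \<xi>
  define M0 where "M0 \<xi> = complex_of_real (c \<xi> * du0 \<sigma> 0 s \<xi>)" for \<xi>
  define M1 where "M1 \<xi> = complex_of_real (c \<xi> * du1 \<sigma> 0 s \<xi>)" for \<xi>
  obtain Nc where wc: "wiener Nc (\<lambda>\<xi>. complex_of_real (c \<xi>))"
    using cutoff_pw_wiener[OF chi a] wiener_bdd_imp_wiener unfolding c_def by blast
  obtain NE where wE: "wiener NE E"
    using wiener_cutoff_exp[OF chi a \<sigma>, of s] s unfolding E_def[abs_def] c_def by auto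
  obtain N0 where w0: "wiener N0 M0"
    using wiener_bdd_du(1)[OF chi a \<sigma>, of 0] s wiener_bdd_imp_wiener unfolding M0_def[abs_def] c_def by blast
  obtain N1 where w1: "wiener N1 M1"
    using wiener_bdd_du(2)[OF chi a \<sigma>, of 0] s wiener_bdd_imp_wiener unfolding M1_def[abs_def] c_def by blast
  define \<Phi> where "\<Phi> = fourier (\<lambda>\<xi>. of_real (pw a \<xi>) * inv_fourier \<phi> \<xi>)"
  have \<Phi>: "inv_fourier \<Phi> = (\<lambda>\<xi>. of_real (pw a \<xi>) * inv_fourier \<phi> \<xi>)"
    unfolding \<Phi>_def by (rule inv_fourier_fourier_pw[OF r a])
  define \<Psi> where "\<Psi> = fourier (\<lambda>\<xi>. of_real (c \<xi>) * inv_fourier \<phi> \<xi>)"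
  have \<Psi>: "inv_fourier \<Psi> = (\<lambda>\<xi>. of_real (c \<xi>) * inv_fourier \<phi> \<xi>)"
    unfolding \<Psi>_def by (rule inv_fourier_fourier_wiener[OF wc i\<phi>])
  have A: "abs_D a T \<phi> = T \<Phi>" for T
    unfolding abs_D_def fourier_multiplier_apply \<Phi>_def pw_def
    by (rule arg_cong[of _ _ "\<lambda>x. T (fourier x)"]) auto
  have L: "low chi T \<Phi> = T \<Psi>" for T
    unfolding low_def fourier_multiplier_apply \<Phi> \<Psi>_def c_def by (simp add: mult.assoc)
  have U: "sol_u \<sigma> u0 u1 s \<Psi> = pairing u0 (\<lambda>\<xi>. E \<xi> + M0 \<xi>) \<phi> + pairing u1 (\<lambda>\<xi>. E \<xi> + M1 \<xi>) \<phi>"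
  proof -
    have H: "complex_of_real (symb0 \<sigma> s \<xi>) * (of_real (c \<xi>) * inv_fourier \<phi> \<xi>) = (E \<xi> + M0 \<xi>) * inv_fourier \<phi> \<xi>"
      "complex_of_real (symb1 \<sigma> s \<xi>) * (of_real (c \<xi>) * inv_fourier \<phi> \<xi>) = (E \<xi> + M1 \<xi>) * inv_fourier \<phi> \<xi>" for \<xi>
      unfolding symb0_du0 symb1_du1 E_def M0_def M1_def by (simp_all add: algebra_simps)
    show ?thesis
      unfolding sol_u_def dist_inv_fourier_def dist_add_def dist_mult_def dist_fourier_def \<Psi> pairing_def H ..
  qed
  have V: "sol_v \<sigma> (\<lambda>x. u0 x + u1 x) s \<Psi> = pairing (\<lambda>x. u0 x + u1 x) E \<phi>"
  proof -
    have "complex_of_real (exp (- s * norm \<xi> powr (2 * \<sigma>))) * (of_real (c \<xi>) * inv_fourier \<phi> \<xi>) = E \<xi> * inv_fourier \<phi> \<xi>" for \<xi>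
      unfolding E_def by simp
    then show ?thesis
      unfolding sol_v_def dist_inv_fourier_def dist_mult_def dist_fourier_def \<Psi> pairing_def by presburger
  qed
  have "abs_D a (dist_diff (low chi (sol_u \<sigma> u0 u1 s)) (low chi (sol_v \<sigma> (\<lambda>x. u0 x + u1 x) s))) \<phi> =
      pairing u0 (\<lambda>\<xi>. E \<xi> + M0 \<xi>) \<phi> + pairing u1 (\<lambda>\<xi>. E \<xi> + M1 \<xi>) \<phi> - pairing (\<lambda>x. u0 x + u1 x) E \<phi>"
    unfolding A dist_diff_def L U V ..
  also have "\<dots> = pairing u0 M0 \<phi> + pairing u1 M1 \<phi>"
    unfolding pairing_add[OF u(1) i\<phi> wE w0] pairing_add[OF u(2) i\<phi> wE w1] pairing_add_left[OF u i\<phi> wE] by simp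
  finally show ?thesis
    unfolding M0_def[abs_def] M1_def[abs_def] c_def .
qed

section \<open>Time derivatives of the pairings\<close>

lemma has_vector_derivative_quadratic_bound:
  fixes Z :: "real \<Rightarrow> complex"
  assumes "\<And>h. \<bar>h\<bar> \<le> 1 / 2 \<Longrightarrow> norm (Z (t + h) - Z t - of_real h * Y) \<le> K * h\<^sup>2"
  shows "(Z has_vector_derivative Y) (at t)"
proof -
  have "((\<lambda>h. norm (Z (t + h) - Z t - h *\<^sub>R Y) / norm h) \<longlongrightarrow> 0) (at 0)"
  proof (rule Lim_null_comparison)
    have "eventually (\<lambda>h::real. \<bar>h\<bar> < 1 / 2) (at 0)"
      unfolding eventually_at by (intro exI[of _ "1/2"]) auto
    then show "\<forall>\<^sub>F h in at 0. norm (norm (Z (t + h) - Z t - h *\<^sub>R Y) / norm h) \<le> K * \<bar>h\<bar>"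
    proof eventually_elim
      case (elim h)
      then have "norm (Z (t + h) - Z t - h *\<^sub>R Y) \<le> K * \<bar>h\<bar> * \<bar>h\<bar>"
        using assms[of h] by (simp add: scaleR_conv_of_real power2_eq_square)
      then show ?case by (cases "h = 0") (auto simp: divide_simps)
    qed
    have "((\<lambda>h. K * \<bar>h\<bar>) \<longlongrightarrow> K * \<bar>0\<bar>) (at (0::real))"
      by (intro tendsto_intros)
    then show "((\<lambda>h. K * \<bar>h\<bar>) \<longlongrightarrow> 0) (at (0::real))" by simp
  qed
  then show ?thesis
    unfolding has_vector_derivative_def has_derivative_at by (simp add: bounded_linear_scaleR_left)
qed

text \<open>The factor exp (- s) is split off. What is left has the symbol
  \<open>r * zfun s r\<close> times the cut-off power; its Taylor remainder is bounded in kernel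
  norm by \<open>wiener_cutoff_remainder\<close>, and \<open>pairing_bounds\<close> carries this
  over to the pairing. The product rule restores the factor.\<close>

lemma pairing_du0_derivative:
  fixes chi :: "'a::euclidean_space \<Rightarrow> real"
  assumes chi: "radial_cutoff chi" and a: "a \<ge> 0" and \<sigma>: "\<sigma> > 0" and t: "t \<ge> 2"
    and u: "L1_plus_Linf u" and \<phi>: "invertible \<phi>"
  shows "((\<lambda>s. pairing u (\<lambda>\<xi>. of_real (chi \<xi> * pw a \<xi> * du0 \<sigma> 0 s \<xi>)) \<phi>) has_vector_derivative
      pairing u (\<lambda>\<xi>. of_real (chi \<xi> * pw a \<xi> * du0 \<sigma> 1 t \<xi>)) \<phi>) (at t)"
proof -
  define r where "r \<xi> = norm \<xi> powr (2 * \<sigma>)" for \<xi> :: 'a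
  define c where "c \<xi> = chi \<xi> * pw a \<xi>" for \<xi>
  define mZ where "mZ s \<xi> = complex_of_real (c \<xi> * (r \<xi> * zfun s (r \<xi>)))" for s \<xi>
  define mY where "mY \<xi> = complex_of_real (c \<xi> * (r \<xi> * exp (t * (1 - r \<xi>))))" for \<xi>
  have mZ0: "mZ s \<xi> = of_real (exp s) * of_real (chi \<xi> * pw a \<xi> * du0 \<sigma> 0 s \<xi>)" for s \<xi>
    unfolding mZ_def c_def du0_def r_def Let_def
    by (simp add: exp_minus del: of_real_mult flip: of_real_mult)
  have wZ: "\<exists>N. wiener N (mZ s)" if s: "s \<ge> 1" for s
  proof -
    obtain N where "wiener N (\<lambda>\<xi>. complex_of_real (chi \<xi> * pw a \<xi> * du0 \<sigma> 0 s \<xi>))"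
      using wiener_bdd_du(1)[OF chi a \<sigma>, of 0] s wiener_bdd_imp_wiener by blast
    from wiener_cmult[OF this, of "of_real (exp s)"] show ?thesis
      unfolding mZ0[abs_def] by blast
  qed
  have wY: "\<exists>N. wiener N mY"
  proof -
    obtain N where N: "wiener N (\<lambda>\<xi>. complex_of_real (chi \<xi> * pw (a + 2 * \<sigma>) \<xi> * exp (- t * r \<xi>)))"
      using wiener_cutoff_exp[OF chi _ \<sigma>, of "a + 2 * \<sigma>" t] a \<sigma> t unfolding r_def by auto
    have "of_real (exp t) * of_real (chi \<xi> * pw (a + 2 * \<sigma>) \<xi> * exp (- t * r \<xi>)) = mY \<xi>" for \<xi>
    proof -
      have "pw (a + 2 * \<sigma>) \<xi> = pw a \<xi> * r \<xi>"
        using pw_mult[of a "2 * \<sigma>" \<xi>] a \<sigma> by (simp add: pw_pos r_def)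
      moreover have "exp t * exp (- t * r \<xi>) = exp (t * (1 - r \<xi>))"
        by (simp add: mult_exp_exp algebra_simps)
      ultimately have "exp t * (chi \<xi> * pw (a + 2 * \<sigma>) \<xi> * exp (- t * r \<xi>)) = c \<xi> * (r \<xi> * exp (t * (1 - r \<xi>)))"
        by (simp add: c_def mult_ac)
      then show ?thesis
        unfolding mY_def by (metis of_real_mult)
    qed
    with wiener_cmult[OF N, of "of_real (exp t)"] show ?thesis
      by auto
  qed
  obtain K where K: "K \<ge> 0" "\<And>N m. wiener N m \<Longrightarrow> norm (pairing u m \<phi>) \<le> K * N"
    using pairing_bounds[OF u \<phi>] by blast
  obtain C where C: "\<And>h. \<bar>h\<bar> \<le> 1 / 2 \<Longrightarrow> wiener (C * h\<^sup>2)
      (\<lambda>\<xi>. complex_of_real (c \<xi> * (r \<xi> * (zfun (t + h) (r \<xi>) - zfun t (r \<xi>) - h * exp (t * (1 - r \<xi>))))))"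
    using wiener_cutoff_remainder[OF chi a \<sigma>, of t] t unfolding c_def r_def by auto
  define Z where "Z s = pairing u (mZ s) \<phi>" for s
  define Y where "Y = pairing u mY \<phi>"
  have dZ: "(Z has_vector_derivative Y) (at t)"
  proof (rule has_vector_derivative_quadratic_bound)
    fix h :: real assume h: "\<bar>h\<bar> \<le> 1 / 2"
    \<comment> \<open>Here \<open>t \<ge> 2\<close> gives \<open>t + h \<ge> 1\<close>, the range in
      which the symbols are controlled.\<close>
    obtain N1 N2 N3 where N: "wiener N1 (mZ (t + h))" "wiener N2 (mZ t)" "wiener N3 mY"
    proof -
      have "1 \<le> t + h" "1 \<le> t" using h t by linarith+
      then show ?thesis using that wZ[of "t + h"] wZ[of t] wY by blast
    qed
    have "Z (t + h) - Z t - of_real h * Y = pairing u (mZ (t + h)) \<phi> + pairing u (\<lambda>\<xi>. (-1) * mZ t \<xi>) \<phi> + pairing u (\<lambda>\<xi>. (- of_real h) * mY \<xi>) \<phi>"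
      unfolding pairing_cmult by (simp add: Z_def Y_def)
    also have "\<dots> = pairing u (\<lambda>\<xi>. (mZ (t + h) \<xi> + (-1) * mZ t \<xi>) + (- of_real h) * mY \<xi>) \<phi>"
      unfolding pairing_add[OF u \<phi> wiener_add[OF N(1) wiener_cmult[OF N(2)]] wiener_cmult[OF N(3)]]
        pairing_add[OF u \<phi> N(1) wiener_cmult[OF N(2)]] ..
    also have "(\<lambda>\<xi>. (mZ (t + h) \<xi> + (-1) * mZ t \<xi>) + (- of_real h) * mY \<xi>) =
        (\<lambda>\<xi>. complex_of_real (c \<xi> * (r \<xi> * (zfun (t + h) (r \<xi>) - zfun t (r \<xi>) - h * exp (t * (1 - r \<xi>))))))"
      by (simp add: mZ_def mY_def fun_eq_iff algebra_simps)
    finally show "norm (Z (t + h) - Z t - of_real h * Y) \<le> K * C * h\<^sup>2"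
      using K(2)[OF C[OF h]] by (simp add: mult.assoc)
  qed
  have dE: "((\<lambda>s. complex_of_real (exp (- s))) has_vector_derivative of_real (- exp (- t))) (at t)"
    by (intro has_vector_derivative_of_real) (auto intro!: derivative_eq_intros)
  have "((\<lambda>s. of_real (exp (- s)) * Z s) has_vector_derivative of_real (exp (- t)) * Y + of_real (- exp (- t)) * Z t) (at t)"
    by (rule has_vector_derivative_mult[OF dE dZ])
  moreover have "of_real (exp (- s)) * Z s = pairing u (\<lambda>\<xi>. of_real (chi \<xi> * pw a \<xi> * du0 \<sigma> 0 s \<xi>)) \<phi>" for s
  proof -
    have "of_real (exp (- s)) * mZ s \<xi> = of_real (chi \<xi> * pw a \<xi> * du0 \<sigma> 0 s \<xi>)" for \<xi>
      unfolding mZ_def c_def du0_def r_def Let_def by simp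
    then show ?thesis
      unfolding Z_def pairing_cmult[symmetric] by presburger
  qed
  moreover have "of_real (exp (- t)) * Y + of_real (- exp (- t)) * Z t = pairing u (\<lambda>\<xi>. of_real (chi \<xi> * pw a \<xi> * du0 \<sigma> 1 t \<xi>)) \<phi>"
  proof -
    obtain N2 N3 where N: "wiener N2 (mZ t)" "wiener N3 mY"
      using wZ[of t] wY t by auto
    have "of_real (exp (- t)) * Y + of_real (- exp (- t)) * Z t =
        pairing u (\<lambda>\<xi>. of_real (exp (- t)) * mY \<xi> + of_real (- exp (- t)) * mZ t \<xi>) \<phi>"
      unfolding pairing_add[OF u \<phi> wiener_cmult[OF N(2)] wiener_cmult[OF N(1)]] pairing_cmult Y_def Z_def ..
    also have "(\<lambda>\<xi>. of_real (exp (- t)) * mY \<xi> + of_real (- exp (- t)) * mZ t \<xi>) =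
        (\<lambda>\<xi>. complex_of_real (chi \<xi> * pw a \<xi> * du0 \<sigma> 1 t \<xi>))"
    proof
      fix \<xi>
      \<comment> \<open>Trades the exponential in \<open>Y\<close> for \<open>zfun\<close>, the
        function in which \<open>du0\<close> is expressed.\<close>
      have z: "exp (t * (1 - r \<xi>)) = (1 - r \<xi>) * zfun t (r \<xi>) + 1"
        by (simp add: zfun_mult)
      have "exp (- t) * (c \<xi> * (r \<xi> * exp (t * (1 - r \<xi>)))) + - exp (- t) * (c \<xi> * (r \<xi> * zfun t (r \<xi>))) =
          chi \<xi> * pw a \<xi> * du0 \<sigma> 1 t \<xi>"
        unfolding z unfolding du0_def c_def r_def Let_def by (simp add: algebra_simps)
      then show "of_real (exp (- t)) * mY \<xi> + of_real (- exp (- t)) * mZ t \<xi> = complex_of_real (chi \<xi> * pw a \<xi> * du0 \<sigma> 1 t \<xi>)"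
        unfolding mY_def mZ_def by (metis of_real_mult of_real_add)
    qed
    finally show ?thesis .
  qed
  ultimately show ?thesis by simp
qed

text \<open>The two symbols differ by a multiple of exp (- s) that is constant in \<xi>, so the time
  derivative for \<open>du1\<close> follows from the one for \<open>du0\<close>.\<close>

lemma pairing_du1:
  fixes chi :: "'a::euclidean_space \<Rightarrow> real"
  assumes chi: "radial_cutoff chi" and a: "a \<ge> 0" and \<sigma>: "\<sigma> > 0" and s: "s \<ge> 1" and j: "j \<in> {0, 1}"
    and u: "L1_plus_Linf u" and \<phi>: "invertible \<phi>"
  shows "pairing u (\<lambda>\<xi>. of_real (chi \<xi> * pw a \<xi> * du1 \<sigma> j s \<xi>)) \<phi> =
    pairing u (\<lambda>\<xi>. of_real (chi \<xi> * pw a \<xi> * du0 \<sigma> j s \<xi>)) \<phi> -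
    (- 1) ^ j * of_real (exp (- s)) * pairing u (\<lambda>\<xi>. of_real (chi \<xi> * pw a \<xi>)) \<phi>"
proof -
  obtain N where N: "wiener N (\<lambda>\<xi>. complex_of_real (chi \<xi> * pw a \<xi> * du0 \<sigma> j s \<xi>))"
    using wiener_bdd_du(1)[OF chi a \<sigma> j] s wiener_bdd_imp_wiener by blast
  obtain N' where N': "wiener N' (\<lambda>\<xi>. complex_of_real (chi \<xi> * pw a \<xi>))"
    using cutoff_pw_wiener[OF chi a] wiener_bdd_imp_wiener by blast
  have eq: "complex_of_real (chi \<xi> * pw a \<xi> * du1 \<sigma> j s \<xi>) =
      of_real (chi \<xi> * pw a \<xi> * du0 \<sigma> j s \<xi>) + (- ((- 1) ^ j * of_real (exp (- s)))) * of_real (chi \<xi> * pw a \<xi>)" for \<xi>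
    by (simp add: du1_def algebra_simps)
  show ?thesis
    unfolding eq pairing_add[OF u \<phi> N wiener_cmult[OF N']] pairing_cmult by simp
qed

lemma pairing_du1_derivative:
  fixes chi :: "'a::euclidean_space \<Rightarrow> real"
  assumes chi: "radial_cutoff chi" and a: "a \<ge> 0" and \<sigma>: "\<sigma> > 0" and t: "t \<ge> 2"
    and u: "L1_plus_Linf u" and \<phi>: "invertible \<phi>"
  shows "((\<lambda>s. pairing u (\<lambda>\<xi>. of_real (chi \<xi> * pw a \<xi> * du1 \<sigma> 0 s \<xi>)) \<phi>) has_vector_derivative
      pairing u (\<lambda>\<xi>. of_real (chi \<xi> * pw a \<xi> * du1 \<sigma> 1 t \<xi>)) \<phi>) (at t)"
proof -
  define P where "P = pairing u (\<lambda>\<xi>. of_real (chi \<xi> * pw a \<xi>)) \<phi>"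
  have dE: "((\<lambda>s. complex_of_real (exp (- s))) has_vector_derivative of_real (- exp (- t))) (at t)"
    by (intro has_vector_derivative_of_real) (auto intro!: derivative_eq_intros)
  have "((\<lambda>s. pairing u (\<lambda>\<xi>. of_real (chi \<xi> * pw a \<xi> * du0 \<sigma> 0 s \<xi>)) \<phi> - of_real (exp (- s)) * P) has_vector_derivative
      pairing u (\<lambda>\<xi>. of_real (chi \<xi> * pw a \<xi> * du0 \<sigma> 1 t \<xi>)) \<phi> - of_real (- exp (- t)) * P) (at t)"
    by (intro has_vector_derivative_diff pairing_du0_derivative assms has_vector_derivative_mult_left dE)
  \<comment> \<open>\<open>pairing_du1\<close> identifies the two expressions for
    \<open>s \<ge> 1\<close>, hence on the open neighbourhood \<open>{1<..}\<close> of
    \<open>t\<close>.\<close>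
  then show ?thesis
  proof (rule has_vector_derivative_transform_within_open[of _ _ _ "{1<..}", THEN has_vector_derivative_eq_rhs])
    show "pairing u (\<lambda>\<xi>. of_real (chi \<xi> * pw a \<xi> * du0 \<sigma> 0 s \<xi>)) \<phi> - of_real (exp (- s)) * P =
        pairing u (\<lambda>\<xi>. of_real (chi \<xi> * pw a \<xi> * du1 \<sigma> 0 s \<xi>)) \<phi>" if "s \<in> {1<..}" for s
      using pairing_du1[OF chi a \<sigma> _ _ u \<phi>, of s 0] that by (simp add: P_def)
    show "pairing u (\<lambda>\<xi>. of_real (chi \<xi> * pw a \<xi> * du0 \<sigma> 1 t \<xi>)) \<phi> - of_real (- exp (- t)) * P =
        pairing u (\<lambda>\<xi>. of_real (chi \<xi> * pw a \<xi> * du1 \<sigma> 1 t \<xi>)) \<phi>"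
      using pairing_du1[OF chi a \<sigma> _ _ u \<phi>, of t 1] t by (simp add: P_def)
  qed (use t in auto)
qed

text \<open>\<open>difference_eq_pairing\<close> holds on a whole neighbourhood of \<open>t\<close>,
  so the derivative can be taken in the pairings.\<close>

lemma time_deriv_difference_eq_pairing:
  fixes chi :: "'a::euclidean_space \<Rightarrow> real"
  assumes chi: "radial_cutoff chi" and a: "a \<ge> 0" and \<sigma>: "\<sigma> > 0" and t: "t \<ge> 2" and j: "j \<in> {0, 1}"
    and u: "L1_plus_Linf u0" "L1_plus_Linf u1" and \<phi>: "schwartz \<phi>"
  shows "(time_deriv ^^ j) (\<lambda>s. abs_D a (dist_diff (low chi (sol_u \<sigma> u0 u1 s)) (low chi (sol_v \<sigma> (\<lambda>x. u0 x + u1 x) s)))) t \<phi> =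
    pairing u0 (\<lambda>\<xi>. of_real (chi \<xi> * pw a \<xi> * du0 \<sigma> j t \<xi>)) \<phi> +
    pairing u1 (\<lambda>\<xi>. of_real (chi \<xi> * pw a \<xi> * du1 \<sigma> j t \<xi>)) \<phi>"
proof (cases "j = 0")
  case True
  then show ?thesis using difference_eq_pairing[OF chi a \<sigma> _ u \<phi>, of t] t by simp
next
  case False
  then have j1: "j = 1" using j by simp
  have i\<phi>: "invertible \<phi>" by (rule rapid_invertible[OF schwartz_rapid[OF \<phi>]])
  have "((\<lambda>s. pairing u0 (\<lambda>\<xi>. of_real (chi \<xi> * pw a \<xi> * du0 \<sigma> 0 s \<xi>)) \<phi> +
      pairing u1 (\<lambda>\<xi>. of_real (chi \<xi> * pw a \<xi> * du1 \<sigma> 0 s \<xi>)) \<phi>) has_vector_derivative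
      pairing u0 (\<lambda>\<xi>. of_real (chi \<xi> * pw a \<xi> * du0 \<sigma> 1 t \<xi>)) \<phi> +
      pairing u1 (\<lambda>\<xi>. of_real (chi \<xi> * pw a \<xi> * du1 \<sigma> 1 t \<xi>)) \<phi>) (at t)"
    by (intro has_vector_derivative_add pairing_du0_derivative pairing_du1_derivative chi a \<sigma> t u i\<phi>)
  then have "((\<lambda>s. abs_D a (dist_diff (low chi (sol_u \<sigma> u0 u1 s)) (low chi (sol_v \<sigma> (\<lambda>x. u0 x + u1 x) s))) \<phi>) has_vector_derivative
      pairing u0 (\<lambda>\<xi>. of_real (chi \<xi> * pw a \<xi> * du0 \<sigma> 1 t \<xi>)) \<phi> +
      pairing u1 (\<lambda>\<xi>. of_real (chi \<xi> * pw a \<xi> * du1 \<sigma> 1 t \<xi>)) \<phi>) (at t)"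
    by (rule has_vector_derivative_transform_within_open[of _ _ _ "{1<..}"])
       (use t difference_eq_pairing[OF chi a \<sigma> _ u \<phi>] in auto)
  then show ?thesis
    unfolding j1 by (simp add: time_deriv_def vector_derivative_at)
qed

lemma Lp_space_norm_finite: "u \<in> Lp_space p \<Longrightarrow> \<exists>U\<ge>0. Lp_norm p u = ennreal U"
  by (cases "Lp_norm p u") (auto simp: Lp_space_def)

theorem theorem1p2:
  fixes \<sigma> a :: real and p q :: ennreal and j :: nat and chi :: "real ^ 'n \<Rightarrow> real"
  assumes "\<sigma> \<ge> 1"
    and "1 \<le> p" and "p \<le> q"
    and "radial_cutoff chi"
    and "a \<ge> 0" and "j \<in> {0, 1}"
  shows "\<exists>C>0. \<exists>T\<ge>1. \<forall>u0 \<in> Lp_space p. \<forall>u1 \<in> Lp_space p. \<forall>t\<ge>T.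
    dist_Lp_norm q
      ((time_deriv ^^ j)
        (\<lambda>s. abs_D a (dist_diff
          (low chi (sol_u \<sigma> u0 u1 s))
          (low chi (sol_v \<sigma> (\<lambda>x. u0 x + u1 x) s)))) t)
    \<le> ennreal (C * (1 + t) powr
          (- (real CARD('n) / (2 * \<sigma>)) * (enn2real (1 / p) - enn2real (1 / q))
           - a / (2 * \<sigma>) - real j - 1))
      * (Lp_norm p u0 + Lp_norm p u1)"
proof -
  have \<sigma>: "\<sigma> > 0" using assms(1) by simp
  have q1: "1 \<le> q" using assms(2,3) by (rule order_trans)
  define \<gamma> where "\<gamma> = a / (2 * \<sigma>) + real j + 1"
  define \<delta> where "\<delta> = real CARD('n) / (2 * \<sigma>)"
  define \<theta> where "\<theta> = enn2real (1 / p) - enn2real (1 / q)"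
  define m0 where "m0 s \<xi> = complex_of_real (chi \<xi> * pw a \<xi> * du0 \<sigma> j s \<xi>)" for s \<xi>
  define m1 where "m1 s \<xi> = complex_of_real (chi \<xi> * pw a \<xi> * du1 \<sigma> j s \<xi>)" for s \<xi>
  obtain C0 where C0: "\<And>s. s \<ge> 1 \<Longrightarrow> wiener_bdd (C0 * (1 + s) powr - \<gamma>) (C0 * (1 + s) powr - (\<gamma> + \<delta>)) (m0 s)"
    using wiener_bdd_du(1)[OF assms(4,5) \<sigma> assms(6)] unfolding m0_def[abs_def] \<gamma>_def \<delta>_def by auto
  obtain C1 where C1: "\<And>s. s \<ge> 1 \<Longrightarrow> wiener_bdd (C1 * (1 + s) powr - \<gamma>) (C1 * (1 + s) powr - (\<gamma> + \<delta>)) (m1 s)"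
    using wiener_bdd_du(2)[OF assms(4,5) \<sigma> assms(6)] unfolding m1_def[abs_def] \<gamma>_def \<delta>_def by auto
  \<comment> \<open>The maximum with 1 makes \<open>N\<close> and \<open>B\<close> below positive,
    as \<open>Lp_norm_corr_le\<close> requires.\<close>
  define C where "C = max 1 (max C0 C1)"
  have C: "C > 0" "C0 \<le> C" "C1 \<le> C" by (auto simp: C_def)
  define e where "e = - (real CARD('n) / (2 * \<sigma>)) * (enn2real (1 / p) - enn2real (1 / q)) - a / (2 * \<sigma>) - real j - 1"
  have main: "dist_Lp_norm q ((time_deriv ^^ j)
        (\<lambda>s. abs_D a (dist_diff (low chi (sol_u \<sigma> u0 u1 s)) (low chi (sol_v \<sigma> (\<lambda>x. u0 x + u1 x) s)))) t)
      \<le> ennreal (4 * C * (1 + t) powr e) * (Lp_norm p u0 + Lp_norm p u1)"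
    if u: "u0 \<in> Lp_space p" "u1 \<in> Lp_space p" and t: "t \<ge> 2" for u0 u1 t
  proof -
    define N where "N = C * (1 + t) powr - \<gamma>"
    define B where "B = C * (1 + t) powr - (\<gamma> + \<delta>)"
    have NB: "N > 0" "B > 0" using C t by (auto simp: N_def B_def)
    have "wiener_bdd N B (m0 t)" "wiener_bdd N B (m1 t)"
      using C t unfolding N_def B_def
      by (auto intro!: wiener_bdd_mono[OF C0] wiener_bdd_mono[OF C1] mult_right_mono)
    then obtain \<mu>0 \<mu>1 where \<mu>0: "integrable lborel \<mu>0" "(LINT y|lborel. norm (\<mu>0 y)) \<le> N" "\<And>y. norm (\<mu>0 y) \<le> B" "m0 t = ft \<mu>0"
      and \<mu>1: "integrable lborel \<mu>1" "(LINT y|lborel. norm (\<mu>1 y)) \<le> N" "\<And>y. norm (\<mu>1 y) \<le> B" "m1 t = ft \<mu>1"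
      unfolding wiener_bdd_def by metis
    note L = Lp_space_L1_plus_Linf[OF u(1) assms(2)] Lp_space_L1_plus_Linf[OF u(2) assms(2)]
    have [measurable]: "u0 \<in> borel_measurable borel" "u1 \<in> borel_measurable borel"
      "\<mu>0 \<in> borel_measurable borel" "\<mu>1 \<in> borel_measurable borel"
      using L \<mu>0 \<mu>1 unfolding L1_plus_Linf_def by auto
    \<comment> \<open>The function representing the distribution: transposing both convolutions
      moves the kernels from the test function to the data.\<close>
    define g where "g x = corr u0 \<mu>0 x + corr u1 \<mu>1 x" for x
    obtain U0 where U0: "U0 \<ge> 0" "Lp_norm p u0 = ennreal U0" using Lp_space_norm_finite[OF u(1)] by blast
    obtain U1 where U1: "U1 \<ge> 0" "Lp_norm p u1 = ennreal U1" using Lp_space_norm_finite[OF u(2)] by blast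
    \<comment> \<open>The exponents of \<open>1 + t\<close> combine to - \<gamma> - \<delta>
      \<theta>, the rate of the theorem, and those of \<open>C\<close> add up to 1.\<close>
    have M: "N powr (1 - \<theta>) * B powr \<theta> = C * (1 + t) powr e"
    proof -
      have "N powr (1 - \<theta>) * B powr \<theta> = (C powr (1 - \<theta>) * C powr \<theta>) * ((1 + t) powr (- \<gamma> * (1 - \<theta>)) * (1 + t) powr (- (\<gamma> + \<delta>) * \<theta>))"
        by (simp add: N_def B_def powr_mult powr_powr mult_ac)
      also have "\<dots> = C powr 1 * (1 + t) powr (- \<gamma> * (1 - \<theta>) + - (\<gamma> + \<delta>) * \<theta>)"
        unfolding powr_add[symmetric] by simp
      also have "- \<gamma> * (1 - \<theta>) + - (\<gamma> + \<delta>) * \<theta> = e"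
        by (simp add: e_def \<gamma>_def \<delta>_def \<theta>_def algebra_simps add_divide_distrib)
      finally show ?thesis using C by simp
    qed
    have M0: "0 \<le> C * (1 + t) powr e" using C by simp
    have n0: "Lp_norm q (corr u0 \<mu>0) \<le> ennreal (C * (1 + t) powr e * U0)"
      using Lp_norm_corr_le[OF assms(2,3) u(1) \<mu>0(1,2) NB(1) \<mu>0(3) NB(2)] M0 U0
      unfolding \<theta>_def[symmetric] M by (simp add: ennreal_mult'')
    have n1: "Lp_norm q (corr u1 \<mu>1) \<le> ennreal (C * (1 + t) powr e * U1)"
      using Lp_norm_corr_le[OF assms(2,3) u(2) \<mu>1(1,2) NB(1) \<mu>1(3) NB(2)] M0 U1
      unfolding \<theta>_def[symmetric] M by (simp add: ennreal_mult'')
    have ng: "Lp_norm q g \<le> ennreal (4 * (C * (1 + t) powr e * U0 + C * (1 + t) powr e * U1))"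
      unfolding g_def[abs_def] using M0 U0 U1
      by (intro Lp_norm_add_le[OF q1 _ _ n0 n1]) auto
    have gL: "g \<in> Lp_space q"
      using ng unfolding Lp_space_def g_def[abs_def] by (auto intro: le_less_trans)
    have rep: "(time_deriv ^^ j) (\<lambda>s. abs_D a (dist_diff (low chi (sol_u \<sigma> u0 u1 s)) (low chi (sol_v \<sigma> (\<lambda>x. u0 x + u1 x) s)))) t \<phi> = dist_of g \<phi>"
      if \<phi>: "schwartz \<phi>" for \<phi>
    proof -
      have i\<phi>: "invertible \<phi>" by (rule rapid_invertible[OF schwartz_rapid[OF \<phi>]])
      then obtain b where b: "integrable lborel \<phi>" "\<And>x. norm (\<phi> x) \<le> b" unfolding invertible_def by auto
      have f0: "fourier (\<lambda>\<xi>. m0 t \<xi> * inv_fourier \<phi> \<xi>) = conv \<mu>0 \<phi>"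
        unfolding \<mu>0(4) using fourier_multiplier_kernel(1)[OF \<mu>0(1) i\<phi>] by blast
      have f1: "fourier (\<lambda>\<xi>. m1 t \<xi> * inv_fourier \<phi> \<xi>) = conv \<mu>1 \<phi>"
        unfolding \<mu>1(4) using fourier_multiplier_kernel(1)[OF \<mu>1(1) i\<phi>] by blast
      have c0: "integrable lborel (\<lambda>z. corr u0 \<mu>0 z * \<phi> z)" "pairing u0 (m0 t) \<phi> = (LINT z|lborel. corr u0 \<mu>0 z * \<phi> z)"
        using mult_conv_pairing[OF L(1) b] \<mu>0(1) unfolding pairing_def dist_of_def f0 by blast+
      have c1: "integrable lborel (\<lambda>z. corr u1 \<mu>1 z * \<phi> z)" "pairing u1 (m1 t) \<phi> = (LINT z|lborel. corr u1 \<mu>1 z * \<phi> z)"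
        using mult_conv_pairing[OF L(2) b] \<mu>1(1) unfolding pairing_def dist_of_def f1 by blast+
      have "(time_deriv ^^ j) (\<lambda>s. abs_D a (dist_diff (low chi (sol_u \<sigma> u0 u1 s)) (low chi (sol_v \<sigma> (\<lambda>x. u0 x + u1 x) s)))) t \<phi> =
          pairing u0 (m0 t) \<phi> + pairing u1 (m1 t) \<phi>"
        unfolding m0_def[abs_def] m1_def[abs_def]
        by (rule time_deriv_difference_eq_pairing[OF assms(4,5) \<sigma> t assms(6) L \<phi>])
      also have "\<dots> = dist_of g \<phi>"
        using c0 c1 by (simp add: dist_of_def g_def distrib_right)
      finally show ?thesis .
    qed
    \<comment> \<open>\<open>g\<close> is a competitor in the infimum that defines the norm.\<close>
    have "dist_Lp_norm q ((time_deriv ^^ j)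
        (\<lambda>s. abs_D a (dist_diff (low chi (sol_u \<sigma> u0 u1 s)) (low chi (sol_v \<sigma> (\<lambda>x. u0 x + u1 x) s)))) t) \<le> Lp_norm q g"
      unfolding dist_Lp_norm_def using gL rep by (intro Inf_lower) blast
    also have "\<dots> \<le> ennreal (4 * C * (1 + t) powr e * (U0 + U1))"
      using ng by (simp add: algebra_simps)
    also have "\<dots> = ennreal (4 * C * (1 + t) powr e) * (Lp_norm p u0 + Lp_norm p u1)"
      using U0 U1 M0 by (simp add: ennreal_mult'' ennreal_plus[symmetric] del: ennreal_plus)
    finally show ?thesis .
  qed
  \<comment> \<open>The 4 stems from \<open>Lp_norm_add_le\<close>; the time 2 leaves room for steps
    of size 1/2 above time 1.\<close>
  show ?thesis
    unfolding e_def[symmetric]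
    by (intro exI[of _ "4 * C"] exI[of _ 2] conjI ballI allI impI main) (use C in auto)
qed

end
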